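(* Let $n\ge1$ and let $q$ be an integer with $0\le q\le n$. There exist a compact complex manifold $M$ of dimension $n$, equipped with a Hermitian metric, and a holomorphic line bundle $L$ over $M$, equipped with a smooth Hermitian metric, such that for $$\lambda_k:=\inf\{\lambda:\ \lambda\text{ is a non-zero eigenvalue of }\Box^{(q)}_k\}$$ we have $\lim_{k\to\infty}k^N\lambda_k=0$ for every $N>0$.
   Context: $\Box^{(q)}_k=\overline\partial_k\overline\partial_k^{\,*}+\overline\partial_k^{\,*}\overline\partial_k$ is the Kodaira Laplacian on $(0,q)$-forms with values in $L^k=L^{\otimes k}$, where $\overline\partial_k$ is the Cauchy-Riemann operator and $\overline\partial_k^{\,*}$ its adjoint with respect to the $L^2$ inner product defined by the Hermitian metric on $M$ and the metric on $L^k$ induced by that of $L$. Since $M$ is compact, $\Box^{(q)}_k$ has discrete spectrum with finite multiplicities. *)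

theory Defs
  imports "HOL-Analysis.Analysis"
begin

section \<open>Smooth and holomorphic maps\<close>

text \<open>For \<open>S\<close> open: \<open>f\<close> is \<open>k\<close> times continuously differentiable in the real sense.\<close>

fun Ck_on :: "nat \<Rightarrow> ('a::real_normed_vector \<Rightarrow> 'b::real_normed_vector) \<Rightarrow> 'a set \<Rightarrow> bool" where
  "Ck_on 0 f S \<longleftrightarrow> continuous_on S f"
| "Ck_on (Suc k) f S \<longleftrightarrow> (\<forall>x\<in>S. f differentiable (at x)) \<and>
     (\<forall>v. Ck_on k (\<lambda>x. frechet_derivative f (at x) v) S)"

definition smooth_map_on :: "('a::real_normed_vector \<Rightarrow> 'b::real_normed_vector) \<Rightarrow> 'a set \<Rightarrow> bool" where
  "smooth_map_on f S \<longleftrightarrow> (\<forall>k. Ck_on k f S)"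

text \<open>Holomorphy in several variables, on an open set \<open>S\<close>: real differentiability with
  complex linear derivative.  The vector-valued and the scalar-valued notion are separate because
  scalar multiplication is \<open>*s\<close> on vectors and \<open>*\<close> on \<open>complex\<close>.\<close>

definition holomorphic_map_on :: "(complex^'n \<Rightarrow> complex^'m) \<Rightarrow> (complex^'n) set \<Rightarrow> bool" where
  "holomorphic_map_on f S \<longleftrightarrow>
     (\<forall>z\<in>S. \<exists>D. (f has_derivative D) (at z) \<and> (\<forall>t v. D (t *s v) = t *s D v))"

definition holomorphic_fun_on :: "(complex^'n \<Rightarrow> complex) \<Rightarrow> (complex^'n) set \<Rightarrow> bool" where
  "holomorphic_fun_on f S \<longleftrightarrow>
     (\<forall>z\<in>S. \<exists>D. (f has_derivative D) (at z) \<and> (\<forall>t v. D (t *s v) = t * D v))"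

text \<open>\<open>dbar_deriv f z v\<close> is \<open>\<Sum>\<^sub>j (\<partial>f/\<partial>(cnj z\<^sub>j)) * cnj (v\<^sub>j)\<close>, the conjugate linear part of the
  real derivative of \<open>f\<close>.\<close>

definition dbar_deriv :: "(complex^'n \<Rightarrow> complex) \<Rightarrow> complex^'n \<Rightarrow> complex^'n \<Rightarrow> complex" where
  "dbar_deriv f z v =
     (frechet_derivative f (at z) v + \<i> * frechet_derivative f (at z) (\<i> *s v)) / 2"


section \<open>Complex manifolds and Hermitian metrics\<close>

text \<open>A chart is a pair of its domain and its coordinate map; values of the coordinate map
  outside the domain are irrelevant.  The points of a compact manifold of dimension \<open>CARD('n)\<close> can
  always be taken in the type \<open>(complex^'n) \<times> (complex^'n)\<close>, by Whitney's embedding theorem or just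
  because there are at most continuum many of them; its topology is the field \<open>pts\<close>, not the one
  of the type.\<close>

type_synonym ('a, 'n) chart = "'a set \<times> ('a \<Rightarrow> complex^'n)"

record ('a, 'n) cmanifold =
  pts :: "'a topology"
  charts :: "('a, 'n) chart set"

definition chart_inv :: "('a, 'n) chart \<Rightarrow> complex^'n \<Rightarrow> 'a" where
  "chart_inv c = inv_into (fst c) (snd c)"

definition chart_change :: "('a, 'n) chart \<Rightarrow> ('a, 'n) chart \<Rightarrow> complex^'n \<Rightarrow> complex^'n" where
  "chart_change c d = snd d \<circ> chart_inv c"

text \<open>The differential at \<open>p\<close> of the change of coordinates from \<open>c\<close> to \<open>d\<close>: it sends the
  coordinates of a tangent vector in the chart \<open>c\<close> to those in the chart \<open>d\<close>.\<close>

definition chart_change_deriv ::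
    "('a, 'n::finite) chart \<Rightarrow> ('a, 'n) chart \<Rightarrow> 'a \<Rightarrow> complex^'n \<Rightarrow> complex^'n" where
  "chart_change_deriv c d p = frechet_derivative (chart_change c d) (at (snd c p))"

definition complex_manifold :: "('a, 'n::finite) cmanifold \<Rightarrow> bool" where
  "complex_manifold M \<longleftrightarrow>
     Hausdorff_space (pts M) \<and> second_countable (pts M) \<and>
     (\<Union>c\<in>charts M. fst c) = topspace (pts M) \<and>
     (\<forall>c\<in>charts M. openin (pts M) (fst c) \<and> open (snd c ` fst c) \<and>
        homeomorphic_map (subtopology (pts M) (fst c)) (top_of_set (snd c ` fst c)) (snd c)) \<and>
     (\<forall>c\<in>charts M. \<forall>d\<in>charts M.
        holomorphic_map_on (chart_change c d) (snd c ` (fst c \<inter> fst d)))"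

text \<open>A Hermitian metric, on the holomorphic tangent bundle: \<open>h c p v w\<close> is the product of the
  tangent vectors at \<open>p\<close> that have coordinates \<open>v\<close> and \<open>w\<close> in the chart \<open>c\<close>.\<close>

type_synonym ('a, 'n) tangent_metric =
  "('a, 'n) chart \<Rightarrow> 'a \<Rightarrow> complex^'n \<Rightarrow> complex^'n \<Rightarrow> complex"

definition hermitian_metric ::
    "('a, 'n::finite) cmanifold \<Rightarrow> ('a, 'n) tangent_metric \<Rightarrow> bool" where
  "hermitian_metric M h \<longleftrightarrow>
     (\<forall>c\<in>charts M. \<forall>p\<in>fst c.
        (\<forall>u v w. h c p (u + v) w = h c p u w + h c p v w) \<and>
        (\<forall>t v w. h c p (t *s v) w = t * h c p v w) \<and>
        (\<forall>v w. h c p w v = cnj (h c p v w)) \<and>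
        (\<forall>v. v \<noteq> 0 \<longrightarrow> Re (h c p v v) > 0)) \<and>
     (\<forall>c\<in>charts M. \<forall>v w. smooth_map_on (\<lambda>z. h c (chart_inv c z) v w) (snd c ` fst c)) \<and>
     (\<forall>c\<in>charts M. \<forall>d\<in>charts M. \<forall>p\<in>fst c \<inter> fst d. \<forall>v w.
        h c p v w = h d p (chart_change_deriv c d p v) (chart_change_deriv c d p w))"

text \<open>The Riemannian volume measure: the Borel measure that in every chart has density
  \<open>det (h\<^sub>a\<^sub>b)\<close> with respect to Lebesgue measure on the coordinate domain.\<close>

definition is_volume_measure ::
    "('a, 'n::finite) cmanifold \<Rightarrow> ('a, 'n) tangent_metric \<Rightarrow> 'a measure \<Rightarrow> bool" where
  "is_volume_measure M h \<mu> \<longleftrightarrow>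
     space \<mu> = topspace (pts M) \<and>
     sets \<mu> = sigma_sets (topspace (pts M)) {U. openin (pts M) U} \<and>
     (\<forall>c\<in>charts M. \<forall>B\<in>sets \<mu>. B \<subseteq> fst c \<longrightarrow>
        emeasure \<mu> B =
          (\<integral>\<^sup>+z\<in>snd c ` B.
             ennreal (Re (det (\<chi> a b. h c (chart_inv c z) (axis a 1) (axis b 1)))) \<partial>lborel))"

definition volume_measure ::
    "('a, 'n::finite) cmanifold \<Rightarrow> ('a, 'n) tangent_metric \<Rightarrow> 'a measure" where
  "volume_measure M h = (THE \<mu>. is_volume_measure M h \<mu>)"


section \<open>Hermitian holomorphic line bundles\<close>

text \<open>A line bundle is given by local holomorphic frames \<open>e\<^sub>i\<close> over the sets of an open cover,
  through their transition functions: a section \<open>s = s\<^sub>i e\<^sub>i\<close> satisfies \<open>s\<^sub>i = trans_fun L i j * s\<^sub>j\<close>.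
  Over a compact manifold finitely many frames suffice, so \<open>'i = nat\<close> is no restriction.\<close>

record ('a, 'i) line_bundle =
  frames :: "'i set"
  fdom :: "'i \<Rightarrow> 'a set"
  trans_fun :: "'i \<Rightarrow> 'i \<Rightarrow> 'a \<Rightarrow> complex"

definition holomorphic_line_bundle ::
    "('a, 'n::finite) cmanifold \<Rightarrow> ('a, 'i) line_bundle \<Rightarrow> bool" where
  "holomorphic_line_bundle M L \<longleftrightarrow>
     (\<forall>i\<in>frames L. openin (pts M) (fdom L i)) \<and>
     (\<Union>i\<in>frames L. fdom L i) = topspace (pts M) \<and>
     (\<forall>i\<in>frames L. \<forall>j\<in>frames L. \<forall>p\<in>fdom L i \<inter> fdom L j. trans_fun L i j p \<noteq> 0) \<and>
     (\<forall>i\<in>frames L. \<forall>j\<in>frames L. \<forall>l\<in>frames L. \<forall>p\<in>fdom L i \<inter> fdom L j \<inter> fdom L l.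
        trans_fun L i j p * trans_fun L j l p = trans_fun L i l p) \<and>
     (\<forall>i\<in>frames L. \<forall>j\<in>frames L. \<forall>c\<in>charts M.
        holomorphic_fun_on (\<lambda>z. trans_fun L i j (chart_inv c z))
          (snd c ` (fst c \<inter> fdom L i \<inter> fdom L j)))"

text \<open>A Hermitian metric on the bundle: \<open>a i p\<close> is the squared norm of the frame \<open>e\<^sub>i\<close> at \<open>p\<close>.\<close>

definition bundle_metric ::
    "('a, 'n::finite) cmanifold \<Rightarrow> ('a, 'i) line_bundle \<Rightarrow> ('i \<Rightarrow> 'a \<Rightarrow> real) \<Rightarrow> bool" where
  "bundle_metric M L a \<longleftrightarrow>
     (\<forall>i\<in>frames L. \<forall>p\<in>fdom L i. a i p > 0) \<and>
     (\<forall>i\<in>frames L. \<forall>c\<in>charts M.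
        smooth_map_on (\<lambda>z. a i (chart_inv c z)) (snd c ` (fst c \<inter> fdom L i))) \<and>
     (\<forall>i\<in>frames L. \<forall>j\<in>frames L. \<forall>p\<in>fdom L i \<inter> fdom L j.
        a j p = (cmod (trans_fun L i j p))\<^sup>2 * a i p)"

text \<open>The tensor power and the induced metric, with respect to the frames \<open>e\<^sub>i\<^sup>\<otimes>\<^sup>k\<close>.\<close>

definition bundle_power :: "('a, 'i) line_bundle \<Rightarrow> nat \<Rightarrow> ('a, 'i) line_bundle" where
  "bundle_power L k = L\<lparr>trans_fun := (\<lambda>i j p. trans_fun L i j p ^ k)\<rparr>"

definition metric_power :: "('i \<Rightarrow> 'a \<Rightarrow> real) \<Rightarrow> nat \<Rightarrow> 'i \<Rightarrow> 'a \<Rightarrow> real" where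
  "metric_power a k = (\<lambda>i p. a i p ^ k)"


section \<open>Forms of type (0,q) with values in a line bundle\<close>

text \<open>A \<open>(0,q)\<close>-covector on \<open>\<complex>\<^sup>n\<close> is an alternating conjugate-multilinear function of \<open>q\<close>
  vectors, given as a list; in particular \<open>d(cnj z\<^sub>j)\<close> is \<open>\<lambda>[v]. cnj (v $ j)\<close>.\<close>

definition antilinear_alternating :: "nat \<Rightarrow> ((complex^'n) list \<Rightarrow> complex) \<Rightarrow> bool" where
  "antilinear_alternating q f \<longleftrightarrow>
     (\<forall>vs l v w. length vs = q \<and> l < q \<longrightarrow>
        f (vs[l := v + w]) = f (vs[l := v]) + f (vs[l := w])) \<and>
     (\<forall>vs l t v. length vs = q \<and> l < q \<longrightarrow> f (vs[l := t *s v]) = cnj t * f (vs[l := v])) \<and>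
     (\<forall>vs l m. length vs = q \<and> l < m \<and> m < q \<and> vs ! l = vs ! m \<longrightarrow> f vs = 0)"

text \<open>\<open>\<alpha> c i p vs\<close> is the coefficient with respect to the frame \<open>e\<^sub>i\<close> of the value of the form at
  \<open>p\<close> on the tangent vectors with coordinates \<open>vs\<close> in the chart \<open>c\<close>.  It is required to be zero
  where this makes no sense, so that equality of forms is equality of functions.\<close>

type_synonym ('a, 'n, 'i) form =
  "('a, 'n) chart \<Rightarrow> 'i \<Rightarrow> 'a \<Rightarrow> (complex^'n) list \<Rightarrow> complex"

definition at_point ::
    "('a, 'n) cmanifold \<Rightarrow> ('a, 'i) line_bundle \<Rightarrow> 'a \<Rightarrow> ('a, 'n) chart \<Rightarrow> 'i \<Rightarrow> bool" where
  "at_point M L p c i \<longleftrightarrow> c \<in> charts M \<and> i \<in> frames L \<and> p \<in> fst c \<inter> fdom L i"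

definition smooth_forms ::
    "('a, 'n::finite) cmanifold \<Rightarrow> ('a, 'i) line_bundle \<Rightarrow> nat \<Rightarrow> ('a, 'n, 'i) form set" where
  "smooth_forms M L q = {\<alpha>.
     (\<forall>c i p vs. \<not> (at_point M L p c i \<and> length vs = q) \<longrightarrow> \<alpha> c i p vs = 0) \<and>
     (\<forall>c i p. at_point M L p c i \<longrightarrow> antilinear_alternating q (\<alpha> c i p)) \<and>
     (\<forall>c i d j p vs. at_point M L p c i \<and> at_point M L p d j \<longrightarrow>
        \<alpha> c i p vs = trans_fun L i j p * \<alpha> d j p (map (chart_change_deriv c d p) vs)) \<and>
     (\<forall>c\<in>charts M. \<forall>i\<in>frames L. \<forall>vs.
        smooth_map_on (\<lambda>z. \<alpha> c i (chart_inv c z) vs) (snd c ` (fst c \<inter> fdom L i)))}"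

text \<open>The Cauchy-Riemann operator, by the usual formula for an exterior derivative on constant
  vector fields.\<close>

definition dbar ::
    "('a, 'n::finite) cmanifold \<Rightarrow> ('a, 'i) line_bundle \<Rightarrow> ('a, 'n, 'i) form \<Rightarrow> ('a, 'n, 'i) form" where
  "dbar M L \<alpha> = (\<lambda>c i p vs.
     if at_point M L p c i
     then (\<Sum>l<length vs. (-1) ^ l *
        dbar_deriv (\<lambda>z. \<alpha> c i (chart_inv c z) (take l vs @ drop (Suc l) vs)) (snd c p) (vs ! l))
     else 0)"


section \<open>The Kodaira Laplacian and its spectrum\<close>

text \<open>The product \<open>\<langle>\<alpha>, \<beta>\<rangle>\<close> at \<open>p\<close> of two \<open>(0,q)\<close>-forms, computed in an arbitrary chart \<open>c\<close>, frame
  \<open>e\<^sub>i\<close> and orthonormal basis \<open>u\<close> of the tangent space.  The factor \<open>1/q!\<close> makes the products of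
  the dual basis that have increasing indices orthonormal.\<close>

definition form_product ::
    "('a, 'n::finite) cmanifold \<Rightarrow> ('a, 'n) tangent_metric \<Rightarrow> ('a, 'i) line_bundle \<Rightarrow>
     ('i \<Rightarrow> 'a \<Rightarrow> real) \<Rightarrow> nat \<Rightarrow> ('a, 'n, 'i) form \<Rightarrow> ('a, 'n, 'i) form \<Rightarrow> 'a \<Rightarrow> complex" where
  "form_product M h L a q \<alpha> \<beta> p =
     (let (c, i) = (SOME (c, i). at_point M L p c i);
          u = (SOME u :: 'n \<Rightarrow> complex^'n. \<forall>j l. h c p (u j) (u l) = (if j = l then 1 else 0))
      in (\<Sum>J\<in>{J :: 'n list. length J = q}. \<alpha> c i p (map u J) * cnj (\<beta> c i p (map u J)))
           * of_real (a i p) / fact q)"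

definition L2_product ::
    "('a, 'n::finite) cmanifold \<Rightarrow> ('a, 'n) tangent_metric \<Rightarrow> ('a, 'i) line_bundle \<Rightarrow>
     ('i \<Rightarrow> 'a \<Rightarrow> real) \<Rightarrow> nat \<Rightarrow> ('a, 'n, 'i) form \<Rightarrow> ('a, 'n, 'i) form \<Rightarrow> complex" where
  "L2_product M h L a q \<alpha> \<beta> = (LINT p|volume_measure M h. form_product M h L a q \<alpha> \<beta> p)"

text \<open>The adjoint of the Cauchy-Riemann operator from \<open>(0,q)\<close>-forms to \<open>(0,q+1)\<close>-forms.\<close>

definition dbar_adjoint ::
    "('a, 'n::finite) cmanifold \<Rightarrow> ('a, 'n) tangent_metric \<Rightarrow> ('a, 'i) line_bundle \<Rightarrow>
     ('i \<Rightarrow> 'a \<Rightarrow> real) \<Rightarrow> nat \<Rightarrow> ('a, 'n, 'i) form \<Rightarrow> ('a, 'n, 'i) form" where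
  "dbar_adjoint M h L a q \<beta> =
     (THE \<gamma>. \<gamma> \<in> smooth_forms M L q \<and>
        (\<forall>\<alpha>\<in>smooth_forms M L q.
           L2_product M h L a (Suc q) (dbar M L \<alpha>) \<beta> = L2_product M h L a q \<alpha> \<gamma>))"

text \<open>The Laplacian on smooth \<open>(0,q)\<close>-forms; on functions the first summand is absent.\<close>

definition kodaira_laplacian ::
    "('a, 'n::finite) cmanifold \<Rightarrow> ('a, 'n) tangent_metric \<Rightarrow> ('a, 'i) line_bundle \<Rightarrow>
     ('i \<Rightarrow> 'a \<Rightarrow> real) \<Rightarrow> nat \<Rightarrow> ('a, 'n, 'i) form \<Rightarrow> ('a, 'n, 'i) form" where
  "kodaira_laplacian M h L a q \<alpha> = (\<lambda>c i p vs.
     (case q of 0 \<Rightarrow> 0 | Suc r \<Rightarrow> dbar M L (dbar_adjoint M h L a r \<alpha>) c i p vs) +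
     dbar_adjoint M h L a q (dbar M L \<alpha>) c i p vs)"

text \<open>On a compact manifold the \<open>L\<^sup>2\<close> eigenforms are smooth, and eigenvalues are real.\<close>

definition laplacian_eigenvalue ::
    "('a, 'n::finite) cmanifold \<Rightarrow> ('a, 'n) tangent_metric \<Rightarrow> ('a, 'i) line_bundle \<Rightarrow>
     ('i \<Rightarrow> 'a \<Rightarrow> real) \<Rightarrow> nat \<Rightarrow> real \<Rightarrow> bool" where
  "laplacian_eigenvalue M h L a q \<mu> \<longleftrightarrow>
     (\<exists>\<alpha>\<in>smooth_forms M L q. \<alpha> \<noteq> (\<lambda>c i p vs. 0) \<and>
        kodaira_laplacian M h L a q \<alpha> = (\<lambda>c i p vs. of_real \<mu> * \<alpha> c i p vs))"

text \<open>The infimum is taken in \<open>ereal\<close>, so it is \<open>\<infinity>\<close> if there is no non-zero eigenvalue.\<close>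

definition inf_nonzero_eigenvalue ::
    "('a, 'n::finite) cmanifold \<Rightarrow> ('a, 'n) tangent_metric \<Rightarrow> ('a, 'i) line_bundle \<Rightarrow>
     ('i \<Rightarrow> 'a \<Rightarrow> real) \<Rightarrow> nat \<Rightarrow> ereal" where
  "inf_nonzero_eigenvalue M h L a q =
     Inf {ereal \<mu> | \<mu>. \<mu> \<noteq> 0 \<and> laplacian_eigenvalue M h L a q \<mu>}"

end

theory Submission
  imports Defs
begin

text \<open>The phenomenon behind the theorem is tunnelling between two wells of the weight.  Let \<open>M\<close> be
  the flat torus \<open>\<complex>\<^sup>n / (2\<pi>\<int> + 2\<pi>i\<int>)\<^sup>n\<close> and \<open>L\<close> the trivial bundle with the metric
  \<open>exp (- (cos x)\<^sup>2)\<close>, where \<open>x\<close> is the real part of one coordinate \<open>z\<^sub>j\<close>.  The metric of \<open>L\<^sup>k\<close> is the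
  weight \<open>w = exp (- k (cos x)\<^sup>2)\<close>.  It concentrates at \<open>x = \<pi>/2\<close> and \<open>x = - \<pi>/2\<close> and is
  exponentially small in between.  An odd function of \<open>x\<close> that is \<open>1\<close> near one maximum of \<open>w\<close> and \<open>- 1\<close>
  near the other is orthogonal to the constants, and its derivative lives where \<open>w\<close> is exponentially
  small; so the Laplacian on functions must have an exponentially small non-zero eigenvalue.

  Because everything depends on \<open>x\<close> only, this becomes a statement about an ordinary differential
  equation.  A function \<open>f (x)\<close> is an eigenfunction for \<open>l / 4\<close> iff \<open>(w f')' = - l w f\<close>.  By the
  symmetries of \<open>w\<close>, a solution with \<open>f 0 = 0\<close> and \<open>f' (\<pi>/2) = 0\<close> extends to a smooth periodic
  one, and the smallest such \<open>l\<close> is found by shooting; comparing the sizes of \<open>w\<close> near \<open>0\<close> and near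
  \<open>\<pi>/2\<close> gives \<open>0 < l \<le> 4 exp (- k / 2)\<close>.  That is
  \<open>exponentially_small_periodic_eigenvalue\<close>.

  In degree \<open>q = 0\<close> the eigenform is \<open>f\<close> itself.  In degree \<open>q = r + 1\<close> it is
  \<open>f' d(cnj z\<^sub>j) \<and> d(cnj z\<^sub>J)\<close> with \<open>J\<close> a list of \<open>r\<close> distinct indices other than \<open>j\<close>, that is, up to a
  factor the image of \<open>f d(cnj z\<^sub>J)\<close> under the Cauchy-Riemann operator; it has the same eigenvalue
  (\<open>small_eigenvalue\<close>).

  An eigenvalue close to zero only bounds the infimum from above.  That the infimum is not negative
  needs the adjoint of the Cauchy-Riemann operator on all smooth forms
  (\<open>dbar_adjoint_form_of\<close>), which in turn rests on integration by parts on the torus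
  (\<open>torus_integral_derivative\<close>).  Integration by parts is obtained from the invariance of the volume
  under translations, and that invariance from the uniqueness of the volume measure
  (\<open>torus_volume_measure_unique\<close>).  Forms on the torus are handled throughout as periodic families
  of covectors on \<open>\<complex>\<^sup>n\<close> (\<open>smooth_form_obtain\<close>).\<close>

section \<open>Calculus of smooth maps\<close>

text \<open>The function \<open>frechet_derivative\<close> is a choice operator, so a derivative that was computed by
  the derivative rules agrees with it only on \<open>S\<close>.  This rule hides that difference; all closure
  properties below are inductions that use it for the step.\<close>

lemma Ck_on_SucI:
  assumes "\<And>x. x \<in> S \<Longrightarrow> (f has_derivative D x) (at x)" "\<And>v. Ck_on k (\<lambda>x. D x v) S" "open S"
  shows "Ck_on (Suc k) f S"
proof -
  have eq: "frechet_derivative f (at x) = D x" if "x \<in> S" for x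
    using frechet_derivative_at[OF assms(1)[OF that]] by simp
  have cong: "Ck_on k g S" if "Ck_on k h S" "\<And>x. x \<in> S \<Longrightarrow> h x = g x" "open S"
    for g h :: "'a \<Rightarrow> 'b" and k
    using that
  proof (induction k arbitrary: g h)
    case 0
    then show ?case by (simp cong: continuous_on_cong)
  next
    case (Suc k)
    have *: "g differentiable at x" "frechet_derivative g (at x) = frechet_derivative h (at x)"
      if "x \<in> S" for x
    proof -
      have hd: "h differentiable at x"
        using Suc.prems(1) that by simp
      show "g differentiable at x"
        using hd Suc.prems(2,3) that unfolding differentiable_def
        by (meson has_derivative_transform_within_open)
      show "frechet_derivative g (at x) = frechet_derivative h (at x)"
        using frechet_derivative_transform_within_open[OF hd Suc.prems(3) that] Suc.prems(2)
        by metis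
    qed
    have "Ck_on k (\<lambda>x. frechet_derivative g (at x) v) S" for v
      using Suc.IH[of "\<lambda>x. frechet_derivative h (at x) v"] Suc.prems * by simp
    with * show ?case by simp
  qed
  have "Ck_on k (\<lambda>x. frechet_derivative f (at x) v) S" for v
    by (rule cong[OF assms(2)[of v] _ assms(3)]) (simp add: eq)
  then show ?thesis
    using assms(1) unfolding Ck_on.simps differentiable_def by blast
qed

lemma Ck_on_SucD:
  assumes "Ck_on (Suc k) f S"
  shows "x \<in> S \<Longrightarrow> (f has_derivative frechet_derivative f (at x)) (at x)"
    and "Ck_on k (\<lambda>x. frechet_derivative f (at x) v) S"
  using assms by (auto simp flip: frechet_derivative_works)

lemma Ck_on_pred: "Ck_on (Suc k) f S \<Longrightarrow> Ck_on k f S"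
proof (induction k arbitrary: f)
  case 0
  then have "\<And>x. x \<in> S \<Longrightarrow> isCont f x"
    by (simp add: differentiable_imp_continuous_within)
  then show ?case by (simp add: continuous_at_imp_continuous_on)
next
  case (Suc k)
  then show ?case by (metis Ck_on.simps(2))
qed

lemma Ck_on_imp_continuous_on: "Ck_on k f S \<Longrightarrow> continuous_on S f"
  by (induction k) (use Ck_on.simps(1) Ck_on_pred in blast)+

lemma Ck_on_cong:
  assumes "Ck_on k f S" "\<And>x. x \<in> S \<Longrightarrow> f x = g x" "open S"
  shows "Ck_on k g S"
proof (cases k)
  case 0
  with assms show ?thesis by (simp cong: continuous_on_cong)
next
  case (Suc l)
  show ?thesis unfolding Suc
  proof (rule Ck_on_SucI)
    show "(g has_derivative frechet_derivative f (at x)) (at x)" if "x \<in> S" for x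
      using has_derivative_transform_within_open[OF Ck_on_SucD(1) assms(3) that] assms that Suc
      by blast
    show "Ck_on l (\<lambda>x. frechet_derivative f (at x) v) S" for v
      using assms(1) Suc by simp
  qed fact
qed

lemma Ck_on_subset:
  assumes "Ck_on k f S" "U \<subseteq> S"
  shows "Ck_on k f U"
  using assms
proof (induction k arbitrary: f)
  case 0
  then show ?case by (simp add: continuous_on_subset)
qed auto

text \<open>Smoothness is local; this is how forms that are smooth in every chart become smooth on
  \<open>\<complex>\<^sup>n\<close>.\<close>

lemma Ck_on_UN:
  assumes "\<And>i. i \<in> I \<Longrightarrow> Ck_on k f (U i)" "\<And>i. i \<in> I \<Longrightarrow> open (U i)"
  shows "Ck_on k f (\<Union>i\<in>I. U i)"
  using assms
proof (induction k arbitrary: f)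
  case 0
  then show ?case by (simp add: continuous_on_open_UN)
qed auto

lemma Ck_on_const: "open S \<Longrightarrow> Ck_on k (\<lambda>x. c) S"
proof (induction k arbitrary: c)
  case (Suc k)
  show ?case by (rule Ck_on_SucI[where D = "\<lambda>x v. 0"]) (use Suc in auto)
qed auto

lemma Ck_on_bounded_linear:
  assumes "bounded_linear h" "Ck_on k f S" "open S"
  shows "Ck_on k (\<lambda>x. h (f x)) S"
  using assms(2)
proof (induction k arbitrary: f)
  case 0
  then show ?case by (simp add: bounded_linear.continuous_on[OF assms(1)])
next
  case (Suc k)
  show ?case
    by (rule Ck_on_SucI[OF bounded_linear.has_derivative[OF assms(1) Ck_on_SucD(1)[OF Suc.prems]]
          Suc.IH[OF Ck_on_SucD(2)[OF Suc.prems]] assms(3)])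
qed

lemma Ck_on_compose_linear:
  assumes "bounded_linear l" "Ck_on k f UNIV" "open S"
  shows "Ck_on k (\<lambda>x. f (l x)) S"
  using assms(2)
proof (induction k arbitrary: f)
  case 0
  have "continuous_on S l" by (simp add: assms(1) linear_continuous_on)
  then show ?case using 0 by (auto intro: continuous_on_compose2)
next
  case (Suc k)
  show ?case
  proof (rule Ck_on_SucI)
    show "((\<lambda>x. f (l x)) has_derivative (\<lambda>v. frechet_derivative f (at (l x)) (l v))) (at x)" for x
      using diff_chain_at[OF bounded_linear.has_derivative[OF assms(1) has_derivative_ident]
          Ck_on_SucD(1)[OF Suc.prems]] by (simp add: o_def)
    show "Ck_on k (\<lambda>x. frechet_derivative f (at (l x)) (l v)) S" for v
      by (rule Suc.IH[OF Ck_on_SucD(2)[OF Suc.prems]])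
  qed fact
qed

lemma Ck_on_add:
  assumes "Ck_on k f S" "Ck_on k g S" "open S"
  shows "Ck_on k (\<lambda>x. f x + g x) S"
  using assms(1,2)
proof (induction k arbitrary: f g)
  case 0
  then show ?case by (simp add: continuous_on_add)
next
  case (Suc k)
  show ?case
    by (rule Ck_on_SucI[OF has_derivative_add[OF Ck_on_SucD(1)[OF Suc.prems(1)] Ck_on_SucD(1)[OF Suc.prems(2)]]])
      (use Suc assms(3) in auto)
qed

lemma Ck_on_uminus: "Ck_on k f S \<Longrightarrow> open S \<Longrightarrow> Ck_on k (\<lambda>x. - f x) S"
  using Ck_on_bounded_linear[OF bounded_linear_minus[OF bounded_linear_ident]] by blast

lemma Ck_on_diff: "Ck_on k f S \<Longrightarrow> Ck_on k g S \<Longrightarrow> open S \<Longrightarrow> Ck_on k (\<lambda>x. f x - g x) S"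
  using Ck_on_add[of k f S "\<lambda>x. - g x"] Ck_on_uminus by force

lemma Ck_on_sum:
  "(\<And>i. i \<in> I \<Longrightarrow> Ck_on k (f i) S) \<Longrightarrow> open S \<Longrightarrow> Ck_on k (\<lambda>x. \<Sum>i\<in>I. f i x) S"
  by (induction I rule: infinite_finite_induct) (auto intro: Ck_on_add Ck_on_const)

lemma Ck_on_mult:
  fixes f g :: "'a::real_normed_vector \<Rightarrow> 'b::real_normed_algebra"
  assumes "Ck_on k f S" "Ck_on k g S" "open S"
  shows "Ck_on k (\<lambda>x. f x * g x) S"
  using assms(1,2)
proof (induction k arbitrary: f g)
  case 0
  then show ?case by (simp add: continuous_on_mult)
next
  case (Suc k)
  have "Ck_on k f S" "Ck_on k g S"
    using Suc.prems Ck_on_pred by blast+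
  then show ?case
    by (intro Ck_on_SucI[OF has_derivative_mult[OF Ck_on_SucD(1)[OF Suc.prems(1)] Ck_on_SucD(1)[OF Suc.prems(2)]]])
      (use assms(3) in \<open>auto intro!: Ck_on_add Suc.IH Ck_on_SucD(2) Suc.prems\<close>)
qed

lemma Ck_on_power:
  fixes f :: "'a::real_normed_vector \<Rightarrow> 'b::real_normed_algebra_1"
  shows "Ck_on k f S \<Longrightarrow> open S \<Longrightarrow> Ck_on k (\<lambda>x. f x ^ m) S"
  by (induction m) (auto intro: Ck_on_mult Ck_on_const)

lemma Ck_on_inverse:
  fixes f :: "'a::real_normed_vector \<Rightarrow> 'b::real_normed_field"
  assumes "Ck_on k f S" "\<And>x. x \<in> S \<Longrightarrow> f x \<noteq> 0" "open S"
  shows "Ck_on k (\<lambda>x. inverse (f x)) S"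
  using assms(1)
proof (induction k)
  case 0
  then show ?case using assms by (auto intro!: continuous_on_inverse)
next
  case (Suc k)
  have IH: "Ck_on k (\<lambda>x. inverse (f x)) S"
    using Suc.IH Suc.prems Ck_on_pred by blast
  show ?case
    by (rule Ck_on_SucI[OF Deriv.has_derivative_inverse[OF assms(2) Ck_on_SucD(1)[OF Suc.prems(1)]]])
      (use Suc.prems assms(3) IH in \<open>auto intro!: Ck_on_uminus Ck_on_mult\<close>)
qed

text \<open>Solutions of differential equations gain one derivative at a time through this rule.\<close>

lemma Ck_on_real_derivative:
  fixes f f' :: "real \<Rightarrow> real"
  assumes "\<And>x. (f has_real_derivative f' x) (at x)" "Ck_on k f' UNIV"
  shows "Ck_on (Suc k) f UNIV"
proof (rule Ck_on_SucI)
  show "(f has_derivative (\<lambda>v. f' x * v)) (at x)" for x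
    using assms(1) by (simp add: has_field_derivative_def)
  show "Ck_on k (\<lambda>x. f' x * v) UNIV" for v
    by (intro Ck_on_mult assms Ck_on_const) auto
qed auto

lemma smooth_map_onD: "smooth_map_on f S \<Longrightarrow> Ck_on k f S"
  by (simp add: smooth_map_on_def)

lemma smooth_map_on_has_derivative:
  "smooth_map_on f S \<Longrightarrow> x \<in> S \<Longrightarrow> (f has_derivative frechet_derivative f (at x)) (at x)"
  using Ck_on_SucD(1)[of 0 f S x] unfolding smooth_map_on_def by blast

lemma smooth_map_on_derivative:
  "smooth_map_on f S \<Longrightarrow> smooth_map_on (\<lambda>x. frechet_derivative f (at x) v) S"
  unfolding smooth_map_on_def using Ck_on_SucD(2) by blast

lemma smooth_map_on_imp_continuous_on: "smooth_map_on f S \<Longrightarrow> continuous_on S f"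
  using Ck_on_imp_continuous_on smooth_map_onD by blast

lemma smooth_map_on_cong:
  "smooth_map_on f S \<Longrightarrow> (\<And>x. x \<in> S \<Longrightarrow> f x = g x) \<Longrightarrow> open S \<Longrightarrow> smooth_map_on g S"
  unfolding smooth_map_on_def using Ck_on_cong by blast

lemma smooth_map_on_subset: "smooth_map_on f S \<Longrightarrow> U \<subseteq> S \<Longrightarrow> smooth_map_on f U"
  unfolding smooth_map_on_def using Ck_on_subset by blast

section \<open>A periodic Sturm-Liouville problem with an exponentially small eigenvalue\<close>

lemma antiderivative_at_0_real:
  fixes g :: "real \<Rightarrow> real"
  assumes "continuous_on UNIV g"
  obtains G where "G 0 = 0" "\<And>x. (G has_real_derivative g x) (at x)"
proof -
  have "\<And>x. isCont g x"
    using assms continuous_on_eq_continuous_at by blast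
  then obtain F where F: "\<And>x::real. (F has_vector_derivative g x) (at x)"
    using einterval_antiderivative[of "-\<infinity>" "\<infinity>" g] by auto
  then have "((\<lambda>x. F x - F 0) has_real_derivative g x) (at x)" for x
    by (auto simp: has_real_derivative_iff_has_vector_derivative intro!: derivative_eq_intros)
  then show thesis using that[of "\<lambda>x. F x - F 0"] by simp
qed

text \<open>For \<open>x \<ge> 0\<close> the right hand side minus or plus \<open>G\<close> is nondecreasing and vanishes at \<open>0\<close>;
  negative \<open>x\<close> are reduced to this by reflection.\<close>

lemma abs_le_pow_div_fact_of_deriv:
  fixes G g :: "real \<Rightarrow> real"
  assumes "G 0 = 0" "\<And>x. (G has_real_derivative g x) (at x)"
    and bound: "\<And>x. \<bar>g x\<bar> \<le> M * ((M * \<bar>x\<bar>) ^ m / fact m)"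
  shows "\<bar>G x\<bar> \<le> (M * \<bar>x\<bar>) ^ Suc m / fact (Suc m)"
proof -
  have H: "((\<lambda>x. (M * x) ^ Suc m / fact (Suc m)) has_real_derivative
      M * ((M * x) ^ m / fact m)) (at x)" for x
  proof -
    have "((\<lambda>x. (M * x) ^ Suc m / fact (Suc m)) has_real_derivative
        (real (Suc m) * (M * x) ^ m * M) / fact (Suc m)) (at x)"
      by (auto intro!: derivative_eq_intros simp del: power_Suc of_nat_Suc)
    then show ?thesis by (simp add: field_simps del: of_nat_Suc power_Suc)
  qed
  have pos: "\<bar>K x\<bar> \<le> (M * x) ^ Suc m / fact (Suc m)"
    if "x \<ge> 0" "K 0 = 0" "\<And>x. (K has_real_derivative k x) (at x)"
      "\<And>x. \<bar>k x\<bar> \<le> M * ((M * \<bar>x\<bar>) ^ m / fact m)" for K k :: "real \<Rightarrow> real" and x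
  proof -
    have k: "k y \<le> M * ((M * y) ^ m / fact m)" "- k y \<le> M * ((M * y) ^ m / fact m)"
      if "y \<ge> 0" for y using \<open>\<And>x. \<bar>k x\<bar> \<le> _ x\<close>[of y] that by auto
    have mono: "u 0 \<le> u x"
      if "\<And>y. (u has_real_derivative v y) (at y)" "\<And>y. 0 \<le> y \<Longrightarrow> 0 \<le> v y" for u v :: "real \<Rightarrow> real"
      using \<open>x \<ge> 0\<close> that by (intro DERIV_nonneg_imp_nondecreasing[of 0 x u]) blast+
    have "(M * 0) ^ Suc m / fact (Suc m) - K 0 \<le> (M * x) ^ Suc m / fact (Suc m) - K x"
      by (rule mono[OF DERIV_diff[OF H that(3)]]) (use k(1) in simp)
    moreover have "(M * 0) ^ Suc m / fact (Suc m) + K 0 \<le> (M * x) ^ Suc m / fact (Suc m) + K x"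
      by (rule mono[OF DERIV_add[OF H that(3)]]) (use k(2) in force)
    ultimately show ?thesis using that(2) by simp
  qed
  show ?thesis
  proof (cases "x \<ge> 0")
    case True
    then show ?thesis using pos[OF True assms] by simp
  next
    case False
    have "((\<lambda>x. G (- x)) has_real_derivative - g (- x)) (at x)" for x
      using DERIV_chain2[OF assms(2) DERIV_minus[OF DERIV_ident]] by simp
    then show ?thesis
      using pos[of "- x" "\<lambda>x. G (- x)" "\<lambda>x. - g (- x)"] assms bound[of "- _"] False by simp
  qed
qed

text \<open>The Picard iterates of a first order system in which each unknown is driven by the other one.\<close>

lemma iterated_antiderivatives:
  fixes c :: "nat \<Rightarrow> real \<Rightarrow> real"
  assumes "\<And>m. continuous_on UNIV (c m)" "\<And>m x. \<bar>c m x\<bar> \<le> M"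
  obtains s where "s 0 = (\<lambda>x. 1)" "\<And>m. s (Suc m) 0 = 0"
    "\<And>m x. (s (Suc m) has_real_derivative c m x * s m x) (at x)"
    "\<And>m x. \<bar>s m x\<bar> \<le> (M * \<bar>x\<bar>) ^ m / fact m" "\<And>m. continuous_on UNIV (s m)"
proof -
  \<comment> \<open>The derivative relation links consecutive iterates, so they are chosen one after the other.\<close>
  define P where "P = (\<lambda>(m::nat) s. continuous_on UNIV (s :: real \<Rightarrow> real) \<and> (m = 0 \<longrightarrow> s = (\<lambda>x. 1)))"
  define Q where "Q = (\<lambda>m s s'. s' 0 = (0::real) \<and> (\<forall>x. (s' has_real_derivative c m x * s x) (at x)))"
  have "\<exists>s. \<forall>m. P m (s m) \<and> Q m (s m) (s (Suc m))"
  proof (rule dependent_nat_choice)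
    show "\<exists>s. P 0 s" by (rule exI[of _ "\<lambda>x. 1"]) (simp add: P_def)
  next
    fix s m assume "P m s"
    then have "continuous_on UNIV (\<lambda>x. c m x * s x)"
      using assms(1) by (auto simp: P_def intro!: continuous_on_mult)
    then obtain G where G: "G 0 = 0" "\<And>x. (G has_real_derivative c m x * s x) (at x)"
      using antiderivative_at_0_real by blast
    then have "continuous_on UNIV G"
      by (meson DERIV_isCont continuous_at_imp_continuous_on)
    with G show "\<exists>s'. P (Suc m) s' \<and> Q m s s'" by (auto simp: P_def Q_def)
  qed
  then obtain s where s: "\<And>m. P m (s m)" "\<And>m. Q m (s m) (s (Suc m))" by blast
  show thesis
  proof
    show "s 0 = (\<lambda>x. 1)" "\<And>m. continuous_on UNIV (s m)" using s(1) by (auto simp: P_def)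
    show 1: "\<And>m. s (Suc m) 0 = 0"
      "\<And>m x. (s (Suc m) has_real_derivative c m x * s m x) (at x)" using s(2) by (auto simp: Q_def)
    show "\<bar>s m x\<bar> \<le> (M * \<bar>x\<bar>) ^ m / fact m" for m x
    proof (induction m arbitrary: x)
      case 0
      then show ?case using s(1)[of 0] by (simp add: P_def)
    next
      case (Suc m)
      have "\<bar>c m y * s m y\<bar> \<le> M * ((M * \<bar>y\<bar>) ^ m / fact m)" for y
        unfolding abs_mult using assms(2)[of m y] by (intro mult_mono Suc) auto
      then show ?case by (rule abs_le_pow_div_fact_of_deriv[OF 1])
    qed
  qed
qed

text \<open>The equation \<open>(w f')' = - l w f\<close> is the system \<open>f' = p / w\<close>, \<open>p' = - l w f\<close>.  Its solution with
  \<open>f 0 = 0\<close> and \<open>p 0 = 1\<close> is a power series in \<open>- l\<close> whose coefficients are Picard iterates,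
  those of even index for \<open>p\<close> and those of odd index for \<open>f\<close>.  The series converges uniformly for
  bounded \<open>l\<close> and \<open>x\<close>, which gives the joint continuity that the shooting argument needs.\<close>

lemma sturm_liouville_initial_value:
  fixes w :: "real \<Rightarrow> real"
  assumes w: "continuous_on UNIV w" "\<And>x. w x > 0" "\<And>x. w x \<le> M" "\<And>x. 1 / w x \<le> M"
  obtains f p :: "real \<Rightarrow> real \<Rightarrow> real"
  where "\<And>l. f l 0 = 0" "\<And>l. p l 0 = 1" "\<And>x. p 0 x = 1"
    "\<And>l x. (f l has_real_derivative p l x / w x) (at x)"
    "\<And>l x. (p l has_real_derivative - l * w x * f l x) (at x)"
    "\<And>R. continuous_on ({-R..R} \<times> {-R..R}) (\<lambda>(l, x). p l x)"
proof -
  define c where "c = (\<lambda>(m::nat) x. if even m then 1 / w x else w x)"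
  have inv_abs: "\<bar>1 / w x\<bar> \<le> M" and w_abs: "\<bar>w x\<bar> \<le> M" for x
    using w(2,3,4)[of x] by simp_all
  have M: "M > 0" using w(2,3)[of 0] by linarith
  have "w x \<noteq> 0" for x using w(2)[of x] by simp
  then have c1: "continuous_on UNIV (c m)" for m
    unfolding c_def using w(1) by (cases "even m") (auto intro!: continuous_intros)
  have c2: "\<bar>c m x\<bar> \<le> M" for m x
    using w(2,3,4)[of x] by (auto simp: c_def abs_of_pos)
  obtain s where s: "s 0 = (\<lambda>x. 1)" "\<And>m. s (Suc m) 0 = 0"
      "\<And>m x. (s (Suc m) has_real_derivative c m x * s m x) (at x)"
      "\<And>m x. \<bar>s m x\<bar> \<le> (M * \<bar>x\<bar>) ^ m / fact m" "\<And>m. continuous_on UNIV (s m)"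
    using iterated_antiderivatives[of c M, OF c1 c2] by blast
  \<comment> \<open>\<open>F\<close> and \<open>Q\<close> are the terms of \<open>f\<close> and \<open>p\<close>; \<open>P\<close> is \<open>Q\<close> without its constant first term, so that
    the derivative of each term of \<open>P\<close> is a term of \<open>f\<close>.\<close>
  define F where "F = (\<lambda>l n x. (- l) ^ n * s (Suc (2 * n)) x)"
  define P where "P = (\<lambda>l n x. (- l) ^ Suc n * s (Suc (Suc (2 * n))) x)"
  define Q where "Q = (\<lambda>l n x. (- l) ^ n * s (2 * n) x)"
  \<comment> \<open>All three are dominated by an exponential series, since \<open>(2 n)! \<ge> n!\<close>.\<close>
  define b where "b = (\<lambda>R n. (R * (M * R)\<^sup>2) ^ n / fact n)" for R :: real
  have summable_b: "summable (\<lambda>n. C * b R n)" for R C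
  proof -
    have "b R = (\<lambda>n. inverse (fact n) * (R * (M * R)\<^sup>2) ^ n)"
      unfolding b_def by (simp only: divide_inverse mult.commute)
    then show ?thesis using summable_mult[OF summable_exp] by simp
  qed
  have sbound: "\<bar>(- l) ^ n * s (2 * n + j) x\<bar> \<le> (M * R) ^ j * b R n"
    if "\<bar>l\<bar> \<le> R" "\<bar>x\<bar> \<le> R" for l x R n j
  proof -
    have R: "R \<ge> 0" using that by linarith
    have "\<bar>s (2 * n + j) x\<bar> \<le> (M * \<bar>x\<bar>) ^ (2 * n + j) / fact (2 * n + j)" by (rule s)
    also have "\<dots> \<le> (M * R) ^ (2 * n + j) / fact n"
      using that M R by (intro frac_le power_mono mult_left_mono zero_le_power fact_mono) auto
    finally have "\<bar>s (2 * n + j) x\<bar> \<le> (M * R) ^ (2 * n + j) / fact n" .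
    moreover have "\<bar>(- l) ^ n\<bar> \<le> R ^ n"
      using that by (simp add: power_abs power_mono)
    ultimately have "\<bar>(- l) ^ n * s (2 * n + j) x\<bar> \<le> R ^ n * ((M * R) ^ (2 * n + j) / fact n)"
      unfolding abs_mult using R by (intro mult_mono) auto
    also have "\<dots> = (M * R) ^ j * b R n"
      by (simp add: b_def power_mult_distrib power_mult power_add)
    finally show ?thesis .
  qed
  have F_le: "\<bar>F l n x\<bar> \<le> (M * R) * b R n" if "\<bar>l\<bar> \<le> R" "\<bar>x\<bar> \<le> R" for l x R n
    using sbound[OF that, of n 1] by (simp add: F_def)
  have Q_le: "\<bar>Q l n x\<bar> \<le> b R n" if "\<bar>l\<bar> \<le> R" "\<bar>x\<bar> \<le> R" for l x R n
    using sbound[OF that, of n 0] by (simp add: Q_def)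
  have P_le: "\<bar>P l n x\<bar> \<le> (R * (M * R)^2) * b R n" if "\<bar>l\<bar> \<le> R" "\<bar>x\<bar> \<le> R" for l x R n
  proof -
    have "\<bar>P l n x\<bar> = \<bar>l\<bar> * \<bar>(- l) ^ n * s (2 * n + 2) x\<bar>"
      by (simp add: P_def abs_mult algebra_simps)
    also have "\<dots> \<le> R * ((M * R)^2 * b R n)"
      using that sbound[OF that, of n 2] by (intro mult_mono) auto
    finally show ?thesis by simp
  qed
  have summ: "summable (\<lambda>n. F l n x)" "summable (\<lambda>n. P l n x)" "summable (\<lambda>n. Q l n x)" for l x
  proof -
    define R where "R = max \<bar>l\<bar> \<bar>x\<bar>"
    have R: "\<bar>l\<bar> \<le> R" "\<bar>x\<bar> \<le> R" by (auto simp: R_def)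
    show "summable (\<lambda>n. F l n x)"
      by (rule summable_comparison_test'[OF summable_b, of 0]) (use F_le[OF R] in auto)
    show "summable (\<lambda>n. P l n x)"
      by (rule summable_comparison_test'[OF summable_b, of 0]) (use P_le[OF R] in auto)
    show "summable (\<lambda>n. Q l n x)"
      by (rule summable_comparison_test'[OF summable_b[of 1], of 0]) (use Q_le[OF R] in auto)
  qed
  have uni: "uniformly_convergent_on {-R..R} (\<lambda>n x. \<Sum>i<n. u x * h i x)"
    if "\<And>n x. \<bar>x\<bar> \<le> R \<Longrightarrow> \<bar>h n x\<bar> \<le> C * b R' n" "\<And>x. \<bar>u x\<bar> \<le> M" for R R' C :: real and h :: "nat \<Rightarrow> real \<Rightarrow> real" and u
  proof (rule Weierstrass_m_test'[OF _ summable_b[of "M * C" R']])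
    fix n x assume "x \<in> {-R..R}"
    then have "\<bar>h n x\<bar> \<le> C * b R' n" by (intro that(1)) auto
    from mult_mono[OF that(2) this] M have "\<bar>u x\<bar> * \<bar>h n x\<bar> \<le> M * (C * b R' n)"
      by simp
    then show "norm (u x * h n x) \<le> M * C * b R' n" by (simp add: abs_mult)
  qed
  define f where "f = (\<lambda>l x. \<Sum>n. F l n x)"
  define p where "p = (\<lambda>l x. 1 + (\<Sum>n. P l n x))"
  have p_Q: "p l x = (\<Sum>n. Q l n x)" for l x
  proof -
    have "(\<Sum>n. Q l (Suc n) x) = (\<Sum>n. Q l n x) - Q l 0 x"
      by (rule suminf_split_head[OF summ(3)])
    moreover have "Q l (Suc n) x = P l n x" for n by (simp add: Q_def P_def)
    ultimately show ?thesis by (simp add: p_def Q_def s(1))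
  qed
  have f_deriv: "(f l has_real_derivative p l x / w x) (at x)" for l x
  proof -
    define R where "R = max \<bar>l\<bar> \<bar>x\<bar> + 1"
    have R: "\<bar>l\<bar> \<le> R" "\<bar>x\<bar> < R" by (auto simp: R_def)
    have "(f l has_real_derivative (\<Sum>n. 1 / w x * Q l n x)) (at x)"
      unfolding f_def
    proof (rule has_field_derivative_series'(2)[where x = x and ?x0.0 = 0 and S = "{-R..R}" and f = "F l"
          and f' = "\<lambda>n x. 1 / w x * Q l n x"])
      show "(F l n has_real_derivative 1 / w x * Q l n x) (at x within {-R..R})" for n x
      proof -
        have "(F l n has_real_derivative (- l) ^ n * (c (2 * n) x * s (2 * n) x)) (at x)"
          unfolding F_def by (intro DERIV_cmult s(3))
        from has_field_derivative_at_within[OF this] show ?thesis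
          by (simp add: c_def Q_def)
      qed
      show "uniformly_convergent_on {-R..R} (\<lambda>n x. \<Sum>i<n. 1 / w x * Q l i x)"
        by (rule uni[where C = 1 and R' = R, OF _ inv_abs]) (simp add: Q_le[OF R(1)])
      show "summable (\<lambda>n. F l n 0)" by (rule summ(1))
      show "convex {-R..R}" by simp
      show "0 \<in> {-R..R}" "x \<in> interior {-R..R}" using R by auto
    qed
    also have "(\<Sum>n. 1 / w x * Q l n x) = p l x / w x"
      unfolding p_Q by (subst suminf_mult[OF summ(3)]) simp
    finally show ?thesis .
  qed
  have p_deriv: "(p l has_real_derivative - l * w x * f l x) (at x)" for l x
  proof -
    define R where "R = max \<bar>l\<bar> \<bar>x\<bar> + 1"
    have R: "\<bar>l\<bar> \<le> R" "\<bar>x\<bar> < R" by (auto simp: R_def)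
    have "((\<lambda>x. \<Sum>n. P l n x) has_real_derivative (\<Sum>n. w x * (- l * F l n x))) (at x)"
    proof (rule has_field_derivative_series'(2)[where x = x and ?x0.0 = 0 and S = "{-R..R}" and f = "P l"
          and f' = "\<lambda>n x. w x * (- l * F l n x)"])
      show "(P l n has_real_derivative w x * (- l * F l n x)) (at x within {-R..R})" for n x
      proof -
        have "(P l n has_real_derivative (- l) ^ Suc n * (c (Suc (2 * n)) x * s (Suc (2 * n)) x)) (at x)"
          unfolding P_def by (intro DERIV_cmult s(3))
        from has_field_derivative_at_within[OF this] show ?thesis
          by (simp add: c_def F_def algebra_simps)
      qed
      have "\<bar>- l * F l n x\<bar> \<le> (R * (M * R)) * b R n" if "\<bar>x\<bar> \<le> R" for n x
      proof -
        have "\<bar>- l * F l n x\<bar> \<le> R * ((M * R) * b R n)"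
          unfolding abs_mult using F_le[OF R(1) that, of n] R by (intro mult_mono) auto
        then show ?thesis by simp
      qed
      then show "uniformly_convergent_on {-R..R} (\<lambda>n x. \<Sum>i<n. w x * (- l * F l i x))"
        by (rule uni[where C = "R * (M * R)" and R' = R, OF _ w_abs])
      show "summable (\<lambda>n. P l n 0)" by (rule summ(2))
      show "convex {-R..R}" by simp
      show "0 \<in> {-R..R}" "x \<in> interior {-R..R}" using R by auto
    qed
    moreover have "(\<Sum>n. w x * (- l * F l n x)) = (\<Sum>n. (- l * w x) * F l n x)"
      by (simp only: mult.assoc mult.left_commute)
    moreover have "\<dots> = - l * w x * f l x"
      unfolding f_def by (rule suminf_mult[OF summ(1)])
    ultimately have "((\<lambda>x. \<Sum>n. P l n x) has_real_derivative - l * w x * f l x) (at x)" by simp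
    from DERIV_add[OF DERIV_const[of 1] this] show ?thesis unfolding p_def by simp
  qed
  have cont: "continuous_on ({-R..R} \<times> {-R..R}) (\<lambda>(l, x). p l x)" for R
  proof -
    have "uniform_limit ({-R..R} \<times> {-R..R}) (\<lambda>n y. \<Sum>i<n. Q (fst y) i (snd y))
        (\<lambda>y. \<Sum>i. Q (fst y) i (snd y)) sequentially"
      by (rule Weierstrass_m_test[OF _ summable_b[of 1 R]]) (use Q_le[of _ R] in force)
    moreover have "continuous_on ({-R..R} \<times> {-R..R}) (\<lambda>y. \<Sum>i<n. Q (fst y) i (snd y))" for n
      unfolding Q_def by (intro continuous_intros continuous_on_compose2[OF s(5)]) auto
    ultimately have "continuous_on ({-R..R} \<times> {-R..R}) (\<lambda>y. \<Sum>i. Q (fst y) i (snd y))"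
      by (intro uniform_limit_theorem[where F = sequentially]) (auto intro: always_eventually)
    then show ?thesis unfolding p_Q by (simp add: case_prod_unfold)
  qed
  have "p l 0 = 1" for l by (simp add: p_def P_def s(2))
  moreover have "p 0 x = 1" for x by (simp add: p_def P_def)
  moreover have "f l 0 = 0" for l by (simp add: f_def F_def s(2))
  ultimately show thesis
    using that f_deriv p_deriv cont by blast
qed

text \<open>The energy \<open>f\<^sup>2 + p\<^sup>2\<close> satisfies \<open>\<bar>e'\<bar> \<le> C e\<close>, so it stays zero in both directions once it is
  zero.\<close>

lemma sturm_liouville_unique:
  fixes w :: "real \<Rightarrow> real"
  assumes w: "\<And>x. w x > 0" "\<And>x. w x \<le> M" "\<And>x. 1 / w x \<le> M"
    and f: "\<And>x. (f has_real_derivative p x / w x) (at x)"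
    and p: "\<And>x. (p has_real_derivative - l * w x * f x) (at x)"
    and "f a = 0" "p a = 0"
  shows "f x = 0" "p x = 0"
proof -
  define C where "C = M + \<bar>l\<bar> * M"
  define e where "e = (\<lambda>x. (f x)\<^sup>2 + (p x)\<^sup>2)"
  define e' where "e' = (\<lambda>x. 2 * f x * p x * (1 / w x - l * w x))"
  have e: "(e has_real_derivative e' x) (at x)" for x
    unfolding e_def e'_def using f p
    by (auto intro!: derivative_eq_intros simp: algebra_simps)
  have bound: "\<bar>e' x\<bar> \<le> C * e x" for x
  proof -
    have "\<bar>2 * f x * p x\<bar> \<le> e x"
      using sum_squares_bound[of "\<bar>f x\<bar>" "\<bar>p x\<bar>"] by (simp add: e_def abs_mult)
    moreover have "\<bar>1 / w x - l * w x\<bar> \<le> C"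
    proof -
      have "\<bar>l * w x\<bar> \<le> \<bar>l\<bar> * M"
        using w(1,2)[of x] by (simp add: abs_mult mult_left_mono)
      moreover have "\<bar>1 / w x\<bar> \<le> M"
        using w(1,3)[of x] by (simp add: abs_of_pos)
      ultimately show ?thesis unfolding C_def by linarith
    qed
    ultimately have "\<bar>2 * f x * p x\<bar> * \<bar>1 / w x - l * w x\<bar> \<le> e x * C"
      by (intro mult_mono) auto
    then show ?thesis by (simp add: e'_def abs_mult mult.commute)
  qed
  have ea: "e a = 0" using assms by (simp add: e_def)
  have "e x \<le> 0"
  proof (cases "a \<le> x")
    case True
    have d: "((\<lambda>x. e x * exp (- C * x)) has_real_derivative (e' y - C * e y) * exp (- C * y)) (at y)" for y
      by (auto intro!: derivative_eq_intros e simp: algebra_simps)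
    have n: "(e' y - C * e y) * exp (- C * y) \<le> 0" for y
      using bound[of y] by (simp add: mult_le_0_iff)
    have "e x * exp (- C * x) \<le> e a * exp (- C * a)"
      by (rule DERIV_nonpos_imp_nonincreasing[OF True]) (use d n in blast)
    then show ?thesis using ea by (simp add: mult_le_0_iff not_le[symmetric])
  next
    case False
    then have "x \<le> a" by simp
    have d: "((\<lambda>x. e x * exp (C * x)) has_real_derivative (e' y + C * e y) * exp (C * y)) (at y)" for y
      by (auto intro!: derivative_eq_intros e simp: algebra_simps)
    have n: "0 \<le> (e' y + C * e y) * exp (C * y)" for y
      using bound[of y] by simp
    have "e x * exp (C * x) \<le> e a * exp (C * a)"
      by (rule DERIV_nonneg_imp_nondecreasing[OF \<open>x \<le> a\<close>]) (use d n in blast)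
    then show ?thesis using ea by (simp add: mult_le_0_iff not_le[symmetric])
  qed
  then show "f x = 0" "p x = 0"
    unfolding e_def by (simp_all add: sum_power2_le_zero_iff)
qed

text \<open>Shooting from \<open>0\<close>: let \<open>l\<close> be the smallest parameter for which \<open>p = w f'\<close> is not positive on
  all of \<open>[0, \<pi>/2]\<close>.  Then \<open>p\<close> vanishes at \<open>\<pi>/2\<close>.  The weight is symmetric about \<open>0\<close> and about
  \<open>\<pi>/2\<close>, so by uniqueness \<open>f\<close> is odd and symmetric about \<open>\<pi>/2\<close>, hence \<open>2\<pi>\<close>-periodic.

  The bound on \<open>l\<close> is the tunnelling estimate.  As long as \<open>p\<close> is positive, \<open>f\<close> has to grow on
  \<open>[0, \<pi>/6]\<close>, where \<open>1 / w \<ge> exp (3 k / 4)\<close>, and this makes \<open>p\<close> decrease on \<open>[\<pi>/3, \<pi>/2]\<close>, where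
  \<open>w \<ge> exp (- k / 4)\<close>; for \<open>l = 4 exp (- k / 2)\<close> the decrease is already more than \<open>p\<close> can
  afford.\<close>

lemma exponentially_small_periodic_eigenvalue:
  fixes k :: nat and w :: "real \<Rightarrow> real"
  defines "w \<equiv> \<lambda>x. exp (- real k * (cos x)\<^sup>2)"
  obtains l :: real and f p :: "real \<Rightarrow> real"
  where "0 < l" "l \<le> 4 * exp (- real k / 2)" "p 0 = 1"
    "\<And>x. (f has_real_derivative p x / w x) (at x)"
    "\<And>x. (p has_real_derivative - l * w x * f x) (at x)"
    "\<And>x. f (x + 2 * pi) = f x" "\<And>x. p (x + 2 * pi) = p x"
proof -
  \<comment> \<open>\<open>M\<close> bounds both \<open>w\<close> and \<open>1 / w\<close>.\<close>
  define M where "M = exp (real k)"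
  have w_pos: "w x > 0" for x by (simp add: w_def)
  have w_cont: "continuous_on UNIV w" unfolding w_def by (intro continuous_intros)
  have cos_le: "real k * (cos x)\<^sup>2 \<le> real k" for x
    by (simp add: mult_left_le abs_square_le_1)
  have w_le: "w x \<le> M" for x
  proof -
    have "- real k * (cos x)\<^sup>2 \<le> 0" by simp
    then show ?thesis unfolding w_def M_def by (metis exp_le_cancel_iff of_nat_0_le_iff order_trans)
  qed
  have w_inv: "1 / w x \<le> M" for x
    unfolding w_def M_def using cos_le[of x] by (simp add: exp_minus field_simps)
  obtain f p :: "real \<Rightarrow> real \<Rightarrow> real"
    where f0: "\<And>l. f l 0 = 0" and p0: "\<And>l. p l 0 = 1" and p1: "\<And>x. p 0 x = 1"
      and f: "\<And>l x. (f l has_real_derivative p l x / w x) (at x)"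
      and p: "\<And>l x. (p l has_real_derivative - l * w x * f l x) (at x)"
      and cont: "\<And>R. continuous_on ({-R..R} \<times> {-R..R}) (\<lambda>(l, x). p l x)"
    using sturm_liouville_initial_value[OF w_cont w_pos w_le w_inv] by blast
  have f_mono: "f l x \<le> f l y"
    if "\<And>z. 0 \<le> z \<Longrightarrow> z \<le> pi / 2 \<Longrightarrow> 0 \<le> p l z" "0 \<le> x" "x \<le> y" "y \<le> pi / 2" for l x y
  proof (rule DERIV_nonneg_imp_nondecreasing[OF \<open>x \<le> y\<close>])
    fix z assume "x \<le> z" "z \<le> y"
    then have "0 \<le> p l z / w z" using that w_pos[of z] by simp
    then show "\<exists>u. (f l has_real_derivative u) (at z) \<and> 0 \<le> u" using f by blast
  qed
  have p_mono: "p l y \<le> p l x"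
    if "0 \<le> l" "\<And>z. 0 \<le> z \<Longrightarrow> z \<le> pi / 2 \<Longrightarrow> 0 \<le> p l z" "0 \<le> x" "x \<le> y" "y \<le> pi / 2" for l x y
  proof (rule DERIV_nonpos_imp_nonincreasing[OF \<open>x \<le> y\<close>])
    fix z assume "x \<le> z" "z \<le> y"
    then have "0 \<le> f l z" using f_mono[of l 0 z] that f0 by simp
    then have "- l * w z * f l z \<le> 0" using that(1) w_pos[of z] by simp
    then show "\<exists>u. (p l has_real_derivative u) (at z) \<and> u \<le> 0" using p by blast
  qed
  define \<Lambda> where "\<Lambda> = 4 * exp (- real k / 2)"
  have \<Lambda>: "\<Lambda> > 0" by (simp add: \<Lambda>_def)
  have "\<exists>x. 0 \<le> x \<and> x \<le> pi / 2 \<and> p \<Lambda> x \<le> 0"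
  proof (rule ccontr)
    assume "\<not> ?thesis"
    then have pos: "\<And>x. 0 \<le> x \<Longrightarrow> x \<le> pi / 2 \<Longrightarrow> 0 < p \<Lambda> x" by force
    then have nonneg: "\<And>x. 0 \<le> x \<Longrightarrow> x \<le> pi / 2 \<Longrightarrow> 0 \<le> p \<Lambda> x" by force
    \<comment> \<open>Both intervals have length \<open>\<pi>/6\<close>; the factor \<open>4\<close> in \<open>\<Lambda>\<close> compensates \<open>(1 / 2)\<^sup>2 \<le> (\<pi>/6)\<^sup>2\<close>.\<close>
    have pi6: "pi / 6 \<ge> 1 / 2" using pi_gt3 by simp
    obtain \<xi> where \<xi>: "0 < \<xi>" "\<xi> < pi / 6" "f \<Lambda> (pi / 6) - f \<Lambda> 0 = (pi / 6 - 0) * (p \<Lambda> \<xi> / w \<xi>)"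
      using MVT2[of 0 "pi / 6" "f \<Lambda>" "\<lambda>x. p \<Lambda> x / w x"] f by auto
    have "cos \<xi> \<ge> sqrt 3 / 2"
      using cos_monotone_0_pi_le[of \<xi> "pi / 6"] \<xi> by (simp add: cos_30)
    then have "(cos \<xi>)\<^sup>2 \<ge> (sqrt 3 / 2)\<^sup>2" by (rule power_mono) simp
    then have "3 / 4 \<le> (cos \<xi>)\<^sup>2" by (simp add: power_divide)
    then have "real k * (3 / 4) \<le> real k * (cos \<xi>)\<^sup>2" by (rule mult_left_mono) simp
    then have winv: "exp (3 * real k / 4) \<le> 1 / w \<xi>"
      by (simp add: w_def exp_minus field_simps)
    have "1 / 2 * (p \<Lambda> (pi / 6) * exp (3 * real k / 4)) \<le> pi / 6 * (p \<Lambda> \<xi> * (1 / w \<xi>))"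
      using pi6 p_mono[of \<Lambda> \<xi> "pi / 6"] nonneg[of "pi / 6"] nonneg[of \<xi>] nonneg \<xi> \<Lambda> winv
      by (intro mult_mono) auto
    then have f6: "1 / 2 * (p \<Lambda> (pi / 6) * exp (3 * real k / 4)) \<le> f \<Lambda> (pi / 6)"
      using \<xi>(3) f0 by simp
    obtain \<eta> where \<eta>: "pi / 3 < \<eta>" "\<eta> < pi / 2"
      "p \<Lambda> (pi / 2) - p \<Lambda> (pi / 3) = (pi / 2 - pi / 3) * (- \<Lambda> * w \<eta> * f \<Lambda> \<eta>)"
      using MVT2[of "pi / 3" "pi / 2" "p \<Lambda>" "\<lambda>x. - \<Lambda> * w x * f \<Lambda> x"] p by auto
    have "cos \<eta> \<le> 1 / 2"
      using cos_monotone_0_pi_le[of "pi / 3" \<eta>] \<eta> by (simp add: cos_60)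
    moreover have "cos \<eta> \<ge> 0" using \<eta> pi_gt_zero by (intro cos_ge_zero) linarith+
    ultimately have "(cos \<eta>)\<^sup>2 \<le> (1 / 2)\<^sup>2" by (intro power_mono)
    then have "real k * (cos \<eta>)\<^sup>2 \<le> real k * (1 / 4)"
      by (intro mult_left_mono) (auto simp: power2_eq_square)
    then have "exp (- real k / 4) \<le> w \<eta>" by (simp add: w_def)
    moreover have "f \<Lambda> (pi / 6) \<le> f \<Lambda> \<eta>" "0 \<le> f \<Lambda> (pi / 6)"
      using f_mono[of \<Lambda> "pi / 6" \<eta>] f_mono[of \<Lambda> 0 "pi / 6"] nonneg \<eta> f0[of \<Lambda>] by auto
    ultimately have "exp (- real k / 4) * (1 / 2 * (p \<Lambda> (pi / 6) * exp (3 * real k / 4))) \<le> w \<eta> * f \<Lambda> \<eta>"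
      using f6 nonneg[of "pi / 6"] w_pos[of \<eta>] by (intro mult_mono) auto
    from mult_left_mono[OF this, of \<Lambda>] \<Lambda>
    have "\<Lambda> * (exp (- real k / 4) * (1 / 2 * (p \<Lambda> (pi / 6) * exp (3 * real k / 4))))
        \<le> \<Lambda> * (w \<eta> * f \<Lambda> \<eta>)" by simp
    from mult_mono[OF pi6 this] nonneg[of "pi / 6"] \<Lambda>
    have "1 / 2 * (\<Lambda> * (exp (- real k / 4) * (1 / 2 * (p \<Lambda> (pi / 6) * exp (3 * real k / 4)))))
        \<le> pi / 6 * (\<Lambda> * (w \<eta> * f \<Lambda> \<eta>))"
      by simp
    also have "\<dots> = p \<Lambda> (pi / 3) - p \<Lambda> (pi / 2)"
      using \<eta>(3) by (simp add: algebra_simps)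
    also have "1 / 2 * (\<Lambda> * (exp (- real k / 4) * (1 / 2 * (p \<Lambda> (pi / 6) * exp (3 * real k / 4)))))
      = p \<Lambda> (pi / 6) * (exp (- real k / 2) * exp (- real k / 4) * exp (3 * real k / 4))"
      by (simp add: \<Lambda>_def)
    also have "\<dots> = p \<Lambda> (pi / 6)"
      by (simp flip: exp_add)
    finally have "p \<Lambda> (pi / 6) \<le> p \<Lambda> (pi / 3) - p \<Lambda> (pi / 2)" .
    moreover have "p \<Lambda> (pi / 3) \<le> p \<Lambda> (pi / 6)" using p_mono nonneg \<Lambda> by simp
    moreover have "p \<Lambda> (pi / 2) > 0" using pos[of "pi / 2"] by simp
    ultimately show False by linarith
  qed
  then obtain x\<^sub>0 where x\<^sub>0: "0 \<le> x\<^sub>0" "x\<^sub>0 \<le> pi / 2" "p \<Lambda> x\<^sub>0 \<le> 0" by blast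
  define S where "S = {0..\<Lambda>} \<times> {0..pi / 2}"
  have contS: "continuous_on S (\<lambda>y. p (fst y) (snd y))"
    using continuous_on_subset[OF cont[of "max \<Lambda> (pi / 2)"], of S] pi_gt_zero \<Lambda>
    by (force simp: S_def case_prod_unfold)
  \<comment> \<open>\<open>l\<close> is the smallest first component of a point of the compact set \<open>Z\<close> of failures of positivity.\<close>
  define Z where "Z = S \<inter> (\<lambda>y. p (fst y) (snd y)) -` {..0}"
  have "compact S" unfolding S_def by (intro compact_Times) auto
  moreover have "closed Z" unfolding Z_def
    by (rule continuous_closed_preimage[OF contS compact_imp_closed[OF \<open>compact S\<close>]]) simp
  ultimately have "compact Z"
    by (metis Z_def compact_Int_closed inf.left_idem)
  moreover have "(\<Lambda>, x\<^sub>0) \<in> Z" using x\<^sub>0 \<Lambda> by (simp add: Z_def S_def)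
  ultimately obtain y where y: "y \<in> Z" "\<And>y'. y' \<in> Z \<Longrightarrow> fst y \<le> fst y'"
    using continuous_attains_inf[of Z fst] continuous_on_fst[OF continuous_on_id] by blast
  define l x\<^sub>1 where "l = fst y" and "x\<^sub>1 = snd y"
  have l: "0 \<le> l" "l \<le> \<Lambda>" and x\<^sub>1: "0 \<le> x\<^sub>1" "x\<^sub>1 \<le> pi / 2" "p l x\<^sub>1 \<le> 0"
    using y(1) by (auto simp: Z_def S_def l_def x\<^sub>1_def mem_Times_iff)
  have l_pos: "0 < l" using l x\<^sub>1(3) p1[of x\<^sub>1] by (cases "l = 0") auto
  have p_nonneg: "0 \<le> p l x" if "0 \<le> x" "x \<le> pi / 2" for x
  proof (rule ccontr)
    assume neg: "\<not> ?thesis"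
    \<comment> \<open>\<open>p\<close> is \<open>1\<close> for the parameter \<open>0\<close>, so if it were negative for \<open>l\<close> it would vanish for a smaller
      parameter.\<close>
    have "continuous_on {0..l} (\<lambda>l'. p l' x)"
    proof -
      have "continuous_on {0..l} (\<lambda>l'. (l', x))" by (intro continuous_intros)
      moreover have "(\<lambda>l'. (l', x)) ` {0..l} \<subseteq> S" using that l by (auto simp: S_def)
      ultimately show ?thesis using continuous_on_compose2[OF contS] by fastforce
    qed
    then obtain l' where l': "0 \<le> l'" "l' \<le> l" "p l' x = 0"
      using IVT2'[of "\<lambda>l'. p l' x" l 0 0] neg l p1[of x] by auto
    then have "(l', x) \<in> Z" using that l by (simp add: Z_def S_def)
    then have "l' = l" using y(2) l'(2) by (fastforce simp: l_def)
    then show False using neg l' by simp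
  qed
  have p_half: "p l (pi / 2) = 0"
  proof -
    have "p l (pi / 2) \<le> p l x\<^sub>1" using p_mono p_nonneg x\<^sub>1 l by simp
    then show ?thesis using p_nonneg[of "pi / 2"] x\<^sub>1 by simp
  qed
  have w_sym: "w (pi - x) = w x" "w (- x) = w x" for x by (simp_all add: w_def)
  note unique = sturm_liouville_unique[OF w_pos w_le w_inv, where l = l]
  have refl: "f l (pi - x) = f l x" "p l (pi - x) = - p l x" for x
  proof -
    have 1: "((\<lambda>x. f l x - f l (pi - x)) has_real_derivative (p l x + p l (pi - x)) / w x) (at x)" for x
      using DERIV_diff[OF f[of l] DERIV_chain2[OF f[of l] DERIV_diff[OF DERIV_const[of pi] DERIV_ident]], of x]
      by (simp add: w_sym add_divide_distrib)
    have 2: "((\<lambda>x. p l x + p l (pi - x)) has_real_derivative - l * w x * (f l x - f l (pi - x))) (at x)" for x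
      using DERIV_add[OF p[of l] DERIV_chain2[OF p[of l] DERIV_diff[OF DERIV_const[of pi] DERIV_ident]], of x]
      by (simp add: w_sym algebra_simps)
    show "f l (pi - x) = f l x" "p l (pi - x) = - p l x"
      using unique[OF 1 2, of "pi / 2" x] p_half by auto
  qed
  have odd: "f l (- x) = - f l x" "p l (- x) = p l x" for x
  proof -
    have 1: "((\<lambda>x. f l x + f l (- x)) has_real_derivative (p l x - p l (- x)) / w x) (at x)" for x
      using DERIV_add[OF f[of l] DERIV_chain2[OF f[of l] DERIV_minus[OF DERIV_ident]], of x]
      by (simp add: w_sym diff_divide_distrib)
    have 2: "((\<lambda>x. p l x - p l (- x)) has_real_derivative - l * w x * (f l x + f l (- x))) (at x)" for x
      using DERIV_diff[OF p[of l] DERIV_chain2[OF p[of l] DERIV_minus[OF DERIV_ident]], of x]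
      by (simp add: w_sym algebra_simps)
    show "f l (- x) = - f l x" "p l (- x) = p l x"
      using unique[OF 1 2, of 0 x] f0 by auto
  qed
  have "f l (x + pi) = - f l x" "p l (x + pi) = - p l x" for x
    using refl[of "- x"] odd[of x] by (simp_all add: add.commute)
  from this[of "_ + pi"] this have "f l (x + 2 * pi) = f l x" "p l (x + 2 * pi) = p l x" for x
    by (simp_all add: add.assoc)
  then show thesis
    using that[of l "p l" "f l"] l_pos l p0 f p unfolding \<Lambda>_def by blast
qed

section \<open>Alternating conjugate-multilinear functions\<close>

text \<open>Lists that are split at the position in question are easier to handle than list updates and
  indices.\<close>

lemma alternating_iff:
  fixes f :: "(complex^'n) list \<Rightarrow> complex"
  shows "antilinear_alternating q f \<longleftrightarrow>
    (\<forall>A B v w. length A + length B + 1 = q \<longrightarrow> f (A @ (v + w) # B) = f (A @ v # B) + f (A @ w # B)) \<and>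
    (\<forall>A B t v. length A + length B + 1 = q \<longrightarrow> f (A @ (t *s v) # B) = cnj t * f (A @ v # B)) \<and>
    (\<forall>A B C v. length A + length B + length C + 2 = q \<longrightarrow> f (A @ v # B @ v # C) = 0)"
  (is "_ = (?add \<and> ?scale \<and> ?alt)")
proof
  assume f: "antilinear_alternating q f"
  have add: "f (vs[l := v + w]) = f (vs[l := v]) + f (vs[l := w])" if "length vs = q" "l < q" for vs l v w
    using f that unfolding antilinear_alternating_def by blast
  have scale: "f (vs[l := t *s v]) = cnj t * f (vs[l := v])" if "length vs = q" "l < q" for vs l t v
    using f that unfolding antilinear_alternating_def by blast
  have "f (A @ (v + w) # B) = f (A @ v # B) + f (A @ w # B)"
    if "length A + length B + 1 = q" for A B v w
    using add[of "A @ v # B" "length A" v w] that by simp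
  moreover have "f (A @ (t *s v) # B) = cnj t * f (A @ v # B)"
    if "length A + length B + 1 = q" for A B t v
    using scale[of "A @ v # B" "length A" t v] that by simp
  moreover have "f (A @ v # B @ v # C) = 0"
    if "length A + length B + length C + 2 = q" for A B C v
  proof -
    let ?vs = "A @ v # B @ v # C"
    have "?vs ! length A = ?vs ! (length A + 1 + length B)"
      by (simp add: nth_append)
    moreover have "length ?vs = q" "length A < length A + 1 + length B" "length A + 1 + length B < q"
      using that by auto
    ultimately show ?thesis using f unfolding antilinear_alternating_def by blast
  qed
  ultimately show "?add \<and> ?scale \<and> ?alt" by blast
next
  assume r: "?add \<and> ?scale \<and> ?alt"
  show "antilinear_alternating q f"
    unfolding antilinear_alternating_def
  proof (intro conjI allI impI)
    fix vs :: "(complex^'n) list" and l v w assume "length vs = q \<and> l < q"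
    then show "f (vs[l := v + w]) = f (vs[l := v]) + f (vs[l := w])"
      using r by (simp add: upd_conv_take_nth_drop)
  next
    fix vs :: "(complex^'n) list" and l t v assume "length vs = q \<and> l < q"
    then show "f (vs[l := t *s v]) = cnj t * f (vs[l := v])"
      using r by (simp add: upd_conv_take_nth_drop)
  next
    fix vs :: "(complex^'n) list" and l m
    assume *: "length vs = q \<and> l < m \<and> m < q \<and> vs ! l = vs ! m"
    define B where "B = take (m - Suc l) (drop (Suc l) vs)"
    have "drop (Suc l) vs = B @ drop m vs"
      unfolding B_def using * append_take_drop_id[of "m - Suc l" "drop (Suc l) vs"] by simp
    moreover have "drop m vs = vs ! l # drop (Suc m) vs"
      using * by (simp add: Cons_nth_drop_Suc)
    moreover have "vs = take l vs @ vs ! l # drop (Suc l) vs"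
      using * by (intro id_take_nth_drop) simp
    ultimately have vs: "vs = take l vs @ vs ! l # B @ vs ! l # drop (Suc m) vs" by simp
    moreover have "length (take l vs) + length B + length (drop (Suc m) vs) + 2 = q"
      using arg_cong[OF vs, of length] * by simp
    ultimately show "f vs = 0" using r by metis
  qed
qed

lemma alternating_add:
  "antilinear_alternating q f \<Longrightarrow> length A + length B + 1 = q \<Longrightarrow>
    f (A @ (v + w) # B) = f (A @ v # B) + f (A @ w # B)"
  by (simp add: alternating_iff)

lemma alternating_scale:
  "antilinear_alternating q f \<Longrightarrow> length A + length B + 1 = q \<Longrightarrow>
    f (A @ (t *s v) # B) = cnj t * f (A @ v # B)"
  by (simp add: alternating_iff)

lemma alternating_repeat:
  "antilinear_alternating q f \<Longrightarrow> length A + length B + length C + 2 = q \<Longrightarrow>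
    f (A @ v # B @ v # C) = 0"
  by (simp add: alternating_iff)

lemma alternating_sum:
  assumes f: "antilinear_alternating q f" "length A + length B + 1 = q" "finite I"
  shows "f (A @ (\<Sum>i\<in>I. c i *s u i) # B) = (\<Sum>i\<in>I. cnj (c i) * f (A @ u i # B))"
  using f(3)
proof (induction I)
  case empty
  show ?case using alternating_scale[OF f(1,2), of 0 0] by simp
next
  case (insert i I)
  then show ?case
    by (simp add: alternating_add[OF f(1,2)] alternating_scale[OF f(1,2)])
qed

text \<open>Expand the value zero at \<open>u + v\<close>, \<open>u + v\<close>.\<close>

lemma alternating_swap:
  assumes f: "antilinear_alternating q f" "length A + length B + 2 = q"
  shows "f (A @ u # v # B) = - f (A @ v # u # B)"
proof -
  have rep: "f (A @ w # w # B) = 0" for w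
    using alternating_repeat[OF f(1), of A "[]" B w] f(2) by simp
  have "0 = f (A @ (u + v) # (u + v) # B)" by (simp add: rep)
  also have "\<dots> = f (A @ u # (u + v) # B) + f (A @ v # (u + v) # B)"
    using alternating_add[OF f(1), of A "(u + v) # B" u v] f(2) by simp
  also have "f (A @ u # (u + v) # B) = f (A @ u # u # B) + f (A @ u # v # B)"
    using alternating_add[OF f(1), of "A @ [u]" B u v] f(2) by simp
  also have "f (A @ v # (u + v) # B) = f (A @ v # u # B) + f (A @ v # v # B)"
    using alternating_add[OF f(1), of "A @ [v]" B u v] f(2) by simp
  finally show ?thesis by (simp add: rep eq_neg_iff_add_eq_0)
qed

lemma alternating_move:
  assumes f: "antilinear_alternating q f" "length A + length B + length C + 1 = q"
  shows "f (A @ B @ v # C) = (-1) ^ length B * f (A @ v # B @ C)"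
  using f(2)
proof (induction B arbitrary: A)
  case (Cons b B)
  have "f (A @ (b # B) @ v # C) = f ((A @ [b]) @ B @ v # C)" by simp
  also have "\<dots> = (-1) ^ length B * f ((A @ [b]) @ v # B @ C)"
    using Cons.prems by (intro Cons.IH) simp
  also have "f ((A @ [b]) @ v # B @ C) = - f (A @ v # b # B @ C)"
    using alternating_swap[OF f(1), of A "B @ C" b v] Cons.prems by simp
  finally show ?case by simp
qed simp

text \<open>Replace the arguments one after the other, from the left, by their expansions in the basis.\<close>

lemma alternating_eq_0:
  fixes u :: "'n::finite \<Rightarrow> complex^'n"
  assumes f: "antilinear_alternating q f"
    and basis: "\<And>v. \<exists>c. v = (\<Sum>j\<in>UNIV. c j *s u j)"
    and zero: "\<And>J. length J = q \<Longrightarrow> f (map u J) = 0"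
    and "length vs = q"
  shows "f vs = 0"
proof -
  have "f (map u J @ vs) = 0" if "length J + length vs = q" for J
    using that
  proof (induction vs arbitrary: J)
    case Nil
    then show ?case using zero by simp
  next
    case (Cons v vs)
    obtain c where c: "v = (\<Sum>j\<in>UNIV. c j *s u j)" using basis by blast
    have "f (map u J @ v # vs) = (\<Sum>j\<in>UNIV. cnj (c j) * f (map u J @ u j # vs))"
      unfolding c using Cons.prems by (intro alternating_sum[OF f]) auto
    moreover have "f (map u J @ u j # vs) = 0" for j
      using Cons.IH[of "J @ [j]"] Cons.prems by simp
    ultimately show ?case by simp
  qed
  from this[of "[]"] assms(4) show ?thesis by simp
qed

lemma alternating_diff:
  "antilinear_alternating q f \<Longrightarrow> antilinear_alternating q g \<Longrightarrow>
    antilinear_alternating q (\<lambda>vs. f vs - g vs)"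
  by (simp add: alternating_iff algebra_simps)

lemma alternating_cmult:
  "antilinear_alternating q f \<Longrightarrow> antilinear_alternating q (\<lambda>vs. c * f vs)"
  by (simp add: alternating_iff algebra_simps)

lemma alternating_add_fun:
  "antilinear_alternating q f \<Longrightarrow> antilinear_alternating q g \<Longrightarrow>
    antilinear_alternating q (\<lambda>vs. f vs + g vs)"
  by (simp add: alternating_iff algebra_simps)

lemma alternating_Cons:
  assumes "antilinear_alternating (Suc q) f"
  shows "antilinear_alternating q (\<lambda>vs. f (v # vs))"
  unfolding alternating_iff
  using alternating_add[OF assms, of "v # _"] alternating_scale[OF assms, of "v # _"]
    alternating_repeat[OF assms, of "v # _"] by auto

text \<open>Alternating sums over the ways of removing one entry.  In \<open>removal_sum\<close> only the middle of
  three lists loses an entry; that makes it possible to split such a sum at a given position.\<close>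

definition removal_sum ::
    "('a \<Rightarrow> 'a list \<Rightarrow> complex) \<Rightarrow> 'a list \<Rightarrow> 'a list \<Rightarrow> 'a list \<Rightarrow> complex" where
  "removal_sum D A vs B =
    (\<Sum>l<length vs. (-1) ^ l * D (vs ! l) (A @ take l vs @ drop (Suc l) vs @ B))"

text \<open>With \<open>D v vs = cnj (v $ j) * f vs\<close> this is \<open>d(cnj z\<^sub>j) \<and> f\<close>, and with \<open>D v\<close> the derivative in
  the direction \<open>v\<close> it is the exterior derivative on constant vector fields.\<close>

definition wedge :: "('a \<Rightarrow> 'a list \<Rightarrow> complex) \<Rightarrow> 'a list \<Rightarrow> complex" where
  "wedge D vs = (\<Sum>l<length vs. (-1) ^ l * D (vs ! l) (take l vs @ drop (Suc l) vs))"

lemma wedge_removal_sum: "wedge D vs = removal_sum D [] vs []"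
  by (simp add: wedge_def removal_sum_def)

lemma sum_lessThan_add:
  "(\<Sum>l<m + n::nat. g l) = (\<Sum>l<m. g l) + (\<Sum>l<n. g (m + l) :: 'a::comm_monoid_add)"
  by (induction n) (auto simp: add.assoc)

lemma removal_sum_append:
  "removal_sum D A (X @ Y) B = removal_sum D A X (Y @ B) + (-1) ^ length X * removal_sum D (A @ X) Y B"
proof -
  have "(\<Sum>l<length X. (-1) ^ l * D ((X @ Y) ! l) (A @ take l (X @ Y) @ drop (Suc l) (X @ Y) @ B)) =
      removal_sum D A X (Y @ B)"
    unfolding removal_sum_def by (intro sum.cong) (auto simp: nth_append)
  moreover have "(\<Sum>l<length Y. (-1) ^ (length X + l) * D ((X @ Y) ! (length X + l))
        (A @ take (length X + l) (X @ Y) @ drop (Suc (length X + l)) (X @ Y) @ B)) =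
      (-1) ^ length X * removal_sum D (A @ X) Y B"
    unfolding removal_sum_def sum_distrib_left
    by (intro sum.cong) (auto simp: nth_append power_add mult.assoc)
  ultimately show ?thesis
    unfolding removal_sum_def[of D A "X @ Y" B] length_append sum_lessThan_add by simp
qed

lemma removal_sum_single: "removal_sum D A [v] B = D v (A @ B)"
  by (simp add: removal_sum_def)

lemma removal_sum_Cons:
  "removal_sum D A (v # Y) B = D v (A @ Y @ B) - removal_sum D (A @ [v]) Y B"
  using removal_sum_append[of D A "[v]" Y B] by (simp add: removal_sum_single)

lemma wedge_middle:
  "wedge D (A @ v # B) = removal_sum D [] A (v # B) + (-1) ^ length A * (D v (A @ B) - removal_sum D (A @ [v]) B [])"
  by (simp add: wedge_removal_sum removal_sum_append removal_sum_Cons)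

text \<open>Alternation: if \<open>v\<close> occurs twice, all terms vanish in which another entry is removed.  The two
  remaining terms differ by moving \<open>v\<close> past the entries \<open>B\<close> between its two places; the sign of that
  move and the signs of the two removals make them cancel.\<close>

lemma alternating_wedge:
  fixes D :: "complex^'n \<Rightarrow> (complex^'n) list \<Rightarrow> complex"
  assumes D: "\<And>v. antilinear_alternating q (D v)"
    and add: "\<And>v w vs. length vs = q \<Longrightarrow> D (v + w) vs = D v vs + D w vs"
    and scale: "\<And>t v vs. length vs = q \<Longrightarrow> D (t *s v) vs = cnj t * D v vs"
  shows "antilinear_alternating (Suc q) (wedge D)"
  unfolding alternating_iff
proof (intro conjI allI impI)
  fix A B :: "(complex^'n) list" and v w assume len: "length A + length B + 1 = Suc q"
  have "removal_sum D [] A ((v + w) # B) = removal_sum D [] A (v # B) + removal_sum D [] A (w # B)"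
    unfolding removal_sum_def sum.distrib[symmetric]
  proof (intro sum.cong refl)
    fix l assume "l \<in> {..<length A}"
    then show "(-1) ^ l * D (A ! l) ([] @ take l A @ drop (Suc l) A @ (v + w) # B) =
      (-1) ^ l * D (A ! l) ([] @ take l A @ drop (Suc l) A @ v # B) +
      (-1) ^ l * D (A ! l) ([] @ take l A @ drop (Suc l) A @ w # B)"
      using alternating_add[OF D, of "take l A @ drop (Suc l) A" B] len
      by (simp add: algebra_simps)
  qed
  moreover have "removal_sum D (A @ [v + w]) B [] = removal_sum D (A @ [v]) B [] + removal_sum D (A @ [w]) B []"
    unfolding removal_sum_def sum.distrib[symmetric]
  proof (intro sum.cong refl)
    fix l assume "l \<in> {..<length B}"
    then show "(-1) ^ l * D (B ! l) ((A @ [v + w]) @ take l B @ drop (Suc l) B @ []) =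
      (-1) ^ l * D (B ! l) ((A @ [v]) @ take l B @ drop (Suc l) B @ []) +
      (-1) ^ l * D (B ! l) ((A @ [w]) @ take l B @ drop (Suc l) B @ [])"
      using alternating_add[OF D, of A "take l B @ drop (Suc l) B"] len
      by (simp add: algebra_simps)
  qed
  ultimately show "wedge D (A @ (v + w) # B) = wedge D (A @ v # B) + wedge D (A @ w # B)"
    unfolding wedge_middle using add[of "A @ B" v w] len by (simp add: algebra_simps)
next
  fix A B :: "(complex^'n) list" and t v assume len: "length A + length B + 1 = Suc q"
  have "removal_sum D [] A ((t *s v) # B) = cnj t * removal_sum D [] A (v # B)"
    unfolding removal_sum_def sum_distrib_left
  proof (intro sum.cong refl)
    fix l assume "l \<in> {..<length A}"
    then show "(-1) ^ l * D (A ! l) ([] @ take l A @ drop (Suc l) A @ (t *s v) # B) =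
      cnj t * ((-1) ^ l * D (A ! l) ([] @ take l A @ drop (Suc l) A @ v # B))"
      using alternating_scale[OF D, of "take l A @ drop (Suc l) A" B] len
      by (simp add: algebra_simps)
  qed
  moreover have "removal_sum D (A @ [t *s v]) B [] = cnj t * removal_sum D (A @ [v]) B []"
    unfolding removal_sum_def sum_distrib_left
  proof (intro sum.cong refl)
    fix l assume "l \<in> {..<length B}"
    then show "(-1) ^ l * D (B ! l) ((A @ [t *s v]) @ take l B @ drop (Suc l) B @ []) =
      cnj t * ((-1) ^ l * D (B ! l) ((A @ [v]) @ take l B @ drop (Suc l) B @ []))"
      using alternating_scale[OF D, of A "take l B @ drop (Suc l) B"] len
      by (simp add: algebra_simps)
  qed
  ultimately show "wedge D (A @ (t *s v) # B) = cnj t * wedge D (A @ v # B)"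
    unfolding wedge_middle using scale[of "A @ B" t v] len by (simp add: algebra_simps)
next
  fix A B C :: "(complex^'n) list" and v assume len: "length A + length B + length C + 2 = Suc q"
  have "removal_sum D [] A (v # B @ v # C) = 0"
    unfolding removal_sum_def
  proof (intro sum.neutral ballI)
    fix l assume "l \<in> {..<length A}"
    then show "(-1) ^ l * D (A ! l) ([] @ take l A @ drop (Suc l) A @ v # B @ v # C) = 0"
      using alternating_repeat[OF D[of "A ! l"], of "take l A @ drop (Suc l) A" B C v] len by simp
  qed
  moreover have "removal_sum D (A @ [v]) B (v # C) = 0"
    unfolding removal_sum_def
  proof (intro sum.neutral ballI)
    fix l assume "l \<in> {..<length B}"
    then show "(-1) ^ l * D (B ! l) ((A @ [v]) @ take l B @ drop (Suc l) B @ v # C) = 0"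
      using alternating_repeat[OF D[of "B ! l"], of A "take l B @ drop (Suc l) B" C v] len by simp
  qed
  moreover have "removal_sum D (A @ v # B @ [v]) C [] = 0"
    unfolding removal_sum_def
  proof (intro sum.neutral ballI)
    fix l assume "l \<in> {..<length C}"
    then show "(-1) ^ l * D (C ! l) ((A @ v # B @ [v]) @ take l C @ drop (Suc l) C @ []) = 0"
      using alternating_repeat[OF D[of "C ! l"], of A B "take l C @ drop (Suc l) C" v] len by simp
  qed
  moreover have "D v (A @ B @ v # C) = (-1) ^ length B * D v (A @ v # B @ C)"
    using len by (intro alternating_move[OF D]) simp
  ultimately show "wedge D (A @ v # B @ v # C) = 0"
    unfolding wedge_middle by (simp add: removal_sum_append removal_sum_Cons)
qed

lemma finite_lists_of_length: "finite {J :: 'n::finite list. length J = q}"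
  using finite_lists_length_eq[of "UNIV :: 'n set" q] by simp

lemma sum_lists_remove_nth:
  fixes G :: "'n::finite \<Rightarrow> 'n list \<Rightarrow> 'b::comm_monoid_add"
  assumes "l \<le> q"
  shows "(\<Sum>K | length K = Suc q. G (K ! l) (take l K @ drop (Suc l) K)) =
    (\<Sum>J | length J = q. \<Sum>j\<in>UNIV. G j J)"
proof -
  have "(\<Sum>J | length J = q. \<Sum>j\<in>UNIV. G j J) = (\<Sum>(J, j)\<in>{J. length J = q} \<times> UNIV. G j J)"
    by (rule sum.cartesian_product)
  also have "\<dots> = (\<Sum>K | length K = Suc q. G (K ! l) (take l K @ drop (Suc l) K))"
    using assms
    by (intro sum.reindex_bij_witness[where j = "\<lambda>(J, j). take l J @ j # drop l J"
          and i = "\<lambda>K. (take l K @ drop (Suc l) K, K ! l)"])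
      (auto simp: nth_append min_def id_take_nth_drop[symmetric])
  finally show ?thesis by simp
qed

text \<open>The pairing of two alternating functions is computed in a basis by summing over all lists of
  basis vectors.  Moving the removed entry of the list to the front of the argument of \<open>f\<close> produces the
  sign with which it was removed, so each of the \<open>q + 1\<close> terms of \<open>wedge D\<close> contributes the same.\<close>

lemma sum_wedge_mult_cnj:
  fixes u :: "'n::finite \<Rightarrow> complex^'n"
  assumes f: "antilinear_alternating (Suc q) f"
  shows "(\<Sum>K | length K = Suc q. wedge D (map u K) * cnj (f (map u K))) =
    of_nat (Suc q) * (\<Sum>J | length J = q. \<Sum>j\<in>UNIV. D (u j) (map u J) * cnj (f (u j # map u J)))"
proof -
  define G where "G = (\<lambda>j J. D (u j) (map u J) * cnj (f (u j # map u J)))"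
  have "wedge D (map u K) * cnj (f (map u K)) =
      (\<Sum>l<Suc q. G (K ! l) (take l K @ drop (Suc l) K))" if K: "length K = Suc q" for K
  proof -
    have "(-1) ^ l * D (map u K ! l) (take l (map u K) @ drop (Suc l) (map u K)) * cnj (f (map u K))
        = G (K ! l) (take l K @ drop (Suc l) K)" if l: "l < Suc q" for l
    proof -
      have "map u K = map u (take l K @ K ! l # drop (Suc l) K)"
        using K l by (metis id_take_nth_drop)
      then have "f (map u K) = f ([] @ map u (take l K) @ u (K ! l) # map u (drop (Suc l) K))" by simp
      also have "\<dots> = (-1) ^ length (map u (take l K)) *
          f ([] @ u (K ! l) # map u (take l K) @ map u (drop (Suc l) K))"
        using K l by (intro alternating_move[OF f]) simp
      also have "length (map u (take l K)) = l" using K l by simp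
      finally have "f (map u K) = (-1) ^ l * f (u (K ! l) # map u (take l K @ drop (Suc l) K))" by simp
      then show ?thesis using K l
        by (simp add: G_def take_map drop_map flip: power_add mult_2 power_mult)
    qed
    then show ?thesis unfolding wedge_def sum_distrib_right using K by (intro sum.cong) auto
  qed
  then have "(\<Sum>K | length K = Suc q. wedge D (map u K) * cnj (f (map u K))) =
      (\<Sum>K | length K = Suc q. \<Sum>l<Suc q. G (K ! l) (take l K @ drop (Suc l) K))"
    by (intro sum.cong) auto
  also have "\<dots> = (\<Sum>l<Suc q. \<Sum>K | length K = Suc q. G (K ! l) (take l K @ drop (Suc l) K))"
    by (rule sum.swap)
  also have "\<dots> = (\<Sum>l<Suc q. \<Sum>J | length J = q. \<Sum>j\<in>UNIV. G j J)"
    by (intro sum.cong sum_lists_remove_nth) auto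
  finally show ?thesis by (simp add: G_def)
qed

text \<open>The covector \<open>d(cnj z\<^sub>j\<^sub>1) \<and> \<dots> \<and> d(cnj z\<^sub>j\<^sub>q)\<close> for \<open>J = [j\<^sub>1, \<dots>, j\<^sub>q]\<close>.  The test in the first
  equation makes it zero on lists of any other length than \<open>q\<close>.\<close>

primrec dzbar :: "'n list \<Rightarrow> (complex^'n) list \<Rightarrow> complex" where
  "dzbar [] = (\<lambda>vs. if vs = [] then 1 else 0)"
| "dzbar (j # J) = wedge (\<lambda>v vs. cnj (v $ j) * dzbar J vs)"

lemma dzbar_wrong_length: "length vs \<noteq> length J \<Longrightarrow> dzbar J vs = 0"
  by (induction J arbitrary: vs) (auto simp: wedge_def intro!: sum.neutral)

lemma alternating_dzbar: "antilinear_alternating (length J) (dzbar J)"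
proof (induction J)
  case Nil
  show ?case by (simp add: alternating_iff)
next
  case (Cons j J)
  then show ?case
    by (auto intro!: alternating_wedge alternating_cmult simp: distrib_right)
qed

lemma dzbar_eq_0_axis: "axis j 1 \<in> set vs \<Longrightarrow> j \<notin> set J \<Longrightarrow> dzbar J vs = 0"
proof (induction J arbitrary: vs)
  case (Cons i J)
  have "cnj (vs ! l $ i) * dzbar J (take l vs @ drop (Suc l) vs) = 0" if "l < length vs" for l
  proof (cases "vs ! l = axis j 1")
    case True
    have "axis j 1 $ i = (0 :: complex)" using Cons.prems by (auto simp: axis_def)
    then show ?thesis using True by simp
  next
    case False
    have "vs = take l vs @ vs ! l # drop (Suc l) vs" using that by (rule id_take_nth_drop)
    then have "set vs = insert (vs ! l) (set (take l vs @ drop (Suc l) vs))"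
      by (metis Un_insert_right list.simps(15) set_append)
    then have "axis j 1 \<in> set (take l vs @ drop (Suc l) vs)"
      using Cons.prems False by auto
    then show ?thesis using Cons.IH Cons.prems by auto
  qed
  then show ?case by (auto simp: wedge_def intro!: sum.neutral)
qed auto

lemma dzbar_Cons_axis:
  assumes "j \<notin> set J"
  shows "dzbar (j # J) (axis j 1 # vs) = dzbar J vs"
proof -
  have "removal_sum (\<lambda>v vs. cnj (v $ j) * dzbar J vs) [axis j 1] vs [] = 0"
  proof -
    have "dzbar J (axis j 1 # ws) = 0" for ws
      by (rule dzbar_eq_0_axis[of j]) (use assms in auto)
    then show ?thesis by (simp add: removal_sum_def)
  qed
  then show ?thesis
    by (simp add: wedge_removal_sum removal_sum_Cons axis_def)
qed

lemma dzbar_axis: "distinct J \<Longrightarrow> dzbar J (map (\<lambda>j. axis j 1) J) = 1"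
  by (induction J) (auto simp: dzbar_Cons_axis simp del: dzbar.simps(2))

lemma vec_eq_sum_axis: "v = (\<Sum>j\<in>UNIV. v $ j *s axis j (1::complex))"
  by (simp add: basis_expansion)

lemma dzbar_eq_0_no_axis:
  assumes "j \<notin> set K"
  shows "dzbar (j # J) (map (\<lambda>i. axis i 1) K) = 0"
proof -
  have "axis (K ! l) 1 $ j = (0 :: complex)" if "l < length K" for l
    using that assms by (auto simp: axis_def)
  then show ?thesis by (simp add: wedge_def)
qed

text \<open>It suffices to evaluate on standard basis vectors.  If \<open>e\<^sub>j\<close> occurs twice among them, alternation
  gives zero; otherwise one of the two factors \<open>d(cnj z\<^sub>j)\<close> meets no \<open>e\<^sub>j\<close>.\<close>

lemma dzbar_repeated: "dzbar (j # j # J) vs = 0"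
proof (cases "length vs = length (j # j # J)")
  case True
  show ?thesis
  proof (rule alternating_eq_0[OF alternating_dzbar _ _ True])
    show "\<exists>c. v = (\<Sum>j\<in>UNIV. c j *s axis j 1)" for v :: "complex^'a"
      using vec_eq_sum_axis by blast
  next
    fix K :: "'a list" assume K: "length K = length (j # j # J)"
    let ?e = "\<lambda>j :: 'a. axis j 1 :: complex^'a"
    show "dzbar (j # j # J) (map ?e K) = 0"
    proof (cases "\<exists>A B C. K = A @ j # B @ j # C")
      case True
      then obtain A B C where "K = A @ j # B @ j # C" by blast
      then show ?thesis
        using alternating_repeat[OF alternating_dzbar[of "j # j # J"],
          of "map ?e A" "map ?e B" "map ?e C" "?e j"] K by simp
    next
      case False
      have "cnj (map ?e K ! l $ j) * dzbar (j # J) (take l (map ?e K) @ drop (Suc l) (map ?e K)) = 0"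
        if l: "l < length K" for l
      proof (cases "K ! l = j")
        case True
        have Kl: "K = take l K @ j # drop (Suc l) K" using id_take_nth_drop[OF l] True by simp
        have "j \<notin> set (take l K)"
        proof
          assume "j \<in> set (take l K)"
          then obtain A B where "take l K = A @ j # B" by (meson split_list)
          then show False using False Kl by (metis append.assoc append_Cons)
        qed
        moreover have "j \<notin> set (drop (Suc l) K)"
        proof
          assume "j \<in> set (drop (Suc l) K)"
          then obtain A B where "drop (Suc l) K = A @ j # B" by (meson split_list)
          then show False using False Kl by metis
        qed
        ultimately have "j \<notin> set (take l K @ drop (Suc l) K)" by simp
        then have "dzbar (j # J) (map ?e (take l K @ drop (Suc l) K)) = 0"
          by (rule dzbar_eq_0_no_axis)
        then show ?thesis by (simp add: take_map drop_map)
      qed (use l in \<open>simp add: axis_def\<close>)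
      then show ?thesis
        by (subst dzbar.simps) (auto simp: wedge_def intro!: sum.neutral simp del: dzbar.simps)
    qed
  qed
qed (rule dzbar_wrong_length)

section \<open>The flat torus\<close>

text \<open>The torus is realised as a product of \<open>2 n\<close> circles, the image of \<open>\<complex>\<^sup>n\<close> under \<open>covering\<close>; this
  makes compactness and the Hausdorff property those of a closed bounded subset of a Euclidean
  space.\<close>

definition torus :: "((complex^'n) \<times> (complex^'n)) set" where
  "torus = {p. \<forall>j. cmod (fst p $ j) = 1 \<and> cmod (snd p $ j) = 1}"

definition covering :: "complex^'n \<Rightarrow> (complex^'n) \<times> (complex^'n)" where
  "covering z = ((\<chi> j. cis (Re (z $ j))), (\<chi> j. cis (Im (z $ j))))"

text \<open>The charts are the local inverses of \<open>covering\<close> on open cubes of side \<open>\<pi>\<close>, one for every centre.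
  On such a cube the inverse is given by principal arguments relative to the centre.  Every translate
  of a chart is again a chart, which makes the translation invariance of the volume immediate, and
  the side \<open>\<pi>\<close> is half a period, which makes the changes of charts translations
  (\<open>transition_translation\<close>).\<close>

definition cube :: "complex^'n \<Rightarrow> (complex^'n) set" where
  "cube c = {z. \<forall>j. \<bar>Re (z $ j) - Re (c $ j)\<bar> < pi / 2 \<and> \<bar>Im (z $ j) - Im (c $ j)\<bar> < pi / 2}"

definition local_lift :: "complex^'n \<Rightarrow> (complex^'n) \<times> (complex^'n) \<Rightarrow> complex^'n" where
  "local_lift c p = (\<chi> j. Complex (Re (c $ j) + Arg (fst p $ j * cis (- Re (c $ j))))
                                (Im (c $ j) + Arg (snd p $ j * cis (- Im (c $ j)))))"

abbreviation lift :: "(complex^'n) \<times> (complex^'n) \<Rightarrow> complex^'n" where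
  "lift \<equiv> local_lift 0"

definition torus_chart :: "complex^'n \<Rightarrow> ((complex^'n) \<times> (complex^'n), 'n) chart" where
  "torus_chart c = (covering ` cube c, local_lift c)"

definition torus_manifold :: "((complex^'n) \<times> (complex^'n), 'n) cmanifold" where
  "torus_manifold = \<lparr>pts = top_of_set torus, charts = range torus_chart\<rparr>"

definition periods :: "(complex^'n) set" where
  "periods = {m. \<forall>j. \<exists>a :: int. \<exists>b :: int. m $ j = Complex (2 * pi * a) (2 * pi * b)}"

lemma torus_manifold_simps [simp]:
  "pts torus_manifold = top_of_set torus" "charts torus_manifold = range torus_chart"
  by (simp_all add: torus_manifold_def)

lemma torus_chart_simps [simp]:
  "fst (torus_chart c) = covering ` cube c" "snd (torus_chart c) = local_lift c"
  by (simp_all add: torus_chart_def)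

lemma covering_in_torus [simp]: "covering z \<in> torus"
  by (simp add: covering_def torus_def)

lemma cis_times_cis_Arg: "cmod u = 1 \<Longrightarrow> cis x * cis (Arg (u * cis (- x))) = u"
proof -
  assume u: "cmod u = 1"
  then have "u * cis (- x) \<noteq> 0" by auto
  then have "cis (Arg (u * cis (- x))) = u * cis (- x)"
    using u by (simp add: cis_Arg sgn_div_norm norm_mult)
  then have "cis x * cis (Arg (u * cis (- x))) = u * (cis (- x) * cis x)" by (simp add: mult_ac)
  then show ?thesis by (simp add: cis_mult)
qed

lemma covering_local_lift: "p \<in> torus \<Longrightarrow> covering (local_lift c p) = p"
  by (simp add: covering_def local_lift_def torus_def prod_eq_iff vec_eq_iff cis_times_cis_Arg flip: cis_mult)

lemma covering_surj: "covering ` UNIV = torus"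
proof (intro equalityI subsetI)
  fix p :: "(complex^'a) \<times> (complex^'a)" assume "p \<in> torus"
  then show "p \<in> covering ` UNIV" using covering_local_lift[of p 0] by (metis rangeI)
qed (auto simp del: split_paired_All)

lemma local_lift_covering:
  assumes "z \<in> cube c"
  shows "local_lift c (covering z) = z"
proof -
  have "Arg (cis (Re (z $ j) - Re (c $ j))) = Re (z $ j) - Re (c $ j)"
    "Arg (cis (Im (z $ j) - Im (c $ j))) = Im (z $ j) - Im (c $ j)" for j
  proof -
    have "\<bar>Re (z $ j) - Re (c $ j)\<bar> < pi / 2" "\<bar>Im (z $ j) - Im (c $ j)\<bar> < pi / 2"
      using assms by (auto simp: cube_def)
    then show "Arg (cis (Re (z $ j) - Re (c $ j))) = Re (z $ j) - Re (c $ j)"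
      "Arg (cis (Im (z $ j) - Im (c $ j))) = Im (z $ j) - Im (c $ j)"
      using pi_gt_zero by (intro Arg_cis; simp add: abs_less_iff; linarith)+
  qed
  then show ?thesis
    by (simp add: local_lift_def covering_def vec_eq_iff cis_mult complex_eq_iff)
qed

lemma center_in_cube [simp]: "c \<in> cube c"
  by (simp add: cube_def)

lemma inj_on_covering: "inj_on covering (cube c)"
  by (metis inj_onI local_lift_covering)

text \<open>An argument is less than \<open>\<pi>/2\<close> in absolute value iff the real part is positive; so chart domains
  are described by strict inequalities between continuous functions.\<close>

lemma cube_eq_lift:
  assumes "p \<in> torus"
  shows "p \<in> covering ` cube c \<longleftrightarrow>
    (\<forall>j. 0 < Re (fst p $ j * cis (- Re (c $ j))) \<and> 0 < Re (snd p $ j * cis (- Im (c $ j))))"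
proof -
  have nz: "fst p $ j * cis (- Re (c $ j)) \<noteq> 0" "snd p $ j * cis (- Im (c $ j)) \<noteq> 0" for j
    using assms by (auto simp: torus_def) (metis norm_zero zero_neq_one)+
  have "p \<in> covering ` cube c \<longleftrightarrow> local_lift c p \<in> cube c"
    using assms covering_local_lift local_lift_covering by (metis image_iff)
  also have "\<dots> \<longleftrightarrow> (\<forall>j. \<bar>Arg (fst p $ j * cis (- Re (c $ j)))\<bar> < pi / 2 \<and>
      \<bar>Arg (snd p $ j * cis (- Im (c $ j)))\<bar> < pi / 2)"
    by (simp add: cube_def local_lift_def)
  finally show ?thesis using nz by (simp only: Arg_Re_pos) blast
qed

lemma continuous_on_covering: "continuous_on S covering"
  unfolding covering_def by (intro continuous_intros)

lemma open_cube [simp]: "open (cube c)"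
proof -
  have "cube c = (\<Inter>j. {z. \<bar>Re (z $ j) - Re (c $ j)\<bar> < pi / 2} \<inter> {z. \<bar>Im (z $ j) - Im (c $ j)\<bar> < pi / 2})"
    by (auto simp: cube_def)
  also have "open \<dots>"
    by (intro open_INT open_Int open_Collect_less continuous_intros ballI) auto
  finally show ?thesis .
qed

lemma chart_domain_eq:
  "covering ` cube c = torus \<inter>
    (\<Inter>j. {p. 0 < Re (fst p $ j * cis (- Re (c $ j)))} \<inter> {p. 0 < Re (snd p $ j * cis (- Im (c $ j)))})"
proof (rule set_eqI)
  fix p :: "(complex^'a) \<times> (complex^'a)"
  have "p \<in> covering ` cube c \<Longrightarrow> p \<in> torus" by auto
  then show "p \<in> covering ` cube c \<longleftrightarrow> p \<in> torus \<inter> (\<Inter>j. {p. 0 < Re (fst p $ j * cis (- Re (c $ j)))} \<inter>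
      {p. 0 < Re (snd p $ j * cis (- Im (c $ j)))})"
    using cube_eq_lift[of p c] unfolding Int_iff INT_iff mem_Collect_eq by blast
qed

lemma openin_chart_domain: "openin (top_of_set torus) (covering ` cube c)"
  unfolding chart_domain_eq
  by (intro openin_open_Int open_INT open_Int open_Collect_less continuous_intros ballI) auto

lemma chart_domain_subset: "covering ` cube c \<subseteq> torus"
  by auto

lemma local_lift_chart_domain: "local_lift c ` covering ` cube c = cube c"
  by (force simp: image_image local_lift_covering)

lemma local_lift_in_cube: "p \<in> covering ` cube c \<Longrightarrow> local_lift c p \<in> cube c"
  using local_lift_chart_domain by blast

lemma continuous_on_local_lift: "continuous_on (covering ` cube c) (local_lift c)"
proof -
  have "continuous_on (covering ` cube c) (\<lambda>p. Arg (fst p $ j * cis (- Re (c $ j))))"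
    "continuous_on (covering ` cube c) (\<lambda>p. Arg (snd p $ j * cis (- Im (c $ j))))" for j
  proof -
    have nonpos: "u \<notin> \<real>\<^sub>\<le>\<^sub>0" if "0 < Re u" for u :: complex
      using that by (auto simp: complex_nonpos_Reals_iff)
    have *: "fst p $ j * cis (- Re (c $ j)) \<notin> \<real>\<^sub>\<le>\<^sub>0" "snd p $ j * cis (- Im (c $ j)) \<notin> \<real>\<^sub>\<le>\<^sub>0"
      if p: "p \<in> covering ` cube c" for p
    proof -
      have "p \<in> torus" using p chart_domain_subset by blast
      then have "0 < Re (fst p $ j * cis (- Re (c $ j)))" "0 < Re (snd p $ j * cis (- Im (c $ j)))"
        using cube_eq_lift[of p c] p by blast+
      then show "fst p $ j * cis (- Re (c $ j)) \<notin> \<real>\<^sub>\<le>\<^sub>0" "snd p $ j * cis (- Im (c $ j)) \<notin> \<real>\<^sub>\<le>\<^sub>0"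
        using nonpos by blast+
    qed
    show "continuous_on (covering ` cube c) (\<lambda>p. Arg (fst p $ j * cis (- Re (c $ j))))"
      by (intro continuous_on_Arg' continuous_intros) (use * in blast)
    show "continuous_on (covering ` cube c) (\<lambda>p. Arg (snd p $ j * cis (- Im (c $ j))))"
      by (intro continuous_on_Arg' continuous_intros) (use * in blast)
  qed
  then show ?thesis
    unfolding local_lift_def Complex_eq
    by (intro continuous_on_vec_lambda continuous_on_add continuous_on_mult continuous_on_const continuous_on_of_real)
qed

lemma chart_inv_torus_chart: "z \<in> cube c \<Longrightarrow> chart_inv (torus_chart c) z = covering z"
  unfolding chart_inv_def
proof (rule inv_into_f_eq)
  show "inj_on (snd (torus_chart c)) (fst (torus_chart c))"
    unfolding torus_chart_simps
    by (rule inj_on_inverseI[where g = covering]) (use chart_domain_subset covering_local_lift in blast)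
qed (auto simp: local_lift_covering)

lemma cis_eq_cis_iff: "cis x = cis y \<longleftrightarrow> (\<exists>n::int. x = y + 2 * pi * n)"
  using sin_cos_eq_iff[of x y] by (auto simp: complex_eq_iff)

lemma covering_eq_iff: "covering z = covering w \<longleftrightarrow> z - w \<in> periods"
proof -
  have "covering z = covering w \<longleftrightarrow> (\<forall>j. (\<exists>a::int. Re (z $ j) = Re (w $ j) + 2 * pi * a) \<and>
      (\<exists>b::int. Im (z $ j) = Im (w $ j) + 2 * pi * b))"
    unfolding covering_def by (simp add: vec_eq_iff all_conj_distrib flip: cis_eq_cis_iff)
  also have "\<dots> \<longleftrightarrow> z - w \<in> periods"
    unfolding periods_def by (simp add: complex_eq_iff diff_eq_eq add.commute)
  finally show ?thesis .
qed

lemma periods_eq_if_close: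
  assumes "m \<in> periods" "m' \<in> periods"
    and "\<And>j. \<bar>Re (m $ j) - Re (m' $ j)\<bar> < 2 * pi" "\<And>j. \<bar>Im (m $ j) - Im (m' $ j)\<bar> < 2 * pi"
  shows "m = m'"
proof -
  have int_eq: "a = b" if "\<bar>2 * pi * real_of_int a - 2 * pi * real_of_int b\<bar> < 2 * pi" for a b
  proof -
    have "\<bar>2 * pi * real_of_int a - 2 * pi * real_of_int b\<bar> = 2 * pi * real_of_int \<bar>a - b\<bar>"
      by (simp add: abs_mult flip: right_diff_distrib)
    then have "real_of_int \<bar>a - b\<bar> < 1" using that pi_gt_zero by simp
    then show "a = b" by linarith
  qed
  have "m $ j = m' $ j" for j
  proof -
    obtain a b where 1: "m $ j = Complex (2 * pi * real_of_int a) (2 * pi * real_of_int b)"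
      using assms(1) unfolding periods_def by blast
    obtain a' b' where 2: "m' $ j = Complex (2 * pi * real_of_int a') (2 * pi * real_of_int b')"
      using assms(2) unfolding periods_def by blast
    show ?thesis using assms(3,4)[of j] int_eq[of a a'] int_eq[of b b'] 1 2 by simp
  qed
  then show ?thesis by (simp add: vec_eq_iff)
qed

lemma countable_periods: "countable (periods :: (complex^'n::finite) set)"
proof -
  define g :: "(int^'n) \<times> (int^'n) \<Rightarrow> complex^'n"
    where "g = (\<lambda>(a, b). \<chi> j. Complex (2 * pi * real_of_int (a $ j)) (2 * pi * real_of_int (b $ j)))"
  have "periods \<subseteq> range g"
  proof
    fix m :: "complex^'n" assume "m \<in> periods"
    then obtain a b where ab: "\<And>j. m $ j = Complex (2 * pi * real_of_int (a j)) (2 * pi * real_of_int (b j))"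
      unfolding periods_def by simp metis
    show "m \<in> range g"
      by (rule range_eqI[of _ _ "((\<chi> j. a j), (\<chi> j. b j))"]) (simp add: vec_eq_iff ab g_def)
  qed
  then show ?thesis by (rule countable_subset) simp
qed

text \<open>The cubes are so small that two charts differ by one and the same period wherever both
  are defined.\<close>

lemma transition_translation:
  assumes "z \<in> cube c" "z' \<in> cube c" "covering z \<in> covering ` cube d" "covering z' \<in> covering ` cube d"
  shows "local_lift d (covering z') = z' + (local_lift d (covering z) - z)"
proof -
  have in_d: "local_lift d (covering z) \<in> cube d" "local_lift d (covering z') \<in> cube d"
    using local_lift_in_cube[OF assms(3)] local_lift_in_cube[OF assms(4)] by auto
  have "local_lift d (covering z') - z' = local_lift d (covering z) - z"
  proof (rule periods_eq_if_close)
    show "local_lift d (covering z') - z' \<in> periods" "local_lift d (covering z) - z \<in> periods"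
      by (simp_all add: covering_local_lift flip: covering_eq_iff)
    show "\<bar>Re ((local_lift d (covering z') - z') $ j) - Re ((local_lift d (covering z) - z) $ j)\<bar> < 2 * pi"
      "\<bar>Im ((local_lift d (covering z') - z') $ j) - Im ((local_lift d (covering z) - z) $ j)\<bar> < 2 * pi" for j
    proof -
      have *: "\<bar>Re (x $ j) - Re (e $ j)\<bar> < pi / 2" "\<bar>Im (x $ j) - Im (e $ j)\<bar> < pi / 2"
        if "x \<in> cube e" for x e :: "complex^'a"
        using that by (auto simp: cube_def)
      show "\<bar>Re ((local_lift d (covering z') - z') $ j) - Re ((local_lift d (covering z) - z) $ j)\<bar> < 2 * pi"
        using *(1)[OF assms(1)] *(1)[OF assms(2)] *(1)[OF in_d(1)] *(1)[OF in_d(2)]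
        unfolding abs_less_iff vector_minus_component minus_complex.sel by (intro conjI; linarith)
      show "\<bar>Im ((local_lift d (covering z') - z') $ j) - Im ((local_lift d (covering z) - z) $ j)\<bar> < 2 * pi"
        using *(2)[OF assms(1)] *(2)[OF assms(2)] *(2)[OF in_d(1)] *(2)[OF in_d(2)]
        unfolding abs_less_iff vector_minus_component minus_complex.sel by (intro conjI; linarith)
    qed
  qed
  then show ?thesis by (simp add: algebra_simps)
qed

lemma open_chart_preimage: "open {z \<in> cube c. covering z \<in> covering ` cube d}"
proof -
  have "{z \<in> cube c. covering z \<in> covering ` cube d} = cube c \<inter>
    (\<Inter>j. {z. 0 < Re (fst (covering z) $ j * cis (- Re (d $ j)))} \<inter>
      {z. 0 < Re (snd (covering z) $ j * cis (- Im (d $ j)))})"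
    using cube_eq_lift[of "covering _" d] by auto
  also have "open \<dots>"
    by (intro open_Int open_cube open_INT open_Int open_Collect_less continuous_intros
        continuous_on_covering ballI) auto
  finally show ?thesis .
qed

lemma chart_change_has_derivative:
  assumes "z \<in> cube c" "covering z \<in> covering ` cube d"
  shows "(chart_change (torus_chart c) (torus_chart d) has_derivative (\<lambda>v. v)) (at z)"
proof -
  let ?S = "{z \<in> cube c. covering z \<in> covering ` cube d}"
  have "((\<lambda>x. x + (local_lift d (covering z) - z)) has_derivative (\<lambda>v. v)) (at z)"
    by (auto intro!: derivative_eq_intros)
  moreover have "open ?S" by (rule open_chart_preimage)
  moreover have "z \<in> ?S" using assms by simp
  moreover have "x + (local_lift d (covering z) - z) = chart_change (torus_chart c) (torus_chart d) x"
    if "x \<in> ?S" for x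
    using transition_translation[of z c x d] assms that
    by (auto simp: chart_change_def chart_inv_torus_chart)
  ultimately show ?thesis by (rule has_derivative_transform_within_open)
qed

text \<open>So coefficients of tensors do not depend on the chart; all tensors on the torus are compared
  through this lemma.\<close>

lemma chart_change_deriv_torus:
  assumes "p \<in> covering ` cube c" "p \<in> covering ` cube d"
  shows "chart_change_deriv (torus_chart c) (torus_chart d) p = (\<lambda>v. v)"
proof -
  have p: "p \<in> torus" using assms chart_domain_subset by blast
  have "local_lift c p \<in> cube c" using assms(1) by (rule local_lift_in_cube)
  moreover have "covering (local_lift c p) = p" by (rule covering_local_lift[OF p])
  ultimately have "(chart_change (torus_chart c) (torus_chart d) has_derivative (\<lambda>v. v)) (at (local_lift c p))"
    using assms by (intro chart_change_has_derivative) auto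
  from frechet_derivative_at[OF this] show ?thesis
    unfolding chart_change_deriv_def by simp
qed

lemma second_countable_euclidean: "second_countable (euclidean :: 'a::second_countable_topology topology)"
proof -
  obtain B :: "'a set set" where B: "countable B" "\<And>c. c \<in> B \<Longrightarrow> open c"
    "\<And>S. open S \<Longrightarrow> \<exists>U\<subseteq>B. S = \<Union>U"
    using univ_second_countable by metis
  show ?thesis
    unfolding second_countable_def
  proof (intro exI conjI allI impI ballI)
    fix U x assume "openin euclidean U \<and> (x::'a) \<in> U"
    then obtain V where "V \<subseteq> B" "U = \<Union>V" "x \<in> U" using B(3) by (metis open_openin)
    then show "\<exists>V\<in>B. x \<in> V \<and> V \<subseteq> U" by blast
  qed (use B in auto)
qed

lemma complex_manifold_torus: "complex_manifold (torus_manifold :: ((complex^'n) \<times> (complex^'n), 'n::finite) cmanifold)"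
  unfolding complex_manifold_def
proof (intro conjI ballI)
  show "Hausdorff_space (pts torus_manifold)" by (simp add: Hausdorff_space_subtopology)
  show "second_countable (pts torus_manifold)"
    by (simp add: second_countable_subtopology second_countable_euclidean)
  show "(\<Union>c\<in>charts torus_manifold. fst c) = topspace (pts (torus_manifold :: ((complex^'n) \<times> (complex^'n), 'n) cmanifold))"
  proof -
    have "p \<in> covering ` cube (lift p)" if "p \<in> torus" for p :: "(complex^'n) \<times> (complex^'n)"
      using covering_local_lift[OF that, of 0] center_in_cube by (metis image_eqI)
    then have "torus \<subseteq> (\<Union>c :: complex^'n. covering ` cube c)" by blast
    moreover have "(\<Union>c :: complex^'n. covering ` cube c) \<subseteq> torus" using chart_domain_subset by blast
    ultimately show ?thesis by simp
  qed
next
  fix c assume "c \<in> charts (torus_manifold :: ((complex^'n) \<times> (complex^'n), 'n) cmanifold)"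
  then obtain x where c: "c = torus_chart x" by auto
  show "openin (pts torus_manifold) (fst c)" by (simp add: c openin_chart_domain)
  show "open (snd c ` fst c)" by (simp add: c local_lift_chart_domain)
  show "homeomorphic_map (subtopology (pts torus_manifold) (fst c)) (top_of_set (snd c ` fst c)) (snd c)"
    unfolding homeomorphic_map_maps homeomorphic_maps_def
  proof (intro exI conjI ballI)
    have sub: "subtopology (pts torus_manifold) (fst c) = top_of_set (covering ` cube x)"
      by (simp add: c subtopology_subtopology inf.absorb2 chart_domain_subset)
    show "continuous_map (subtopology (pts torus_manifold) (fst c)) (top_of_set (snd c ` fst c)) (snd c)"
      unfolding sub by (simp add: c continuous_map_in_subtopology continuous_on_local_lift)
    show "continuous_map (top_of_set (snd c ` fst c)) (subtopology (pts torus_manifold) (fst c)) covering"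
      unfolding sub by (simp add: c continuous_map_in_subtopology continuous_on_covering local_lift_chart_domain)
    show "covering (snd c y) = y" if "y \<in> topspace (subtopology (pts torus_manifold) (fst c))" for y
      using that by (simp add: c covering_local_lift)
    show "snd c (covering y) = y" if "y \<in> topspace (top_of_set (snd c ` fst c))" for y
      using that by (simp add: c local_lift_chart_domain local_lift_covering)
  qed
next
  fix c d assume "c \<in> charts (torus_manifold :: ((complex^'n) \<times> (complex^'n), 'n) cmanifold)"
    "d \<in> charts (torus_manifold :: ((complex^'n) \<times> (complex^'n), 'n) cmanifold)"
  then obtain x y where c: "c = torus_chart x" and d: "d = torus_chart y" by auto
  show "holomorphic_map_on (chart_change c d) (snd c ` (fst c \<inter> fst d))"
    unfolding holomorphic_map_on_def
  proof
    fix z assume "z \<in> snd c ` (fst c \<inter> fst d)"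
    then obtain p where p: "p \<in> covering ` cube x" "p \<in> covering ` cube y" "z = local_lift x p"
      unfolding c d torus_chart_simps by blast
    then obtain z' where z': "z' \<in> cube x" "covering z' \<in> covering ` cube y" "z = local_lift x (covering z')"
      by blast
    then have "z = z'" using local_lift_covering by simp
    then have "(chart_change c d has_derivative (\<lambda>v. v)) (at z)"
      unfolding c d using z' by (intro chart_change_has_derivative) auto
    then show "\<exists>D. (chart_change c d has_derivative D) (at z) \<and> (\<forall>t v. D (t *s v) = t *s D v)" by blast
  qed
qed

lemma compact_torus: "compact (torus :: ((complex^'n::finite) \<times> (complex^'n)) set)"
proof -
  have "closed (torus :: ((complex^'n) \<times> (complex^'n)) set)"
  proof -
    have "torus = (\<Inter>j::'n. {p. cmod (fst p $ j) = 1} \<inter> {p. cmod (snd p $ j) = 1})"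
      unfolding torus_def by blast
    also have "closed \<dots>"
      by (intro closed_INT closed_Int closed_Collect_eq continuous_intros ballI)
    finally show ?thesis .
  qed
  moreover have "bounded (torus :: ((complex^'n) \<times> (complex^'n)) set)"
  proof (rule boundedI)
    fix p :: "(complex^'n) \<times> (complex^'n)" assume p: "p \<in> torus"
    have "norm p \<le> norm (fst p) + norm (snd p)" 
      using norm_Pair_le[of "fst p" "snd p"] by simp
    also have "norm (fst p) \<le> (\<Sum>j\<in>UNIV. cmod (fst p $ j))" unfolding norm_vec_def by (rule L2_set_le_sum) simp
    also have "norm (snd p) \<le> (\<Sum>j\<in>UNIV. cmod (snd p $ j))" unfolding norm_vec_def by (rule L2_set_le_sum) simp
    finally show "norm p \<le> real CARD('n) + real CARD('n)" using p by (simp add: torus_def)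
  qed
  ultimately show ?thesis using compact_eq_bounded_closed by blast
qed

lemma compact_space_torus: "compact_space (pts torus_manifold)"
  by (simp add: compact_space_subtopology compact_torus)

definition flat_metric :: "((complex^'n) \<times> (complex^'n), 'n) tangent_metric" where
  "flat_metric c p v w = (\<Sum>j\<in>UNIV. v $ j * cnj (w $ j))"

lemma flat_metric_self: "flat_metric c p v v = of_real (\<Sum>j\<in>UNIV. (cmod (v $ j))\<^sup>2)"
  by (simp only: flat_metric_def of_real_sum complex_norm_square)

lemma hermitian_metric_flat: "hermitian_metric torus_manifold flat_metric"
  unfolding hermitian_metric_def
proof (intro conjI ballI allI impI)
  fix c and p :: "(complex^'a) \<times> (complex^'a)" and t and u v w :: "complex^'a"
  show "flat_metric c p (u + v) w = flat_metric c p u w + flat_metric c p v w"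
    by (simp add: flat_metric_def distrib_right sum.distrib)
  show "flat_metric c p (t *s v) w = t * flat_metric c p v w"
    by (simp add: flat_metric_def sum_distrib_left mult.assoc)
  show "flat_metric c p w v = cnj (flat_metric c p v w)"
    by (simp add: flat_metric_def mult.commute)
  assume "v \<noteq> 0"
  then obtain i where "v $ i \<noteq> 0" by (auto simp: vec_eq_iff)
  then have "0 < (\<Sum>j\<in>UNIV. (cmod (v $ j))\<^sup>2)"
    by (intro sum_pos2[of _ i]) auto
  then show "Re (flat_metric c p v v) > 0" by (simp add: flat_metric_self)
next
  fix c :: "((complex^'a) \<times> (complex^'a), 'a) chart" and v w :: "complex^'a" assume "c \<in> charts torus_manifold"
  then have "open (snd c ` fst c)" by (auto simp: local_lift_chart_domain)
  then show "smooth_map_on (\<lambda>z. flat_metric c (chart_inv c z) v w) (snd c ` fst c)"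
    unfolding flat_metric_def smooth_map_on_def by (simp add: Ck_on_const)
next
  fix c d :: "((complex^'a) \<times> (complex^'a), 'a) chart"
    and p :: "(complex^'a) \<times> (complex^'a)" and v w :: "complex^'a"
  assume "c \<in> charts torus_manifold" "d \<in> charts torus_manifold" and p: "p \<in> fst c \<inter> fst d"
  then obtain x y where "c = torus_chart x" "d = torus_chart y" by auto
  then have "chart_change_deriv c d p = (\<lambda>v. v)"
    using p by (simp add: chart_change_deriv_torus)
  then show "flat_metric c p v w = flat_metric d p (chart_change_deriv c d p v) (chart_change_deriv c d p w)"
    by (simp add: flat_metric_def)
qed

text \<open>A single global frame.  The twist by the powers of the bundle is entirely in the weight.\<close>

definition trivial_bundle :: "((complex^'n) \<times> (complex^'n), nat) line_bundle" where
  "trivial_bundle = \<lparr>frames = {0}, fdom = (\<lambda>i. torus), trans_fun = (\<lambda>i j p. 1)\<rparr>"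

lemma trivial_bundle_simps [simp]:
  "frames trivial_bundle = {0}" "fdom trivial_bundle i = torus" "trans_fun trivial_bundle i j p = 1"
  by (simp_all add: trivial_bundle_def)

lemma bundle_power_trivial: "bundle_power trivial_bundle k = trivial_bundle"
  by (simp add: bundle_power_def trivial_bundle_def)

lemma chart_domain_Int_torus: "covering ` cube c \<inter> torus = covering ` cube c"
  using chart_domain_subset by blast

lemma holomorphic_line_bundle_trivial: "holomorphic_line_bundle torus_manifold trivial_bundle"
proof -
  have "holomorphic_fun_on (\<lambda>z. 1) S" for S :: "(complex^'a) set"
    unfolding holomorphic_fun_on_def
  proof
    fix z :: "complex^'a"
    show "\<exists>D. ((\<lambda>z. 1) has_derivative D) (at z) \<and> (\<forall>t v. D (t *s v) = t * D v)"
      by (rule exI[of _ "\<lambda>v. 0"]) simp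
  qed
  then show ?thesis by (simp add: holomorphic_line_bundle_def)
qed

text \<open>Functions on the torus are functions on \<open>\<complex>\<^sup>n\<close> that factor through \<open>covering\<close>.  The function on
  the torus is \<open>\<lambda>p. F (lift p)\<close>; \<open>lift\<close> is discontinuous, but for continuous periodic \<open>F\<close>
  the composition is continuous (\<open>continuous_on_torus_lift\<close>).\<close>

definition periodic :: "(complex^'n \<Rightarrow> 'b) \<Rightarrow> bool" where
  "periodic F \<longleftrightarrow> (\<forall>z w. covering z = covering w \<longrightarrow> F z = F w)"

lemma periodicD: "periodic F \<Longrightarrow> covering z = covering w \<Longrightarrow> F z = F w"
  unfolding periodic_def by blast

lemma periodic_local_lift:
  assumes "periodic F"
  shows "F (local_lift c (covering z)) = F z"
proof -
  have "covering (local_lift c (covering z)) = covering z" by (simp add: covering_local_lift)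
  then show ?thesis by (rule periodicD[OF assms])
qed

definition weight_metric :: "(complex^'n \<Rightarrow> real) \<Rightarrow> nat \<Rightarrow> (complex^'n) \<times> (complex^'n) \<Rightarrow> real" where
  "weight_metric W i p = W (lift p)"

lemma metric_power_weight: "metric_power (weight_metric W) k = weight_metric (\<lambda>z. W z ^ k)"
  unfolding metric_power_def weight_metric_def ..

lemma bundle_metric_weight:
  assumes W: "periodic W" "\<And>z. W z > 0" "smooth_map_on W UNIV"
  shows "bundle_metric torus_manifold trivial_bundle (weight_metric W)"
  unfolding bundle_metric_def
proof (intro conjI ballI)
  fix i c assume "c \<in> charts (torus_manifold :: ((complex^'a) \<times> (complex^'a), 'a) cmanifold)"
  then obtain x where c: "c = torus_chart x" by auto
  have "smooth_map_on (\<lambda>z. weight_metric W i (chart_inv c z)) (cube x)"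
    by (rule smooth_map_on_cong[OF smooth_map_on_subset[OF W(3)]])
      (simp_all add: c chart_inv_torus_chart weight_metric_def periodic_local_lift[OF W(1)])
  then show "smooth_map_on (\<lambda>z. weight_metric W i (chart_inv c z)) (snd c ` (fst c \<inter> fdom trivial_bundle i))"
    by (simp add: c chart_domain_Int_torus local_lift_chart_domain)
next
  fix i p assume "p \<in> fdom (trivial_bundle :: ((complex^'a) \<times> (complex^'a), nat) line_bundle) i"
  show "0 < weight_metric W i p" using W(2) by (simp add: weight_metric_def)
next
  fix i j p
  show "weight_metric W j p = (cmod (trans_fun trivial_bundle i j p))\<^sup>2 * weight_metric W i p"
    by (simp add: weight_metric_def)
qed

section \<open>The volume measure of the torus and integration by parts\<close>

lemma flat_metric_axis: "flat_metric c p (axis a 1) (axis b 1) = (if a = b then 1 else 0)"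
proof -
  have "axis a (1::complex) $ j * cnj (axis b 1 $ j) = (if j = a then if a = b then 1 else 0 else 0)" for j :: 'a
    by (simp add: axis_def)
  then show ?thesis by (simp add: flat_metric_def)
qed

lemma flat_metric_det: "det (\<chi> a b. flat_metric c p (axis a 1) (axis b 1)) = 1"
proof -
  have "(\<chi> a b. flat_metric c p (axis a 1) (axis b 1)) = (mat 1 :: complex^'a^'a)"
    by (simp add: flat_metric_axis mat_def vec_eq_iff)
  then show ?thesis by simp
qed

lemma closed_torus: "closed (torus :: ((complex^'n::finite) \<times> (complex^'n)) set)"
  by (rule compact_imp_closed[OF compact_torus])

lemma sets_torus:
  "sigma_sets torus {U. openin (top_of_set torus) U} =
    sets (restrict_space borel (torus :: ((complex^'n::finite) \<times> (complex^'n)) set))"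
proof -
  have "{U. openin (top_of_set torus) U} = (\<inter>) torus ` {S :: ((complex^'n) \<times> (complex^'n)) set. open S}"
    by (auto simp: openin_open)
  moreover have "torus \<in> sigma_sets UNIV {S :: ((complex^'n) \<times> (complex^'n)) set. open S}"
  proof -
    have "(torus :: ((complex^'n) \<times> (complex^'n)) set) \<in> sets borel" by (rule borel_closed[OF closed_torus])
    then show ?thesis by (simp add: borel_def)
  qed
  ultimately show ?thesis
    by (simp add: sets_restrict_space sigma_sets_Int borel_def)
qed

lemma sets_torus_borel:
  "B \<in> sets (restrict_space borel torus) \<Longrightarrow> B \<in> sets borel"
  for B :: "((complex^'n::finite) \<times> (complex^'n)) set"
  by (simp add: sets_restrict_space_iff borel_closed[OF closed_torus])

lemma openin_torus_measurable:
  "openin (top_of_set torus) U \<Longrightarrow> U \<in> sets (restrict_space borel torus)"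
  for U :: "((complex^'n::finite) \<times> (complex^'n)) set"
  unfolding sets_torus[symmetric] by (rule sigma_sets.Basic) simp

lemma measurable_covering [measurable]: "covering \<in> borel_measurable (borel :: (complex^'n::finite) measure)"
  by (rule borel_measurable_continuous_onI[OF continuous_on_covering])

lemma vimage_covering_measurable:
  "B \<in> sets borel \<Longrightarrow> covering -` B \<in> sets (borel :: (complex^'n::finite) measure)"
  using measurable_sets[OF measurable_covering] by fastforce

text \<open>In the flat metric the density is \<open>1\<close>, so the volume is Lebesgue measure in every chart.\<close>

lemma is_volume_measure_torus_iff:
  fixes \<mu> :: "((complex^'n::finite) \<times> (complex^'n)) measure"
  shows "is_volume_measure torus_manifold flat_metric \<mu> \<longleftrightarrow>
    space \<mu> = torus \<and> sets \<mu> = sets (restrict_space borel torus) \<and>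
    (\<forall>c. \<forall>B\<in>sets \<mu>. B \<subseteq> covering ` cube c \<longrightarrow> emeasure \<mu> B = emeasure lborel (cube c \<inter> covering -` B))"
proof -
  have "(\<integral>\<^sup>+z\<in>local_lift c ` B. ennreal (Re (det (\<chi> a b. flat_metric (torus_chart c) (chart_inv (torus_chart c) z)
          (axis a 1) (axis b 1)))) \<partial>lborel) = emeasure lborel (cube c \<inter> covering -` B)"
    if "B \<in> sets (restrict_space borel torus)" "B \<subseteq> covering ` cube c" for c :: "complex^'n" and B
  proof -
    have "local_lift c ` B = cube c \<inter> covering -` B"
    proof (intro equalityI subsetI)
      fix z assume "z \<in> local_lift c ` B"
      then obtain p where p: "p \<in> B" "z = local_lift c p" by blast
      moreover have "p \<in> torus" using p that chart_domain_subset by blast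
      ultimately have "local_lift c p \<in> cube c" "covering (local_lift c p) = p"
        using that(2) local_lift_in_cube covering_local_lift by blast+
      then show "z \<in> cube c \<inter> covering -` B" using p by simp
    next
      fix z assume "z \<in> cube c \<inter> covering -` B"
      then show "z \<in> local_lift c ` B" using local_lift_covering[of z c] by (metis IntE imageI vimageE)
    qed
    moreover have "cube c \<inter> covering -` B \<in> sets lborel"
      using vimage_covering_measurable[OF sets_torus_borel[OF that(1)]] by (simp add: borel_open sets.Int)
    ultimately show ?thesis by (simp add: flat_metric_det)
  qed
  then show ?thesis
    unfolding is_volume_measure_def torus_manifold_simps sets_torus topspace_euclidean_subtopology
    by (simp cong: conj_cong)
qed

lemma emeasure_lborel_translation:
  "A \<in> sets borel \<Longrightarrow> emeasure lborel ((\<lambda>z. z + t) -` A) = emeasure lborel (A :: 'a::euclidean_space set)"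
proof -
  assume A: "A \<in> sets borel"
  have "emeasure lborel A = emeasure (distr lborel borel ((+) t)) A" by (simp add: lborel_distr_plus)
  also have "\<dots> = emeasure lborel ((+) t -` A)" using A by (subst emeasure_distr) auto
  also have "(+) t -` A = (\<lambda>z. z + t) -` A" by (auto simp: add.commute)
  finally show ?thesis ..
qed

text \<open>A half-open fundamental domain of the covering: the image of \<open>lift\<close>.\<close>

definition cell :: "(complex^'n) set" where
  "cell = {z. \<forall>j. - pi < Re (z $ j) \<and> Re (z $ j) \<le> pi \<and> - pi < Im (z $ j) \<and> Im (z $ j) \<le> pi}"

lemma cell_measurable: "cell \<in> sets (borel :: (complex^'n::finite) measure)"
proof -
  have "cell = (\<Inter>j::'n. {z. - pi < Re (z $ j)} \<inter> {z. Re (z $ j) \<le> pi} \<inter> {z. - pi < Im (z $ j)} \<inter> {z. Im (z $ j) \<le> pi})"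
    by (auto simp: cell_def)
  also have "\<dots> \<in> sets borel"
    by (intro sets.finite_INT sets.Int borel_open borel_closed open_Collect_less closed_Collect_le continuous_intros) auto
  finally show ?thesis .
qed

lemma lift_in_cell: "lift p \<in> cell"
  using Arg_bounded by (simp add: cell_def local_lift_def)

lemma cell_unique: "z - m \<in> cell \<Longrightarrow> z - m' \<in> cell \<Longrightarrow> m \<in> periods \<Longrightarrow> m' \<in> periods \<Longrightarrow> m = m'"
proof (rule periods_eq_if_close)
  assume 1: "z - m \<in> cell" "z - m' \<in> cell"
  fix j
  have "- pi < Re (z $ j) - Re (m $ j)" "Re (z $ j) - Re (m $ j) \<le> pi"
    "- pi < Im (z $ j) - Im (m $ j)" "Im (z $ j) - Im (m $ j) \<le> pi"
    "- pi < Re (z $ j) - Re (m' $ j)" "Re (z $ j) - Re (m' $ j) \<le> pi"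
    "- pi < Im (z $ j) - Im (m' $ j)" "Im (z $ j) - Im (m' $ j) \<le> pi"
    using 1 by (auto simp: cell_def)
  then show "\<bar>Re (m $ j) - Re (m' $ j)\<bar> < 2 * pi" "\<bar>Im (m $ j) - Im (m' $ j)\<bar> < 2 * pi"
    unfolding abs_less_iff by (intro conjI; linarith)+
qed

lemma covering_add_period: "m \<in> periods \<Longrightarrow> covering (z + m) = covering z"
  by (simp add: covering_eq_iff)

text \<open>Both sets consist of one representative in \<open>\<complex>\<^sup>n\<close> for every point of \<open>B\<close>.  Cut them into countably
  many pieces according to the period by which the two representatives of a point differ; the
  corresponding pieces are translates of each other.\<close>

lemma emeasure_cell_covering:
  fixes c :: "complex^'n::finite"
  assumes "B \<in> sets borel" "B \<subseteq> covering ` cube c"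
  shows "emeasure lborel (cell \<inter> covering -` B) = emeasure lborel (cube c \<inter> covering -` B)"
proof -
  define D where "D = cube c \<inter> covering -` B"
  have vB: "covering -` B \<in> sets borel" by (rule vimage_covering_measurable[OF assms(1)])
  have D: "D \<in> sets borel" unfolding D_def by (rule sets.Int[OF borel_open[OF open_cube] vB])
  have tr: "(\<lambda>z. z + m) -` A \<in> sets borel" if "A \<in> sets borel" for m :: "complex^'n" and A
    using measurable_sets[of "\<lambda>z. z + m" borel borel A] that by simp
  define X where "X = (\<lambda>m. D \<inter> (\<lambda>z. z + (- m)) -` cell)"
  define Y where "Y = (\<lambda>m. (cell \<inter> covering -` B) \<inter> (\<lambda>z. z + m) -` cube c)"
  have X: "X m \<in> sets lborel" and Y: "Y m \<in> sets lborel" for m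
    using sets.Int[OF D tr[OF cell_measurable, of "- m"]]
      sets.Int[OF sets.Int[OF cell_measurable vB] tr[OF borel_open[OF open_cube]]]
    by (simp_all add: X_def Y_def)
  have XY: "emeasure lborel (X m) = emeasure lborel (Y m)" if "m \<in> periods" for m
  proof -
    have "Y m = (\<lambda>z. z + m) -` X m"
      using that by (auto simp: X_def Y_def D_def covering_add_period)
    then show ?thesis using emeasure_lborel_translation[of "X m" m] X by simp
  qed
  have "D = (\<Union>m\<in>periods. X m)"
  proof (intro equalityI subsetI)
    fix z assume z: "z \<in> D"
    have "z - lift (covering z) \<in> periods"
      by (simp add: covering_local_lift flip: covering_eq_iff)
    moreover have "z \<in> X (z - lift (covering z))" using z lift_in_cell by (simp add: X_def)
    ultimately show "z \<in> (\<Union>m\<in>periods. X m)" by blast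
  qed (auto simp: X_def)
  moreover have "disjoint_family_on X periods"
    unfolding disjoint_family_on_def
  proof (intro ballI impI)
    fix m m' :: "complex^'n" assume m: "m \<in> periods" "m' \<in> periods" "m \<noteq> m'"
    have False if "z \<in> X m" "z \<in> X m'" for z
      using cell_unique[of z m m'] m that by (simp add: X_def)
    then show "X m \<inter> X m' = {}" by blast
  qed
  ultimately have "emeasure lborel D = (\<integral>\<^sup>+m. emeasure lborel (X m) \<partial>count_space periods)"
    using emeasure_UN_countable[of periods X lborel] X countable_periods by simp
  also have "\<dots> = (\<integral>\<^sup>+m. emeasure lborel (Y m) \<partial>count_space periods)"
    by (intro nn_integral_cong) (simp add: XY)
  also have "\<dots> = emeasure lborel (\<Union>m\<in>periods. Y m)"
  proof (rule emeasure_UN_countable[symmetric])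
    show "disjoint_family_on Y periods"
      unfolding disjoint_family_on_def
    proof (intro ballI impI)
      fix m m' :: "complex^'n" assume m: "m \<in> periods" "m' \<in> periods" "m \<noteq> m'"
      show "Y m \<inter> Y m' = {}"
      proof (rule ccontr)
        assume "Y m \<inter> Y m' \<noteq> {}"
        then obtain y where y: "y + m \<in> cube c" "y + m' \<in> cube c" by (auto simp: Y_def)
        moreover have "covering (y + m) = covering (y + m')" using m by (simp add: covering_add_period)
        ultimately have "y + m = y + m'" using inj_on_covering[of c] by (meson inj_onD)
        then show False using m by simp
      qed
    qed
  qed (use Y countable_periods in auto)
  also have "(\<Union>m\<in>periods. Y m) = cell \<inter> covering -` B"
  proof (intro equalityI subsetI)
    fix y assume y: "y \<in> cell \<inter> covering -` B"
    then obtain z where z: "z \<in> cube c" "covering y = covering z" using assms(2) by blast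
    then have "z - y \<in> periods" by (simp flip: covering_eq_iff)
    moreover have "y \<in> Y (z - y)" using y z by (simp add: Y_def)
    ultimately show "y \<in> (\<Union>m\<in>periods. Y m)" by blast
  qed (auto simp: Y_def)
  finally show ?thesis by (simp add: D_def)
qed

text \<open>The push-forward of Lebesgue measure on the fundamental domain.\<close>

lemma torus_volume_measure_exists:
  "\<exists>\<mu> :: ((complex^'n::finite) \<times> (complex^'n)) measure.
    is_volume_measure torus_manifold flat_metric \<mu> \<and> finite_measure \<mu>"
proof -
  define \<mu> :: "((complex^'n) \<times> (complex^'n)) measure"
    where "\<mu> = distr (restrict_space lborel cell) (restrict_space borel torus) covering"
  have meas: "covering \<in> restrict_space lborel cell \<rightarrow>\<^sub>M restrict_space borel torus"
    by (intro measurable_restrict_space1 measurable_restrict_space2) auto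
  have emeasure: "emeasure \<mu> B = emeasure lborel (cell \<inter> covering -` B)"
    if "B \<in> sets (restrict_space borel torus)" for B
  proof -
    have "emeasure \<mu> B = emeasure (restrict_space lborel cell) (covering -` B \<inter> space (restrict_space lborel cell))"
      unfolding \<mu>_def using meas that by (rule emeasure_distr)
    also have "\<dots> = emeasure lborel (cell \<inter> covering -` B)"
      using cell_measurable by (subst emeasure_restrict_space) (auto simp: space_restrict_space Int_commute)
    finally show ?thesis .
  qed
  have 1: "space \<mu> = torus" "sets \<mu> = sets (restrict_space borel torus)"
    by (simp_all add: \<mu>_def space_restrict_space)
  have "bounded (cell :: (complex^'n) set)"
  proof (rule boundedI)
    fix z :: "complex^'n" assume z: "z \<in> cell"
    have "norm z \<le> (\<Sum>j\<in>UNIV. cmod (z $ j))" unfolding norm_vec_def by (rule L2_set_le_sum) simp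
    also have "\<dots> \<le> (\<Sum>j\<in>(UNIV::'n set). 2 * pi)"
    proof (rule sum_mono)
      fix j :: 'n
      have "- pi < Re (z $ j)" "Re (z $ j) \<le> pi" "- pi < Im (z $ j)" "Im (z $ j) \<le> pi"
        using z by (auto simp: cell_def)
      then show "cmod (z $ j) \<le> 2 * pi" using cmod_le[of "z $ j"] by linarith
    qed
    finally show "norm z \<le> (\<Sum>j\<in>(UNIV::'n set). 2 * pi)" .
  qed
  then have "emeasure lborel (cell :: (complex^'n) set) < \<infinity>"
    by (rule emeasure_bounded_finite)
  moreover have "emeasure \<mu> (space \<mu>) \<le> emeasure lborel (cell :: (complex^'n) set)"
    unfolding 1(1) using emeasure[of torus] sets.top[of \<mu>] 1 cell_measurable
    by (auto intro!: emeasure_mono)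
  ultimately have "finite_measure \<mu>" by (intro finite_measureI) auto
  moreover have "is_volume_measure torus_manifold flat_metric \<mu>"
    unfolding is_volume_measure_torus_iff
  proof (intro conjI allI ballI impI 1)
    fix c :: "complex^'n" and B assume "B \<in> sets \<mu>" "B \<subseteq> covering ` cube c"
    then show "emeasure \<mu> B = emeasure lborel (cube c \<inter> covering -` B)"
      using emeasure[of B] emeasure_cell_covering[OF sets_torus_borel, of B c] 1 by simp
  qed
  ultimately show ?thesis by blast
qed

text \<open>A volume measure is prescribed on the Borel sets inside charts.  Countably many charts, those with
  centres in a countable dense set, cover the torus, and every Borel set is a disjoint union of
  pieces inside them.\<close>

lemma torus_volume_measure_unique:
  fixes \<mu> \<nu> :: "((complex^'n::finite) \<times> (complex^'n)) measure"
  assumes "is_volume_measure torus_manifold flat_metric \<mu>" "is_volume_measure torus_manifold flat_metric \<nu>"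
  shows "\<mu> = \<nu>"
proof -
  note \<mu> = assms(1)[unfolded is_volume_measure_torus_iff] and \<nu> = assms(2)[unfolded is_volume_measure_torus_iff]
  obtain S :: "(complex^'n) set" where S: "countable S" "\<And>X. open X \<Longrightarrow> X \<noteq> {} \<Longrightarrow> \<exists>d\<in>S. d \<in> X"
    using countable_dense_setE by blast
  have "S \<noteq> {}" using S(2)[of UNIV] by auto
  define F where "F = (\<lambda>i. covering ` cube (from_nat_into S i))"
  have F_sets: "F i \<in> sets (restrict_space borel torus)" for i
    unfolding F_def by (rule openin_torus_measurable[OF openin_chart_domain])
  have F_cover: "torus \<subseteq> (\<Union>i. F i)"
  proof
    fix p :: "(complex^'n) \<times> (complex^'n)" assume p: "p \<in> torus"
    obtain d where d: "d \<in> S" "d \<in> cube (lift p)"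
      using S(2)[OF open_cube[of "lift p"]] center_in_cube[of "lift p"] by blast
    then obtain i where "d = from_nat_into S i" using S(1) from_nat_into_surj by metis
    moreover have "lift p \<in> cube d" using d(2) by (simp add: cube_def abs_minus_commute)
    ultimately show "p \<in> (\<Union>i. F i)"
      unfolding F_def using covering_local_lift[OF p, of 0] by (metis UN_I UNIV_I image_eqI)
  qed
  show ?thesis
  proof (rule measure_eqI)
    show "sets \<mu> = sets \<nu>" using \<mu> \<nu> by simp
    fix A assume A: "A \<in> sets \<mu>"
    define G where "G = (\<lambda>i. A \<inter> disjointed F i)"
    have "disjointed F i \<in> sets (restrict_space borel torus)" for i
      using sets.range_disjointed_sets[of F "restrict_space borel torus"] F_sets by auto
    then have G: "G i \<in> sets (restrict_space borel torus)" for i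
      unfolding G_def using A \<mu> by auto
    have "A \<subseteq> torus" using A \<mu> sets.sets_into_space by blast
    have "(\<Union>i. G i) = A \<inter> (\<Union>i. disjointed F i)" by (auto simp: G_def)
    then have UG: "(\<Union>i. G i) = A"
      using F_cover \<open>A \<subseteq> torus\<close> unfolding UN_disjointed_eq by (metis inf.absorb1 order_trans)
    have disj: "disjoint_family G"
      using disjoint_family_disjointed[of F] unfolding G_def disjoint_family_on_def by blast
    have "G i \<subseteq> covering ` cube (from_nat_into S i)" for i
      using disjointed_subset[of F i] by (auto simp: G_def F_def)
    then have eq: "emeasure \<mu> (G i) = emeasure \<nu> (G i)" for i
      using \<mu> \<nu> G by metis
    have rG: "range G \<subseteq> sets (restrict_space borel torus)" using G by blast
    have "emeasure \<mu> A = (\<Sum>i. emeasure \<mu> (G i))"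
      using suminf_emeasure[of G \<mu>] rG \<mu> disj UG by simp
    also have "\<dots> = (\<Sum>i. emeasure \<nu> (G i))" by (simp add: eq)
    also have "\<dots> = emeasure \<nu> A"
      using suminf_emeasure[of G \<nu>] rG \<nu> disj UG by simp
    finally show "emeasure \<mu> A = emeasure \<nu> A" .
  qed
qed

abbreviation torus_volume :: "((complex^'n::finite) \<times> (complex^'n)) measure" where
  "torus_volume \<equiv> volume_measure torus_manifold flat_metric"

lemma is_volume_measure_torus_volume: "is_volume_measure torus_manifold flat_metric torus_volume"
  and finite_measure_torus_volume: "finite_measure torus_volume"
proof -
  obtain \<mu> :: "((complex^'n::finite) \<times> (complex^'n)) measure"
    where "is_volume_measure torus_manifold flat_metric \<mu>" "finite_measure \<mu>"
    using torus_volume_measure_exists by blast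
  moreover from this have "torus_volume = \<mu>"
    unfolding volume_measure_def using torus_volume_measure_unique by blast
  ultimately show "is_volume_measure torus_manifold flat_metric (torus_volume :: ((complex^'n) \<times> (complex^'n)) measure)"
    "finite_measure (torus_volume :: ((complex^'n) \<times> (complex^'n)) measure)" by simp_all
qed

lemmas torus_volume = is_volume_measure_torus_iff[THEN iffD1, OF is_volume_measure_torus_volume]

lemma space_torus_volume [simp]: "space torus_volume = torus"
  using torus_volume by blast

lemma sets_torus_volume: "sets torus_volume = sets (restrict_space borel torus)"
  using torus_volume by blast

lemma emeasure_torus_volume:
  "B \<in> sets torus_volume \<Longrightarrow> B \<subseteq> covering ` cube c \<Longrightarrow>
    emeasure torus_volume B = emeasure lborel (cube c \<inter> covering -` B)"
  using torus_volume by blast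

text \<open>The torus is a group; its volume is invariant because the translates of a chart are charts.\<close>

definition shift :: "complex^'n \<Rightarrow> (complex^'n) \<times> (complex^'n) \<Rightarrow> (complex^'n) \<times> (complex^'n)" where
  "shift t p = ((\<chi> j. fst p $ j * cis (Re (t $ j))), (\<chi> j. snd p $ j * cis (Im (t $ j))))"

lemma shift_covering: "shift t (covering z) = covering (z + t)"
  by (simp add: shift_def covering_def cis_mult)

lemma shift_in_torus: "p \<in> torus \<Longrightarrow> shift t p \<in> torus"
  by (simp add: torus_def shift_def norm_mult)

lemma measurable_shift: "shift t \<in> torus_volume \<rightarrow>\<^sub>M (torus_volume :: ((complex^'n::finite) \<times> (complex^'n)) measure)"
proof -
  have "continuous_on torus (shift t)" unfolding shift_def by (intro continuous_intros)
  then have "shift t \<in> borel_measurable (restrict_space borel torus)"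
    by (rule borel_measurable_continuous_on_restrict)
  then have "shift t \<in> restrict_space borel torus \<rightarrow>\<^sub>M restrict_space borel torus"
    by (intro measurable_restrict_space2) (auto simp: space_restrict_space shift_in_torus)
  then show ?thesis
    by (simp cong: measurable_cong_sets add: sets_torus_volume)
qed

lemma distr_torus_volume_shift:
  "distr torus_volume torus_volume (shift t) = (torus_volume :: ((complex^'n::finite) \<times> (complex^'n)) measure)"
proof (rule torus_volume_measure_unique[OF _ is_volume_measure_torus_volume])
  let ?\<nu> = "distr torus_volume torus_volume (shift t)"
  show "is_volume_measure torus_manifold flat_metric ?\<nu>"
    unfolding is_volume_measure_torus_iff
  proof (intro conjI allI ballI impI)
    show "space ?\<nu> = torus" by simp
    show "sets ?\<nu> = sets (restrict_space borel torus)" by (simp add: sets_torus_volume)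
    fix c :: "complex^'n" and B assume "B \<in> sets ?\<nu>" and sub: "B \<subseteq> covering ` cube c"
    then have B: "B \<in> sets torus_volume" by simp
    define B' where "B' = shift t -` B \<inter> torus"
    have B': "B' \<in> sets torus_volume"
      using measurable_sets[OF measurable_shift[of t] B] by (simp add: B'_def)
    have "B' \<subseteq> covering ` cube (c - t)"
    proof
      fix p assume p: "p \<in> B'"
      then obtain z where z: "p = covering z"
        using covering_surj by (metis B'_def IntD2 imageE)
      then have "covering (z + t) \<in> B" using p by (simp add: B'_def shift_covering)
      then obtain w where w: "w \<in> cube c" "covering (z + t) = covering w" using sub by blast
      then have "z + t - w \<in> periods" by (simp flip: covering_eq_iff)
      then have "covering z = covering (w - t)" by (simp add: covering_eq_iff algebra_simps)
      moreover have "w - t \<in> cube (c - t)" using w by (simp add: cube_def)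
      ultimately show "p \<in> covering ` cube (c - t)" using z by simp
    qed
    moreover have "cube (c - t) \<inter> covering -` B' = (\<lambda>z. z + t) -` (cube c \<inter> covering -` B)"
      by (rule set_eqI) (simp add: B'_def shift_covering cube_def algebra_simps)
    moreover have "cube c \<inter> covering -` B \<in> sets borel"
      using B sets_torus_borel[of B] unfolding sets_torus_volume
      by (intro sets.Int[OF borel_open[OF open_cube]] vimage_covering_measurable)
    ultimately have "emeasure torus_volume B' = emeasure lborel (cube c \<inter> covering -` B)"
      using emeasure_torus_volume[OF B'] emeasure_lborel_translation by metis
    then show "emeasure ?\<nu> B = emeasure lborel (cube c \<inter> covering -` B)"
      using emeasure_distr[OF measurable_shift B, of t] by (simp add: B'_def)
  qed
qed

subsection \<open>Integration of periodic functions\<close>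

definition torus_integral :: "(complex^'n::finite \<Rightarrow> complex) \<Rightarrow> complex" where
  "torus_integral \<Phi> = (LINT p|torus_volume. \<Phi> (lift p))"

lemma continuous_on_torus_lift:
  fixes \<Phi> :: "complex^'n::finite \<Rightarrow> 'b::topological_space"
  assumes "periodic \<Phi>" "continuous_on UNIV \<Phi>"
  shows "continuous_on torus (\<lambda>p. \<Phi> (lift p))"
proof (subst continuous_openin_preimage_eq, intro allI impI)
  fix S :: "'b set" assume S: "open S"
  have eq: "\<Phi> (lift p) = \<Phi> (local_lift c p)" if "p \<in> torus" for p c
    using that by (intro periodicD[OF assms(1)]) (simp add: covering_local_lift)
  have "openin (top_of_set torus) (covering ` cube c \<inter> (\<lambda>p. \<Phi> (lift p)) -` S)" for c :: "complex^'n"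
  proof -
    have "continuous_on (covering ` cube c) (\<lambda>p. \<Phi> (local_lift c p))"
      by (rule continuous_on_compose2[OF assms(2) continuous_on_local_lift]) auto
    then have "openin (top_of_set (covering ` cube c)) (covering ` cube c \<inter> (\<lambda>p. \<Phi> (local_lift c p)) -` S)"
      using S continuous_openin_preimage_gen by blast
    moreover have "covering ` cube c \<inter> (\<lambda>p. \<Phi> (local_lift c p)) -` S = covering ` cube c \<inter> (\<lambda>p. \<Phi> (lift p)) -` S"
    proof (rule set_eqI)
      fix p
      show "p \<in> covering ` cube c \<inter> (\<lambda>p. \<Phi> (local_lift c p)) -` S \<longleftrightarrow> p \<in> covering ` cube c \<inter> (\<lambda>p. \<Phi> (lift p)) -` S"
      proof (cases "p \<in> covering ` cube c")
        case True
        then have "p \<in> torus" using chart_domain_subset by blast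
        from eq[OF this, of c] show ?thesis by (simp only: Int_iff vimage_eq)
      qed blast
    qed
    ultimately show ?thesis using openin_chart_domain openin_trans by metis
  qed
  then have "openin (top_of_set torus) (\<Union>c. covering ` cube c \<inter> (\<lambda>p. \<Phi> (lift p)) -` S)" by blast
  moreover have "(\<Union>c. covering ` cube c \<inter> (\<lambda>p. \<Phi> (lift p)) -` S) = torus \<inter> (\<lambda>p. \<Phi> (lift p)) -` S"
  proof (intro equalityI subsetI)
    fix p assume p: "p \<in> torus \<inter> (\<lambda>p. \<Phi> (lift p)) -` S"
    then have "p \<in> covering ` cube (lift p)"
      using covering_local_lift[of p 0] center_in_cube by (metis IntD1 image_eqI)
    then show "p \<in> (\<Union>c. covering ` cube c \<inter> (\<lambda>p. \<Phi> (lift p)) -` S)" using p by blast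
  qed (use chart_domain_subset in blast)
  ultimately show "openin (top_of_set torus) (torus \<inter> (\<lambda>p. \<Phi> (lift p)) -` S)" by simp
qed

lemma periodic_bounded:
  fixes \<Phi> :: "complex^'n::finite \<Rightarrow> 'b::real_normed_vector"
  assumes "periodic \<Phi>" "continuous_on UNIV \<Phi>"
  obtains K where "K > 0" "\<And>z. norm (\<Phi> z) \<le> K"
proof -
  have "bounded ((\<lambda>p. \<Phi> (lift p)) ` torus)"
    by (intro compact_imp_bounded compact_continuous_image continuous_on_torus_lift assms compact_torus)
  then obtain K where K: "K > 0" "\<And>p. p \<in> torus \<Longrightarrow> norm (\<Phi> (lift p)) \<le> K"
    unfolding bounded_pos by blast
  then show thesis
    using that[of K] periodic_local_lift[OF assms(1), of 0] covering_in_torus by metis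
qed

lemma borel_measurable_torus_lift:
  fixes \<Phi> :: "complex^'n::finite \<Rightarrow> 'b::topological_space"
  assumes "periodic \<Phi>" "continuous_on UNIV \<Phi>"
  shows "(\<lambda>p. \<Phi> (lift p)) \<in> borel_measurable torus_volume"
  using borel_measurable_continuous_on_restrict[OF continuous_on_torus_lift[OF assms]]
  by (simp cong: measurable_cong_sets add: sets_torus_volume)

lemma integrable_torus_lift:
  fixes \<Phi> :: "complex^'n::finite \<Rightarrow> 'b::{banach, second_countable_topology}"
  assumes "periodic \<Phi>" "continuous_on UNIV \<Phi>"
  shows "integrable torus_volume (\<lambda>p. \<Phi> (lift p))"
proof -
  obtain K where "\<And>z. norm (\<Phi> z) \<le> K" using periodic_bounded[OF assms] by blast
  then show ?thesis
    by (intro finite_measure.integrable_const_bound[OF finite_measure_torus_volume, of _ K]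
        borel_measurable_torus_lift assms) auto
qed

lemma torus_integral_translate:
  assumes "periodic \<Phi>" "continuous_on UNIV \<Phi>"
  shows "torus_integral (\<lambda>z. \<Phi> (z + t)) = torus_integral \<Phi>"
proof -
  have "\<Phi> (lift p + t) = \<Phi> (lift (shift t p))" if "p \<in> torus" for p
    using that shift_covering[of t "lift p"]
    by (intro periodicD[OF assms(1)]) (simp add: covering_local_lift shift_in_torus)
  then have "torus_integral (\<lambda>z. \<Phi> (z + t)) = (LINT p|torus_volume. \<Phi> (lift (shift t p)))"
    unfolding torus_integral_def by (intro Bochner_Integration.integral_cong) auto
  also have "\<dots> = (LINT p|distr torus_volume torus_volume (shift t). \<Phi> (lift p))"
    by (rule integral_distr[symmetric, OF measurable_shift borel_measurable_torus_lift[OF assms]])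
  finally show ?thesis by (simp add: distr_torus_volume_shift torus_integral_def)
qed

lemma periodicI: "(\<And>z w. covering z = covering w \<Longrightarrow> F z = F w) \<Longrightarrow> periodic F"
  unfolding periodic_def by blast

lemma periodic_translate: "periodic \<Phi> \<Longrightarrow> periodic (\<lambda>z. \<Phi> (z + t))"
proof -
  assume \<Phi>: "periodic \<Phi>"
  have "\<Phi> (z + t) = \<Phi> (w + t)" if "covering z = covering w" for z w
  proof (rule periodicD[OF \<Phi>])
    show "covering (z + t) = covering (w + t)" using that by (simp flip: shift_covering)
  qed
  then show ?thesis by (rule periodicI)
qed

lemma periodic_frechet_derivative:
  fixes \<Phi> :: "complex^'n::finite \<Rightarrow> 'b::real_normed_vector"
  assumes "periodic \<Phi>"
  shows "periodic (\<lambda>z. frechet_derivative \<Phi> (at z) v)"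
  unfolding periodic_def
proof (intro allI impI)
  fix z w :: "complex^'n" assume zw: "covering z = covering w"
  have imp: "(\<Phi> has_derivative D) (at w)" if "(\<Phi> has_derivative D) (at z)" "covering z = covering w" for D z w
  proof -
    have m: "z - w \<in> periods" using that(2) by (simp add: covering_eq_iff)
    have eq: "\<Phi> (x + (z - w)) = \<Phi> x" for x
      by (rule periodicD[OF assms]) (rule covering_add_period[OF m])
    have "((\<lambda>x. x + (z - w)) has_derivative (\<lambda>v. v)) (at w)"
      by (auto intro!: derivative_eq_intros)
    then have "(\<Phi> \<circ> (\<lambda>x. x + (z - w)) has_derivative D \<circ> (\<lambda>v. v)) (at w)"
      using that(1) by (intro diff_chain_at) simp_all
    then show ?thesis by (simp only: eq o_def)
  qed
  have "(\<Phi> has_derivative D) (at z) \<longleftrightarrow> (\<Phi> has_derivative D) (at w)" for D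
    using imp zw by metis
  then show "frechet_derivative \<Phi> (at z) v = frechet_derivative \<Phi> (at w) v"
    unfolding frechet_derivative_def by simp
qed

text \<open>The integrals of the difference quotients of \<open>\<Phi>\<close> vanish by translation invariance.  The
  quotients are bounded by the maximum of the derivative and converge to it, so the integral of the
  derivative vanishes too.\<close>

lemma torus_integral_derivative:
  assumes "periodic \<Phi>" "\<And>z. (\<Phi> has_derivative frechet_derivative \<Phi> (at z)) (at z)"
    and contD: "continuous_on UNIV (\<lambda>z. frechet_derivative \<Phi> (at z) v)"
  shows "torus_integral (\<lambda>z. frechet_derivative \<Phi> (at z) v) = 0"
proof -
  define D where "D = (\<lambda>z. frechet_derivative \<Phi> (at z) v)"
  have per_D: "periodic D" unfolding D_def by (rule periodic_frechet_derivative[OF assms(1)])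
  obtain K where K: "K > 0" "\<And>z. norm (D z) \<le> K"
    using periodic_bounded[OF per_D] contD unfolding D_def by blast
  have cont: "continuous_on UNIV \<Phi>"
    using has_derivative_continuous[OF assms(2)] by (simp add: continuous_at_imp_continuous_on)
  have g: "((\<lambda>s. \<Phi> (z + s *\<^sub>R v)) has_derivative (\<lambda>h. h *\<^sub>R D (z + s *\<^sub>R v))) (at s)" for z s
  proof -
    have "((\<lambda>s. z + s *\<^sub>R v) has_derivative (\<lambda>h. h *\<^sub>R v)) (at s)"
      by (auto intro!: derivative_eq_intros)
    from diff_chain_at[OF this assms(2)]
    have "((\<lambda>s. \<Phi> (z + s *\<^sub>R v)) has_derivative (\<lambda>h. frechet_derivative \<Phi> (at (z + s *\<^sub>R v)) (h *\<^sub>R v))) (at s)"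
      by (simp add: o_def)
    moreover have "linear (frechet_derivative \<Phi> (at (z + s *\<^sub>R v)))"
      using assms(2) by (rule has_derivative_linear)
    ultimately show ?thesis by (simp add: linear_scale D_def)
  qed
  define F where "F = (\<lambda>n z. real (Suc n) *\<^sub>R (\<Phi> (z + (1 / real (Suc n)) *\<^sub>R v) - \<Phi> z))"
  have F_bound: "norm (F n z) \<le> K" for n z
  proof -
    have "norm (\<Phi> (z + (1 / real (Suc n)) *\<^sub>R v) - \<Phi> (z + 0 *\<^sub>R v)) \<le> K * norm (1 / real (Suc n) - 0)"
    proof (rule differentiable_bound[of UNIV "\<lambda>s. \<Phi> (z + s *\<^sub>R v)" "\<lambda>s h. h *\<^sub>R D (z + s *\<^sub>R v)" K])
      show "((\<lambda>s. \<Phi> (z + s *\<^sub>R v)) has_derivative (\<lambda>h. h *\<^sub>R D (z + s *\<^sub>R v))) (at s within UNIV)" for s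
        by (rule g)
      show "onorm (\<lambda>h. h *\<^sub>R D (z + s *\<^sub>R v)) \<le> K" for s
        by (rule onorm_le) (simp add: mult.commute[of K] mult_left_mono K)
    qed auto
    then have "norm (\<Phi> (z + (1 / real (Suc n)) *\<^sub>R v) - \<Phi> z) \<le> K / real (Suc n)" by simp
    then show ?thesis unfolding F_def norm_scaleR by (simp add: field_simps del: of_nat_Suc)
  qed
  have F_lim: "(\<lambda>n. F n z) \<longlonglongrightarrow> D z" for z
  proof -
    let ?g = "\<lambda>s. \<Phi> (z + s *\<^sub>R v)"
    have "(\<lambda>h. norm (?g (0 + h) - ?g 0 - h *\<^sub>R D z) / norm h) \<midarrow>0\<rightarrow> 0"
      using g[of z 0] by (simp add: has_derivative_at)
    moreover have "filterlim (\<lambda>n. 1 / real (Suc n)) (at 0) sequentially"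
      unfolding filterlim_at using LIMSEQ_inverse_real_of_nat by (simp add: inverse_eq_divide)
    ultimately have "(\<lambda>n. norm (?g (0 + 1 / real (Suc n)) - ?g 0 - (1 / real (Suc n)) *\<^sub>R D z) / norm (1 / real (Suc n))) \<longlonglongrightarrow> 0"
      by (rule filterlim_compose)
    moreover have "norm (?g (0 + 1 / real (Suc n)) - ?g 0 - (1 / real (Suc n)) *\<^sub>R D z) / norm (1 / real (Suc n))
        = norm (F n z - D z)" for n
    proof -
      have "F n z - D z = real (Suc n) *\<^sub>R (?g (0 + 1 / real (Suc n)) - ?g 0 - (1 / real (Suc n)) *\<^sub>R D z)"
        by (simp add: F_def scaleR_diff_right del: of_nat_Suc)
      then show ?thesis by (simp only: norm_scaleR) (simp add: field_simps del: of_nat_Suc)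
    qed
    ultimately have "(\<lambda>n. norm (F n z - D z)) \<longlonglongrightarrow> 0" by simp
    then show ?thesis using LIM_zero_cancel tendsto_norm_zero_iff by blast
  qed
  have per_F: "periodic (F n)" for n
    unfolding F_def using periodicD[OF periodic_translate[OF assms(1)]] periodicD[OF assms(1)]
    by (intro periodicI) metis
  have cont_F: "continuous_on UNIV (F n)" for n
    unfolding F_def by (intro continuous_intros continuous_on_compose2[OF cont]) auto
  have "(\<lambda>n. LINT p|torus_volume. F n (lift p)) \<longlonglongrightarrow> (LINT p|torus_volume. D (lift p))"
  proof (rule integral_dominated_convergence[where w = "\<lambda>_. K"])
    show "(\<lambda>p. D (lift p)) \<in> borel_measurable torus_volume"
      using borel_measurable_torus_lift[OF per_D] contD by (simp add: D_def)
    show "(\<lambda>p. F n (lift p)) \<in> borel_measurable torus_volume" for n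
      by (rule borel_measurable_torus_lift[OF per_F cont_F])
    show "integrable torus_volume (\<lambda>_. K)"
      by (rule finite_measure.integrable_const[OF finite_measure_torus_volume])
  qed (use F_lim F_bound in auto)
  moreover have "(LINT p|torus_volume. F n (lift p)) = 0" for n
  proof -
    let ?\<Phi>t = "\<lambda>z. \<Phi> (z + (1 / real (Suc n)) *\<^sub>R v)"
    have cont_t: "continuous_on UNIV ?\<Phi>t"
      by (intro continuous_on_compose2[OF cont] continuous_intros) auto
    have "(LINT p|torus_volume. F n (lift p)) = real (Suc n) *\<^sub>R (torus_integral ?\<Phi>t - torus_integral \<Phi>)"
      unfolding F_def torus_integral_def
      by (subst Bochner_Integration.integral_diff[symmetric])
        (simp_all add: integrable_torus_lift[OF assms(1) cont] integrable_torus_lift[OF periodic_translate[OF assms(1)] cont_t]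
          del: of_nat_Suc)
    then show ?thesis using torus_integral_translate[OF assms(1) cont] by simp
  qed
  ultimately have "(LINT p|torus_volume. D (lift p)) = 0"
    using LIMSEQ_unique tendsto_const by (metis (no_types, lifting) ext)
  then show ?thesis by (simp add: torus_integral_def D_def)
qed

lemma torus_integral_add:
  assumes "periodic \<Phi>" "continuous_on UNIV \<Phi>" "periodic \<Psi>" "continuous_on UNIV \<Psi>"
  shows "torus_integral (\<lambda>z. \<Phi> z + \<Psi> z) = torus_integral \<Phi> + torus_integral \<Psi>"
  unfolding torus_integral_def
  by (rule Bochner_Integration.integral_add; rule integrable_torus_lift) (use assms in auto)

lemma torus_integral_diff:
  assumes "periodic \<Phi>" "continuous_on UNIV \<Phi>" "periodic \<Psi>" "continuous_on UNIV \<Psi>"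
  shows "torus_integral (\<lambda>z. \<Phi> z - \<Psi> z) = torus_integral \<Phi> - torus_integral \<Psi>"
  unfolding torus_integral_def
  by (rule Bochner_Integration.integral_diff; rule integrable_torus_lift) (use assms in auto)

lemma torus_integral_cmult: "torus_integral (\<lambda>z. c * \<Phi> z) = c * torus_integral \<Phi>"
  unfolding torus_integral_def by simp

lemma torus_integral_sum:
  assumes "\<And>i. i \<in> I \<Longrightarrow> periodic (\<Phi> i)" "\<And>i. i \<in> I \<Longrightarrow> continuous_on UNIV (\<Phi> i)"
  shows "torus_integral (\<lambda>z. \<Sum>i\<in>I. \<Phi> i z) = (\<Sum>i\<in>I. torus_integral (\<Phi> i))"
  unfolding torus_integral_def
  by (rule Bochner_Integration.integral_sum; rule integrable_torus_lift) (use assms in auto)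

lemma torus_integral_cong: "(\<And>z. \<Phi> z = \<Psi> z) \<Longrightarrow> torus_integral \<Phi> = torus_integral \<Psi>"
  by (simp add: torus_integral_def)

lemma torus_integral_dbar_deriv:
  assumes "periodic \<Phi>" "smooth_map_on \<Phi> UNIV"
  shows "torus_integral (\<lambda>z. dbar_deriv \<Phi> z v) = 0"
proof -
  let ?D = "\<lambda>v z. frechet_derivative \<Phi> (at z) v"
  have cont: "continuous_on UNIV (?D v)" for v
    using smooth_map_on_imp_continuous_on smooth_map_on_derivative assms(2) by blast
  have per: "periodic (?D v)" for v by (rule periodic_frechet_derivative[OF assms(1)])
  have int: "torus_integral (?D v) = 0" for v
    using smooth_map_on_has_derivative[OF assms(2)] by (intro torus_integral_derivative assms(1) cont) auto
  have "torus_integral (\<lambda>z. dbar_deriv \<Phi> z v) = torus_integral (\<lambda>z. (1/2) * ?D v z + (\<i>/2) * ?D (\<i> *s v) z)"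
    by (rule torus_integral_cong) (simp add: dbar_deriv_def field_simps)
  also have "\<dots> = torus_integral (\<lambda>z. (1/2) * ?D v z) + torus_integral (\<lambda>z. (\<i>/2) * ?D (\<i> *s v) z)"
    by (intro torus_integral_add continuous_intros cont periodicI arg_cong2[where f = "(*)"] refl periodicD[OF per])
  also have "\<dots> = 0" unfolding torus_integral_cmult int by simp
  finally show ?thesis .
qed

lemma torus_integral_of_real:
  "torus_integral (\<lambda>z. of_real (\<Phi> z)) = of_real (LINT p|torus_volume. \<Phi> (lift p))"
  unfolding torus_integral_def by (rule integral_complex_of_real)

text \<open>The integrand vanishes almost everywhere.  In a chart the volume is Lebesgue measure, so the open
  set where the integrand is positive is negligible and hence empty.\<close>

lemma torus_integral_eq_0_imp:
  fixes \<Phi> :: "complex^'n::finite \<Rightarrow> real"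
  assumes "periodic \<Phi>" "continuous_on UNIV \<Phi>" "\<And>z. \<Phi> z \<ge> 0"
    and "torus_integral (\<lambda>z. of_real (\<Phi> z)) = 0"
  shows "\<Phi> z = 0"
proof -
  let ?N = "{p \<in> torus. \<Phi> (lift p) \<noteq> 0}"
  have int: "(LINT p|torus_volume. \<Phi> (lift p)) = 0"
    using assms(4) unfolding torus_integral_of_real by simp
  have meas: "?N \<in> sets torus_volume"
  proof -
    have "(\<lambda>p. \<Phi> (lift p)) -` (- {0}) \<inter> space torus_volume \<in> sets torus_volume"
      by (rule measurable_sets[OF borel_measurable_torus_lift[OF assms(1,2)]]) simp
    moreover have "(\<lambda>p. \<Phi> (lift p)) -` (- {0}) \<inter> space torus_volume = ?N"
      by (rule set_eqI) (simp add: conj_commute)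
    ultimately show ?thesis by simp
  qed
  have "AE p in torus_volume. \<Phi> (lift p) = 0"
    using integral_nonneg_eq_0_iff_AE[OF integrable_torus_lift[OF assms(1,2)]] assms(3) int by simp
  then have N0: "emeasure torus_volume ?N = 0"
    using AE_iff_measurable[OF meas, of "\<lambda>p. \<Phi> (lift p) = 0"] by simp
  define U where "U = {w \<in> cube z. \<Phi> w \<noteq> 0}"
  define B where "B = ?N \<inter> covering ` cube z"
  have chart: "covering ` cube z \<in> sets torus_volume"
    unfolding sets_torus_volume by (rule openin_torus_measurable[OF openin_chart_domain])
  have "emeasure torus_volume B = 0"
    using emeasure_mono[of B ?N torus_volume] meas N0 by (simp add: B_def)
  moreover have "cube z \<inter> covering -` B = U"
    by (auto simp: B_def U_def periodic_local_lift[OF assms(1)])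
  moreover have "B \<in> sets torus_volume" unfolding B_def using meas chart by (rule sets.Int)
  ultimately have U0: "emeasure lborel U = 0"
    using emeasure_torus_volume[of B z] by (simp add: B_def)
  have "open U"
  proof -
    have "U = cube z \<inter> \<Phi> -` (- {0})" by (auto simp: U_def)
    moreover have "open (cube z \<inter> \<Phi> -` (- {0}))"
      by (rule continuous_open_preimage[OF continuous_on_subset[OF assms(2)]]) auto
    ultimately show ?thesis by simp
  qed
  then have "negligible U"
    using U0 null_sets_completionI[of U lborel] by (simp add: negligible_iff_null_sets null_sets_def)
  then have "U = {}" using \<open>open U\<close> open_not_negligible by blast
  then show ?thesis unfolding U_def by auto
qed

section \<open>The conjugate linear part of the derivative\<close>

text \<open>The operator \<open>frechet_derivative\<close> chooses among the same candidates for both functions.\<close>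

lemma dbar_deriv_cong:
  assumes "open S" "z \<in> S" "\<And>w. w \<in> S \<Longrightarrow> f w = g w"
  shows "dbar_deriv f z v = dbar_deriv g z v"
proof -
  have "(f has_derivative D) (at z) \<longleftrightarrow> (g has_derivative D) (at z)" for D
    using has_derivative_transform_within_open[OF _ assms(1,2)] assms(3) by metis
  then show ?thesis unfolding dbar_deriv_def frechet_derivative_def by simp
qed

lemma dbar_deriv_eq: "(f has_derivative D) (at z) \<Longrightarrow> dbar_deriv f z v = (D v + \<i> * D (\<i> *s v)) / 2"
  unfolding dbar_deriv_def using frechet_derivative_at by metis

lemma dbar_deriv_const [simp]: "dbar_deriv (\<lambda>z. c) z v = 0"
  using dbar_deriv_eq[OF has_derivative_const] by simp

lemma vec_scale_decompose: "(t :: complex) *s v = Re t *\<^sub>R v + Im t *\<^sub>R (\<i> *s v)"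
  by (simp add: vec_eq_iff complex_eq_iff)

lemma
  assumes f: "f differentiable (at z)"
  shows dbar_deriv_add_vec: "dbar_deriv f z (v + w) = dbar_deriv f z v + dbar_deriv f z w"
    and dbar_deriv_scale_vec: "dbar_deriv f z (t *s v) = cnj t * dbar_deriv f z v"
proof -
  define D where "D = frechet_derivative f (at z)"
  have "linear D" unfolding D_def using f frechet_derivative_works has_derivative_linear by blast
  then have add: "\<And>v w. D (v + w) = D v + D w" and scale: "\<And>r v. D (r *\<^sub>R v) = of_real r * D v"
    by (simp add: linear_add, metis linear_scale scaleR_conv_of_real)
  have dd: "\<And>v. dbar_deriv f z v = (D v + \<i> * D (\<i> *s v)) / 2" by (simp add: dbar_deriv_def D_def)
  show "dbar_deriv f z (v + w) = dbar_deriv f z v + dbar_deriv f z w"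
    by (simp add: dd vector_add_ldistrib add field_simps)
  have 1: "D (t *s v) = of_real (Re t) * D v + of_real (Im t) * D (\<i> *s v)"
    by (subst vec_scale_decompose) (simp only: add scale)
  have 2: "D (\<i> *s (t *s v)) = of_real (Re t) * D (\<i> *s v) - of_real (Im t) * D v"
  proof -
    have "\<i> *s (t *s v) = Re t *\<^sub>R (\<i> *s v) + (- Im t) *\<^sub>R v"
      by (simp add: vec_eq_iff complex_eq_iff)
    then show ?thesis by (simp only: add scale) simp
  qed
  have 3: "cnj t = of_real (Re t) - \<i> * of_real (Im t)" by (simp add: complex_eq_iff)
  show "dbar_deriv f z (t *s v) = cnj t * dbar_deriv f z v"
    unfolding dd 1 2 3 by (simp add: field_simps)
qed

lemma smooth_map_on_differentiable: "smooth_map_on f UNIV \<Longrightarrow> f differentiable (at z)"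
  using smooth_map_on_has_derivative differentiable_def by blast

lemma smooth_dbar_deriv:
  assumes "smooth_map_on f UNIV"
  shows "smooth_map_on (\<lambda>z. dbar_deriv f z v) UNIV"
proof -
  have D: "Ck_on k (\<lambda>z. frechet_derivative f (at z) v) UNIV" for k v
    using smooth_map_on_derivative[OF assms] by (rule smooth_map_onD)
  have "Ck_on k (\<lambda>z. (frechet_derivative f (at z) v + \<i> * frechet_derivative f (at z) (\<i> *s v)) * (1/2)) UNIV" for k
    by (intro Ck_on_mult Ck_on_add D Ck_on_const) auto
  then show ?thesis by (simp add: smooth_map_on_def dbar_deriv_def)
qed

lemma periodic_dbar_deriv:
  assumes "periodic f"
  shows "periodic (\<lambda>z. dbar_deriv f z v)"
  unfolding dbar_deriv_def
  by (intro periodicI arg_cong2[where f = "(/)"] arg_cong2[where f = "(+)"] arg_cong2[where f = "(*)"] refl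
      periodicD[OF periodic_frechet_derivative[OF assms]])

lemma
  assumes f: "smooth_map_on f UNIV" and g: "smooth_map_on g UNIV"
  shows dbar_deriv_add: "dbar_deriv (\<lambda>z. f z + g z) z v = dbar_deriv f z v + dbar_deriv g z v"
    and dbar_deriv_mult: "dbar_deriv (\<lambda>z. f z * g z) z v = f z * dbar_deriv g z v + dbar_deriv f z v * g z"
    and dbar_deriv_cmult: "dbar_deriv (\<lambda>z. c * g z) z v = c * dbar_deriv g z v"
proof -
  note F = smooth_map_on_has_derivative[OF f UNIV_I, of z] and G = smooth_map_on_has_derivative[OF g UNIV_I, of z]
  show "dbar_deriv (\<lambda>z. f z + g z) z v = dbar_deriv f z v + dbar_deriv g z v"
    unfolding dbar_deriv_eq[OF has_derivative_add[OF F G]] by (simp add: dbar_deriv_def field_simps)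
  show "dbar_deriv (\<lambda>z. f z * g z) z v = f z * dbar_deriv g z v + dbar_deriv f z v * g z"
    unfolding dbar_deriv_eq[OF has_derivative_mult[OF F G]] by (simp add: dbar_deriv_def field_simps)
  show "dbar_deriv (\<lambda>z. c * g z) z v = c * dbar_deriv g z v"
    unfolding dbar_deriv_eq[OF has_derivative_mult_right[OF G]] by (simp add: dbar_deriv_def field_simps)
qed

section \<open>Smooth forms on the torus as periodic forms\<close>

text \<open>Since changes of charts have the identity as derivative and the bundle has one global frame, a
  smooth form on the torus is the same as a periodic family of covectors on \<open>\<complex>\<^sup>n\<close>.  The operators
  are computed on such families; \<open>form_of\<close> transports the results to the torus.\<close>

definition periodic_forms :: "nat \<Rightarrow> (complex^'n::finite \<Rightarrow> (complex^'n) list \<Rightarrow> complex) set" where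
  "periodic_forms q = {A. periodic A \<and> (\<forall>z. antilinear_alternating q (A z)) \<and>
    (\<forall>z vs. length vs \<noteq> q \<longrightarrow> A z vs = 0) \<and> (\<forall>vs. smooth_map_on (\<lambda>z. A z vs) UNIV)}"

lemma periodic_formsI:
  assumes "\<And>vs. periodic (\<lambda>z. A z vs)" "\<And>z. antilinear_alternating q (A z)"
    "\<And>z vs. length vs \<noteq> q \<Longrightarrow> A z vs = 0" "\<And>vs. smooth_map_on (\<lambda>z. A z vs) UNIV"
  shows "A \<in> periodic_forms q"
proof -
  have "periodic A" using periodicD[OF assms(1)] by (intro periodicI ext) blast
  then show ?thesis using assms by (simp add: periodic_forms_def)
qed

lemma periodic_formsD:
  assumes "A \<in> periodic_forms q"
  shows "periodic A" "periodic (\<lambda>z. A z vs)" "antilinear_alternating q (A z)"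
    "length vs \<noteq> q \<Longrightarrow> A z vs = 0" "smooth_map_on (\<lambda>z. A z vs) UNIV"
    "continuous_on UNIV (\<lambda>z. A z vs)"
proof -
  show "periodic A" using assms by (simp add: periodic_forms_def)
  show "periodic (\<lambda>z. A z vs)"
  proof (rule periodicI)
    fix z w :: "complex^'a" assume "covering z = covering w"
    from periodicD[OF \<open>periodic A\<close> this] show "A z vs = A w vs" by (rule fun_cong)
  qed
  show "antilinear_alternating q (A z)" "length vs \<noteq> q \<Longrightarrow> A z vs = 0"
    and smooth: "smooth_map_on (\<lambda>z. A z vs) UNIV" using assms by (auto simp: periodic_forms_def)
  show "continuous_on UNIV (\<lambda>z. A z vs)" using smooth by (rule smooth_map_on_imp_continuous_on)
qed

definition form_of ::
    "(complex^'n::finite \<Rightarrow> (complex^'n) list \<Rightarrow> complex) \<Rightarrow> ((complex^'n) \<times> (complex^'n), 'n, nat) form" where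
  "form_of A c i p vs = (if at_point torus_manifold trivial_bundle p c i then A (snd c p) vs else 0)"

lemma at_point_torus:
  "at_point torus_manifold trivial_bundle p c i \<longleftrightarrow> i = 0 \<and> (\<exists>x. c = torus_chart x \<and> p \<in> covering ` cube x)"
proof
  assume "at_point torus_manifold trivial_bundle p c i"
  then have *: "c \<in> range torus_chart \<and> i \<in> {0} \<and> p \<in> fst c \<inter> torus"
    unfolding at_point_def torus_manifold_simps trivial_bundle_simps .
  have c: "c \<in> range torus_chart" using * by (rule conjunct1)
  have i: "i = 0" and p: "p \<in> fst c" using * by simp_all
  obtain x where x: "c = torus_chart x" using c by (rule imageE)
  have "p \<in> covering ` cube x" using p unfolding x torus_chart_simps .
  with i x show "i = 0 \<and> (\<exists>x. c = torus_chart x \<and> p \<in> covering ` cube x)" by blast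
next
  assume "i = 0 \<and> (\<exists>x. c = torus_chart x \<and> p \<in> covering ` cube x)"
  then obtain x where "i = 0" "c = torus_chart x" "p \<in> covering ` cube x" by blast
  then show "at_point torus_manifold trivial_bundle p c i"
    using chart_domain_subset by (auto simp: at_point_def)
qed

lemma at_point_torus_chart:
  "at_point torus_manifold trivial_bundle p (torus_chart x) 0 \<longleftrightarrow> p \<in> covering ` cube x"
  unfolding at_point_def torus_chart_simps trivial_bundle_simps chart_domain_Int_torus by simp

lemma form_of_covering:
  "z \<in> cube x \<Longrightarrow> form_of A (torus_chart x) 0 (covering z) = A z"
  by (simp add: form_of_def at_point_torus_chart local_lift_covering fun_eq_iff)

lemma form_of_eq_iff: "form_of A = form_of B \<longleftrightarrow> A = B"
proof
  assume eq: "form_of A = form_of B"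
  have "A z = B z" for z
    using form_of_covering[OF center_in_cube, of A z] form_of_covering[OF center_in_cube, of B z] eq by simp
  then show "A = B" by blast
qed simp

lemma form_of_at_point:
  assumes "periodic A" "at_point torus_manifold trivial_bundle p c i"
  shows "form_of A c i p = A (lift p)"
proof -
  obtain x where x: "c = torus_chart x" "p \<in> covering ` cube x" using assms(2) at_point_torus by blast
  then have "p \<in> torus" using chart_domain_subset by blast
  then have "A (local_lift x p) = A (lift p)"
    by (intro periodicD[OF assms(1)]) (simp add: covering_local_lift)
  then show ?thesis using assms(2) x by (simp add: form_of_def fun_eq_iff)
qed

lemma form_of_smooth_form:
  assumes A: "A \<in> periodic_forms q"
  shows "form_of A \<in> smooth_forms torus_manifold trivial_bundle q"
  unfolding smooth_forms_def mem_Collect_eq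
proof (intro conjI allI impI ballI)
  fix c :: "((complex^'a) \<times> (complex^'a), 'a) chart" and i p and vs :: "(complex^'a) list"
  assume "\<not> (at_point torus_manifold trivial_bundle p c i \<and> length vs = q)"
  then show "form_of A c i p vs = 0" using periodic_formsD(4)[OF A] by (auto simp: form_of_def)
next
  fix c :: "((complex^'a) \<times> (complex^'a), 'a) chart" and i and p :: "(complex^'a) \<times> (complex^'a)"
  assume "at_point torus_manifold trivial_bundle p c i"
  then show "antilinear_alternating q (form_of A c i p)"
    using form_of_at_point[OF periodic_formsD(1)[OF A]] periodic_formsD(3)[OF A] by simp
next
  fix c d :: "((complex^'a) \<times> (complex^'a), 'a) chart" and i j p and vs :: "(complex^'a) list"
  assume *: "at_point torus_manifold trivial_bundle p c i \<and> at_point torus_manifold trivial_bundle p d j"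
  then obtain x y where "c = torus_chart x" "p \<in> covering ` cube x" "d = torus_chart y" "p \<in> covering ` cube y"
    unfolding at_point_torus by blast
  then have "chart_change_deriv c d p = (\<lambda>v. v)" by (simp add: chart_change_deriv_torus)
  then show "form_of A c i p vs = trans_fun trivial_bundle i j p * form_of A d j p (map (chart_change_deriv c d p) vs)"
    using form_of_at_point[OF periodic_formsD(1)[OF A]] * by simp
next
  fix c :: "((complex^'a) \<times> (complex^'a), 'a) chart" and i and vs :: "(complex^'a) list"
  assume "c \<in> charts torus_manifold" "i \<in> frames (trivial_bundle :: ((complex^'a) \<times> (complex^'a), nat) line_bundle)"
  then obtain x where c: "c = torus_chart x" and i: "i = 0" by auto
  have "smooth_map_on (\<lambda>z. form_of A c i (chart_inv c z) vs) (cube x)"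
    by (rule smooth_map_on_cong[OF smooth_map_on_subset[OF periodic_formsD(5)[OF A, of vs]]])
      (simp_all add: c i chart_inv_torus_chart form_of_covering)
  then show "smooth_map_on (\<lambda>z. form_of A c i (chart_inv c z) vs) (snd c ` (fst c \<inter> fdom trivial_bundle i))"
    by (simp add: c chart_domain_Int_torus local_lift_chart_domain)
qed

lemma smooth_formsD:
  assumes "\<alpha> \<in> smooth_forms M L q"
  shows "\<not> (at_point M L p c i \<and> length vs = q) \<Longrightarrow> \<alpha> c i p vs = 0"
    and "at_point M L p c i \<Longrightarrow> antilinear_alternating q (\<alpha> c i p)"
    and "at_point M L p c i \<Longrightarrow> at_point M L p d j \<Longrightarrow>
      \<alpha> c i p vs = trans_fun L i j p * \<alpha> d j p (map (chart_change_deriv c d p) vs)"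
    and "c \<in> charts M \<Longrightarrow> i \<in> frames L \<Longrightarrow>
      smooth_map_on (\<lambda>z. \<alpha> c i (chart_inv c z) vs) (snd c ` (fst c \<inter> fdom L i))"
  using assms unfolding smooth_forms_def mem_Collect_eq by blast+

text \<open>The value at \<open>z\<close> is read off in the chart centred at \<open>z\<close>.  Near any \<open>x\<close> the chart centred at \<open>x\<close> can
  be used instead, which gives smoothness.\<close>

lemma smooth_form_obtain:
  fixes \<alpha> :: "((complex^'n::finite) \<times> (complex^'n), 'n, nat) form"
  assumes \<alpha>: "\<alpha> \<in> smooth_forms torus_manifold trivial_bundle q"
  obtains A where "A \<in> periodic_forms q" "\<alpha> = form_of A"
proof -
  note \<alpha>D = smooth_formsD[OF \<alpha>]
  have indep: "\<alpha> (torus_chart x) 0 p vs = \<alpha> (torus_chart y) 0 p vs"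
    if "p \<in> covering ` cube x" "p \<in> covering ` cube y" for x y p vs
  proof -
    have "\<alpha> (torus_chart x) 0 p vs = trans_fun trivial_bundle 0 0 p *
        \<alpha> (torus_chart y) 0 p (map (chart_change_deriv (torus_chart x) (torus_chart y) p) vs)"
      by (rule \<alpha>D(3)) (simp_all only: at_point_torus_chart that)
    then show ?thesis using that by (simp add: chart_change_deriv_torus)
  qed
  define A where "A = (\<lambda>z. \<alpha> (torus_chart z) 0 (covering z))"
  have A: "A z vs = \<alpha> (torus_chart x) 0 (covering z) vs" if "z \<in> cube x" for x z vs
    using indep[of "covering z" z x vs] that by (simp add: A_def)
  have "A \<in> periodic_forms q"
  proof (rule periodic_formsI)
    show "periodic (\<lambda>z. A z vs)" for vs
    proof (rule periodicI)
      fix z w :: "complex^'n" assume zw: "covering z = covering w"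
      show "A z vs = A w vs"
        using imageI[OF center_in_cube, of covering z] imageI[OF center_in_cube, of covering w]
        unfolding A_def zw by (rule indep)
    qed
    show "antilinear_alternating q (A z)" for z
      unfolding A_def by (rule \<alpha>D(2)) (simp add: at_point_torus_chart)
    show "A z vs = 0" if "length vs \<noteq> q" for z vs
      unfolding A_def by (rule \<alpha>D(1)) (simp add: that)
    show "smooth_map_on (\<lambda>z. A z vs) UNIV" for vs
    proof -
      have "smooth_map_on (\<lambda>z. A z vs) (cube x)" for x
      proof -
        have "smooth_map_on (\<lambda>z. \<alpha> (torus_chart x) 0 (chart_inv (torus_chart x) z) vs)
            (snd (torus_chart x) ` (fst (torus_chart x) \<inter> fdom trivial_bundle 0))"
          by (rule \<alpha>D(4)) simp_all
        then have "smooth_map_on (\<lambda>z. \<alpha> (torus_chart x) 0 (chart_inv (torus_chart x) z) vs) (cube x)"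
          by (simp add: chart_domain_Int_torus local_lift_chart_domain)
        then show ?thesis
          by (rule smooth_map_on_cong) (simp_all add: chart_inv_torus_chart A)
      qed
      then have "Ck_on k (\<lambda>z. A z vs) (\<Union>x\<in>UNIV. cube x)" for k
        by (intro Ck_on_UN) (auto simp: smooth_map_on_def)
      moreover have "(\<Union>x\<in>UNIV. cube x) = (UNIV :: (complex^'n) set)"
        using center_in_cube by blast
      ultimately show ?thesis by (simp add: smooth_map_on_def)
    qed
  qed
  moreover have "\<alpha> = form_of A"
  proof (intro ext)
    fix c i p vs
    show "\<alpha> c i p vs = form_of A c i p vs"
    proof (cases "at_point torus_manifold trivial_bundle p c i")
      case True
      then obtain x z where "i = 0" "c = torus_chart x" "z \<in> cube x" "p = covering z"
        unfolding at_point_torus by blast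
      then show ?thesis using A[of z x vs] form_of_covering[of z x A] by simp
    next
      case False
      then show ?thesis using \<alpha>D(1)[of p c i vs] by (simp add: form_of_def)
    qed
  qed
  ultimately show thesis by (rule that)
qed

definition periodic_dbar ::
    "(complex^'n::finite \<Rightarrow> (complex^'n) list \<Rightarrow> complex) \<Rightarrow> complex^'n \<Rightarrow> (complex^'n) list \<Rightarrow> complex" where
  "periodic_dbar A z = wedge (\<lambda>v vs. dbar_deriv (\<lambda>z. A z vs) z v)"

lemma dbar_form_of: "dbar torus_manifold trivial_bundle (form_of A) = form_of (periodic_dbar A)"
proof (intro ext)
  fix c i p vs
  show "dbar torus_manifold trivial_bundle (form_of A) c i p vs = form_of (periodic_dbar A) c i p vs"
  proof (cases "at_point torus_manifold trivial_bundle p c i")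
    case True
    then obtain x where x: "i = 0" "c = torus_chart x" "p \<in> covering ` cube x"
      unfolding at_point_torus by blast
    have "dbar_deriv (\<lambda>z. form_of A c i (chart_inv c z) ws) (local_lift x p) v =
        dbar_deriv (\<lambda>z. A z ws) (local_lift x p) v" for ws v
      by (rule dbar_deriv_cong[OF open_cube local_lift_in_cube[OF x(3)]])
        (simp add: x chart_inv_torus_chart form_of_covering)
    then show ?thesis using True
      by (simp add: dbar_def form_of_def periodic_dbar_def wedge_def x(2))
  qed (simp add: dbar_def form_of_def)
qed

lemma periodic_dbar_in_periodic_forms:
  assumes A: "A \<in> periodic_forms q"
  shows "periodic_dbar A \<in> periodic_forms (Suc q)"
proof (rule periodic_formsI)
  note AD = periodic_formsD[OF A]
  fix z and vs :: "(complex^'a) list"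
  show "periodic (\<lambda>z. periodic_dbar A z vs)"
    unfolding periodic_dbar_def wedge_def
    by (intro periodicI sum.cong arg_cong2[where f = "(*)"] refl periodicD[OF periodic_dbar_deriv[OF AD(2)]])
  show "antilinear_alternating (Suc q) (periodic_dbar A z)"
    unfolding periodic_dbar_def
  proof (rule alternating_wedge)
    show "antilinear_alternating q (\<lambda>vs. dbar_deriv (\<lambda>z. A z vs) z v)" for v
      unfolding alternating_iff
      by (intro conjI allI impI)
        (simp_all add: alternating_add[OF AD(3)] alternating_scale[OF AD(3)]
          alternating_repeat[OF AD(3)] dbar_deriv_add[OF AD(5) AD(5)] dbar_deriv_cmult[OF AD(5) AD(5)])
  qed (simp_all add: dbar_deriv_add_vec dbar_deriv_scale_vec smooth_map_on_differentiable[OF AD(5)])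
  show "periodic_dbar A z vs = 0" if "length vs \<noteq> Suc q"
    unfolding periodic_dbar_def wedge_def
  proof (intro sum.neutral ballI)
    fix l assume "l \<in> {..<length vs}"
    then have "length (take l vs @ drop (Suc l) vs) \<noteq> q" using that by auto
    then have "(\<lambda>z. A z (take l vs @ drop (Suc l) vs)) = (\<lambda>z. 0)" using AD(4) by blast
    then show "(- 1) ^ l * dbar_deriv (\<lambda>z. A z (take l vs @ drop (Suc l) vs)) z (vs ! l) = 0" by simp
  qed
  show "smooth_map_on (\<lambda>z. periodic_dbar A z vs) UNIV"
    unfolding periodic_dbar_def wedge_def smooth_map_on_def
    by (intro allI Ck_on_sum Ck_on_mult Ck_on_const smooth_map_onD[OF smooth_dbar_deriv[OF AD(5)]]) auto
qed

section \<open>The inner product, the adjoint and the Laplacian\<close>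

text \<open>The pointwise product of forms uses an orthonormal basis that is chosen by Hilbert's operator.
  The flat metric is the same at all points, so this is one constant basis; it is the following
  one.\<close>

definition onb :: "'n::finite \<Rightarrow> complex^'n" where
  "onb = (SOME u. \<forall>j l. (\<Sum>a\<in>UNIV. u j $ a * cnj (u l $ a)) = (if j = l then 1 else 0))"

lemma onb_orthonormal:
  "(\<Sum>a\<in>UNIV. onb j $ a * cnj (onb l $ a)) = (if j = l then 1 else 0)"
proof -
  let ?P = "\<lambda>u :: 'a \<Rightarrow> complex^'a. \<forall>j l. (\<Sum>a\<in>UNIV. u j $ a * cnj (u l $ a)) = (if j = l then 1 else 0)"
  have "?P (\<lambda>j. axis j 1)" using flat_metric_axis unfolding flat_metric_def by blast
  then have "?P onb" unfolding onb_def by (rule someI[where P = ?P])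
  then show ?thesis by blast
qed

text \<open>The rows of a square matrix are orthonormal iff its columns are.\<close>

lemma onb_dual: "(\<Sum>j\<in>UNIV. cnj (onb j $ a) * onb j $ b) = (if a = b then 1 else 0)"
proof -
  let ?P = "(\<chi> j a. onb j $ a) :: complex^'a^'a" and ?Q = "(\<chi> a l. cnj (onb l $ a)) :: complex^'a^'a"
  have "?P ** ?Q = mat 1"
    by (simp add: matrix_matrix_mult_def mat_def vec_eq_iff onb_orthonormal)
  then have "?Q ** ?P = mat 1" by (simp add: matrix_left_right_inverse)
  then have "(?Q ** ?P) $ a $ b = (mat 1 :: complex^'a^'a) $ a $ b" by simp
  then show ?thesis by (simp add: matrix_matrix_mult_def mat_def)
qed

lemma axis_eq_sum_onb: "axis a 1 = (\<Sum>j\<in>UNIV. cnj (onb j $ a) *s onb j)"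
  by (simp add: vec_eq_iff onb_dual axis_def)

lemma vec_eq_sum_onb: "\<exists>c. v = (\<Sum>j\<in>UNIV. c j *s (onb j :: complex^'n::finite))"
proof
  have eq: "v $ b = (\<Sum>j\<in>UNIV. (\<Sum>a\<in>UNIV. v $ a * cnj (onb j $ a)) * onb j $ b)" for b
  proof -
    have "(\<Sum>j\<in>UNIV. (\<Sum>a\<in>UNIV. v $ a * cnj (onb j $ a)) * onb j $ b) =
        (\<Sum>j\<in>UNIV. \<Sum>a\<in>UNIV. v $ a * (cnj (onb j $ a) * onb j $ b))"
      by (simp add: sum_distrib_right mult.assoc)
    also have "\<dots> = (\<Sum>a\<in>UNIV. v $ a * (\<Sum>j\<in>UNIV. cnj (onb j $ a) * onb j $ b))"
      unfolding sum_distrib_left by (rule sum.swap)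
    also have "\<dots> = (\<Sum>a\<in>UNIV. if a = b then v $ a else 0)"
      unfolding onb_dual by (intro sum.cong) auto
    also have "\<dots> = v $ b" by simp
    finally show ?thesis ..
  qed
  show "v = (\<Sum>j\<in>UNIV. (\<Sum>a\<in>UNIV. v $ a * cnj (onb j $ a)) *s onb j)"
    unfolding vec_eq_iff sum_component vector_smult_component by (intro allI eq)
qed

locale torus_weight =
  fixes W :: "complex^'n::finite \<Rightarrow> real"
  assumes W_periodic: "periodic W" and W_pos: "\<And>z. W z > 0" and W_smooth: "smooth_map_on W UNIV"
begin

definition pairing where
  "pairing q A B z = (\<Sum>J | length J = q. A z (map onb J) * cnj (B z (map onb J))) * of_real (W z) / fact q"

definition inner_product where
  "inner_product q A B = torus_integral (pairing q A B)"

text \<open>The formula that integration by parts produces: minus the divergence of \<open>W * B\<close>, divided by \<open>W\<close>.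
  The divergence needs the complex linear part of the derivative; it is written as the conjugate of
  the conjugate linear part of the conjugate function.\<close>

definition formal_adjoint where
  "formal_adjoint B z vs =
    - (\<Sum>j\<in>UNIV. cnj (dbar_deriv (\<lambda>z. of_real (W z) * cnj (B z (onb j # vs))) z (onb j))) / of_real (W z)"

lemma form_product_form_of:
  assumes A: "A \<in> periodic_forms q" and B: "B \<in> periodic_forms q" and p: "p \<in> torus"
  shows "form_product torus_manifold flat_metric trivial_bundle (weight_metric W) q (form_of A) (form_of B) p =
    pairing q A B (lift p)"
proof -
  let ?ci = "SOME (c, i). at_point torus_manifold trivial_bundle p c i"
  have "p \<in> covering ` cube (lift p)"
    using covering_local_lift[OF p, of 0] center_in_cube by (metis image_eqI)
  then have "\<exists>ci. case ci of (c, i) \<Rightarrow> at_point torus_manifold trivial_bundle p c i"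
    using at_point_torus_chart[of p "lift p"] by (intro exI[of _ "(torus_chart (lift p), 0)"]) simp
  then have "case ?ci of (c, i) \<Rightarrow> at_point torus_manifold trivial_bundle p c i" by (rule someI_ex)
  then obtain c i where ci: "?ci = (c, i)" "at_point torus_manifold trivial_bundle p c i"
    by (cases ?ci) simp
  note form_of_at_point[OF periodic_formsD(1)[OF A] ci(2)] form_of_at_point[OF periodic_formsD(1)[OF B] ci(2)]
  then show ?thesis
    unfolding form_product_def ci Let_def prod.case pairing_def flat_metric_def onb_def[symmetric]
    by (simp add: weight_metric_def)
qed

lemma L2_product_form_of:
  assumes "A \<in> periodic_forms q" "B \<in> periodic_forms q"
  shows "L2_product torus_manifold flat_metric trivial_bundle (weight_metric W) q (form_of A) (form_of B) =
    inner_product q A B"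
  unfolding L2_product_def inner_product_def torus_integral_def
  by (intro Bochner_Integration.integral_cong refl) (simp add: form_product_form_of[OF assms])

lemma W_neq_0 [simp]: "W z \<noteq> 0" using W_pos[of z] by simp

lemma Ck_W: "Ck_on k (\<lambda>z. complex_of_real (W z)) UNIV"
  by (rule Ck_on_bounded_linear[OF bounded_linear_of_real smooth_map_onD[OF W_smooth]]) simp

lemma Ck_form: "A \<in> periodic_forms q \<Longrightarrow> Ck_on k (\<lambda>z. A z vs) UNIV"
  using periodic_formsD(5) smooth_map_onD by blast

lemma Ck_cnj: "Ck_on k f UNIV \<Longrightarrow> Ck_on k (\<lambda>z. cnj (f z)) UNIV"
  by (rule Ck_on_bounded_linear[OF bounded_linear_cnj]) simp_all

lemma pairing_periodic:
  assumes A: "A \<in> periodic_forms q" and B: "B \<in> periodic_forms q"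
  shows "periodic (pairing q A B)"
proof (rule periodicI)
  fix z w :: "complex^'n" assume zw: "covering z = covering w"
  have "A z = A w" "B z = B w" "W z = W w"
    by (fact periodicD[OF periodic_formsD(1)[OF A] zw] periodicD[OF periodic_formsD(1)[OF B] zw]
        periodicD[OF W_periodic zw])+
  then show "pairing q A B z = pairing q A B w" by (simp add: pairing_def)
qed

lemma pairing_continuous:
  assumes A: "A \<in> periodic_forms q" and B: "B \<in> periodic_forms q"
  shows "continuous_on UNIV (pairing q A B)"
  unfolding pairing_def
  by (intro continuous_intros periodic_formsD(6)[OF A] periodic_formsD(6)[OF B]
      Ck_on_imp_continuous_on[OF smooth_map_onD[OF W_smooth]]) auto

lemma inner_product_diff_left:
  assumes "A \<in> periodic_forms q" "B \<in> periodic_forms q" "C \<in> periodic_forms q"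
  shows "inner_product q C (\<lambda>z vs. A z vs - B z vs) = inner_product q C A - inner_product q C B"
proof -
  have "inner_product q C (\<lambda>z vs. A z vs - B z vs) = torus_integral (\<lambda>z. pairing q C A z - pairing q C B z)"
    unfolding inner_product_def
    by (rule torus_integral_cong)
      (simp add: pairing_def right_diff_distrib left_diff_distrib sum_subtractf diff_divide_distrib)
  also have "\<dots> = inner_product q C A - inner_product q C B"
    unfolding inner_product_def using assms
    by (intro torus_integral_diff pairing_periodic pairing_continuous)
  finally show ?thesis .
qed

lemma inner_product_add_left:
  assumes "A \<in> periodic_forms q" "B \<in> periodic_forms q" "C \<in> periodic_forms q"
  shows "inner_product q (\<lambda>z vs. A z vs + B z vs) C = inner_product q A C + inner_product q B C"
proof -
  have "inner_product q (\<lambda>z vs. A z vs + B z vs) C = torus_integral (\<lambda>z. pairing q A C z + pairing q B C z)"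
    unfolding inner_product_def
    by (rule torus_integral_cong)
      (simp add: pairing_def distrib_left distrib_right sum.distrib add_divide_distrib)
  also have "\<dots> = inner_product q A C + inner_product q B C"
    unfolding inner_product_def using assms
    by (intro torus_integral_add pairing_periodic pairing_continuous)
  finally show ?thesis .
qed

lemma inner_product_cmult_left: "inner_product q (\<lambda>z vs. c * A z vs) B = c * inner_product q A B"
proof -
  have "pairing q (\<lambda>z vs. c * A z vs) B z = c * pairing q A B z" for z
    by (simp add: pairing_def sum_distrib_left sum_distrib_right mult_ac)
  then show ?thesis
    unfolding inner_product_def torus_integral_cmult[symmetric] by (rule torus_integral_cong)
qed

lemma inner_product_cnj: "inner_product q B A = cnj (inner_product q A B)"
proof -
  have "pairing q B A z = cnj (pairing q A B z)" for z
    by (simp add: pairing_def mult.commute)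
  then show ?thesis unfolding inner_product_def torus_integral_def by simp
qed

lemma pairing_self:
  "pairing q A A z = of_real ((\<Sum>J | length J = q. (cmod (A z (map onb J)))\<^sup>2) * W z / fact q)"
  unfolding pairing_def complex_norm_square[symmetric] by simp

text \<open>The product is positive definite: if the integral of the pointwise square norm vanishes, then so
  does the form on all lists of basis vectors, and hence the form.\<close>

lemma inner_product_self:
  assumes A: "A \<in> periodic_forms q"
  obtains r where "inner_product q A A = of_real r" "0 \<le> r" "r = 0 \<Longrightarrow> A = (\<lambda>z vs. 0)"
proof -
  define \<Phi> where "\<Phi> = (\<lambda>z. (\<Sum>J | length J = q. (cmod (A z (map onb J)))\<^sup>2) * W z / fact q)"
  have \<Phi>: "pairing q A A = (\<lambda>z. of_real (\<Phi> z))" by (simp add: pairing_self \<Phi>_def fun_eq_iff)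
  have \<Phi>_nonneg: "\<Phi> z \<ge> 0" for z
    unfolding \<Phi>_def using W_pos[of z] by (simp add: sum_nonneg)
  have per: "periodic \<Phi>"
  proof (rule periodicI)
    fix z w :: "complex^'n" assume "covering z = covering w"
    from periodicD[OF pairing_periodic[OF A A] this] show "\<Phi> z = \<Phi> w" unfolding \<Phi> by simp
  qed
  have cont: "continuous_on UNIV \<Phi>"
    unfolding \<Phi>_def
    by (intro continuous_intros periodic_formsD(6)[OF A] Ck_on_imp_continuous_on[OF smooth_map_onD[OF W_smooth]]) auto
  define r where "r = (LINT p|torus_volume. \<Phi> (lift p))"
  have r: "inner_product q A A = of_real r"
    unfolding inner_product_def \<Phi> r_def by (rule torus_integral_of_real)
  show thesis
  proof (rule that[OF r])
    show "0 \<le> r" unfolding r_def using \<Phi>_nonneg by (intro Bochner_Integration.integral_nonneg) auto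
  next
    assume "r = 0"
    then have "torus_integral (\<lambda>z. of_real (\<Phi> z)) = 0"
      using r unfolding inner_product_def \<Phi> by simp
    then have "\<Phi> z = 0" for z by (rule torus_integral_eq_0_imp[OF per cont \<Phi>_nonneg])
    then have "(\<Sum>J | length J = q. (cmod (A z (map onb J)))\<^sup>2) = 0" for z
      by (simp add: \<Phi>_def)
    then have onb_0: "A z (map onb J) = 0" if "length J = q" for z J
      using that by (subst (asm) sum_nonneg_eq_0_iff) (auto simp: finite_lists_of_length)
    have "A z vs = 0" for z vs
    proof (cases "length vs = q")
      case True
      show ?thesis
        by (rule alternating_eq_0[OF periodic_formsD(3)[OF A] vec_eq_sum_onb onb_0 True])
    next
      case False
      then show ?thesis by (rule periodic_formsD(4)[OF A])
    qed
    then show "A = (\<lambda>z vs. 0)" by blast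
  qed
qed

lemma smooth_adjoint_integrand:
  assumes B: "B \<in> periodic_forms (Suc q)"
  shows "smooth_map_on (\<lambda>z. of_real (W z) * cnj (B z vs)) UNIV"
  unfolding smooth_map_on_def by (intro allI Ck_on_mult Ck_W Ck_cnj Ck_form[OF B]) simp

lemma periodic_adjoint_integrand:
  assumes B: "B \<in> periodic_forms (Suc q)"
  shows "periodic (\<lambda>z. of_real (W z) * cnj (B z vs) :: complex)"
proof (rule periodicI)
  fix z w :: "complex^'n" assume zw: "covering z = covering w"
  have "B z = B w" "W z = W w"
    by (fact periodicD[OF periodic_formsD(1)[OF B] zw] periodicD[OF W_periodic zw])+
  then show "of_real (W z) * cnj (B z vs) = (of_real (W w) * cnj (B w vs) :: complex)" by simp
qed

lemma formal_adjoint_in_periodic_forms: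
  assumes B: "B \<in> periodic_forms (Suc q)"
  shows "formal_adjoint B \<in> periodic_forms q"
proof (rule periodic_formsI)
  note sm = smooth_adjoint_integrand[OF B] and per = periodic_adjoint_integrand[OF B]
  fix z and vs :: "(complex^'n) list"
  show "periodic (\<lambda>z. formal_adjoint B z vs)"
  proof (rule periodicI)
    fix z w :: "complex^'n" assume zw: "covering z = covering w"
    have "W z = W w" using periodicD[OF W_periodic zw] .
    then show "formal_adjoint B z vs = formal_adjoint B w vs"
      unfolding formal_adjoint_def using periodicD[OF periodic_dbar_deriv[OF per] zw] by simp
  qed
  show "antilinear_alternating q (formal_adjoint B z)"
  proof -
    define T where "T = (\<lambda>u vs. cnj (dbar_deriv (\<lambda>z. of_real (W z) * cnj (B z (u # vs))) z u))"
    have BD: "antilinear_alternating q (\<lambda>vs. B z (u # vs))" for u z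
      by (rule alternating_Cons[OF periodic_formsD(3)[OF B]])
    have T: "antilinear_alternating q (T u)" for u
      unfolding alternating_iff
    proof (intro conjI allI impI)
      fix X Y :: "(complex^'n) list" and v w assume len: "length X + length Y + 1 = q"
      show "T u (X @ (v + w) # Y) = T u (X @ v # Y) + T u (X @ w # Y)"
        unfolding T_def using alternating_add[OF BD len]
        by (simp add: distrib_left dbar_deriv_add[OF sm sm])
    next
      fix X Y :: "(complex^'n) list" and t v assume len: "length X + length Y + 1 = q"
      show "T u (X @ (t *s v) # Y) = cnj t * T u (X @ v # Y)"
        unfolding T_def using alternating_scale[OF BD len]
        by (simp add: mult.left_commute[of _ t] dbar_deriv_cmult[OF sm sm])
    next
      fix X Y Z :: "(complex^'n) list" and v assume len: "length X + length Y + length Z + 2 = q"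
      show "T u (X @ v # Y @ v # Z) = 0"
        unfolding T_def using alternating_repeat[OF BD len] by simp
    qed
    have "antilinear_alternating q (\<lambda>vs. \<Sum>j\<in>I. T (onb j) vs)" if "finite I" for I
      using that
      by induction (simp_all add: alternating_add_fun[OF T] alternating_iff[of q "\<lambda>vs. 0"])
    then have "antilinear_alternating q (\<lambda>vs. (- 1 / of_real (W z)) * (\<Sum>j\<in>UNIV. T (onb j) vs))"
      by (intro alternating_cmult) simp
    moreover have "formal_adjoint B z = (\<lambda>vs. (- 1 / of_real (W z)) * (\<Sum>j\<in>UNIV. T (onb j) vs))"
      by (simp add: formal_adjoint_def T_def fun_eq_iff)
    ultimately show ?thesis by simp
  qed
  show "formal_adjoint B z vs = 0" if "length vs \<noteq> q"
    unfolding formal_adjoint_def using that periodic_formsD(4)[OF B] by simp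
  have "Ck_on k (\<lambda>z. - (\<Sum>j\<in>UNIV. cnj (dbar_deriv (\<lambda>z. of_real (W z) * cnj (B z (onb j # vs))) z (onb j)))
      * inverse (of_real (W z))) UNIV" for k
    by (intro Ck_on_mult Ck_on_uminus Ck_on_sum Ck_cnj smooth_map_onD[OF smooth_dbar_deriv[OF sm]]
        Ck_on_inverse Ck_W) auto
  then show "smooth_map_on (\<lambda>z. formal_adjoint B z vs) UNIV"
    by (simp add: smooth_map_on_def formal_adjoint_def divide_inverse)
qed

text \<open>By \<open>sum_wedge_mult_cnj\<close> only one term of the antisymmetrisation has to be considered.  Pointwise,
  the difference of the two sides is then by the product rule a sum of derivatives of periodic
  functions, whose integrals vanish.\<close>

lemma inner_product_dbar:
  assumes A: "A \<in> periodic_forms q" and B: "B \<in> periodic_forms (Suc q)"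
  shows "inner_product (Suc q) (periodic_dbar A) B = inner_product q A (formal_adjoint B)"
proof -
  note dA = periodic_dbar_in_periodic_forms[OF A] and adj = formal_adjoint_in_periodic_forms[OF B]
  note sm = smooth_adjoint_integrand[OF B] and per = periodic_adjoint_integrand[OF B]
  define G where "G = (\<lambda>J j z. complex_of_real (W z) * cnj (B z (onb j # map onb J)))"
  define F where "F = (\<lambda>J j z. A z (map onb J) * G J j z)"
  have F_smooth: "smooth_map_on (F J j) UNIV" for J j
    unfolding F_def G_def smooth_map_on_def
    by (intro allI Ck_on_mult Ck_form[OF A] smooth_map_onD[OF sm]) simp
  have F_per: "periodic (F J j)" for J j
    unfolding F_def G_def
    by (intro periodicI arg_cong2[where f = "(*)"] periodicD[OF periodic_formsD(2)[OF A]] periodicD[OF per])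
  have "pairing (Suc q) (periodic_dbar A) B z - pairing q A (formal_adjoint B) z =
      (\<Sum>J | length J = q. \<Sum>j\<in>UNIV. (1 / fact q) * dbar_deriv (F J j) z (onb j))" for z
  proof -
    let ?d = "\<lambda>J j. dbar_deriv (\<lambda>z. A z (map onb J)) z (onb j)"
    have "(\<Sum>K | length K = Suc q. periodic_dbar A z (map onb K) * cnj (B z (map onb K))) =
        of_nat (Suc q) * (\<Sum>J | length J = q. \<Sum>j\<in>UNIV. ?d J j * cnj (B z (onb j # map onb J)))"
      unfolding periodic_dbar_def by (rule sum_wedge_mult_cnj[OF periodic_formsD(3)[OF B]])
    then have 1: "pairing (Suc q) (periodic_dbar A) B z =
        (\<Sum>J | length J = q. \<Sum>j\<in>UNIV. ?d J j * cnj (B z (onb j # map onb J))) * of_real (W z) / fact q"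
      unfolding pairing_def by (simp del: of_nat_Suc)
    have 2: "cnj (formal_adjoint B z (map onb J)) * of_real (W z) = - (\<Sum>j\<in>UNIV. dbar_deriv (G J j) z (onb j))" for J
      by (simp add: formal_adjoint_def G_def)
    have "pairing q A (formal_adjoint B) z =
        (\<Sum>J | length J = q. A z (map onb J) * (cnj (formal_adjoint B z (map onb J)) * of_real (W z))) / fact q"
      unfolding pairing_def by (simp add: sum_distrib_right mult.assoc)
    also have "\<dots> = - (\<Sum>J | length J = q. \<Sum>j\<in>UNIV. A z (map onb J) * dbar_deriv (G J j) z (onb j)) / fact q"
      unfolding 2 by (simp add: sum_distrib_left sum_negf)
    finally have 3: "pairing q A (formal_adjoint B) z =
        - (\<Sum>J | length J = q. \<Sum>j\<in>UNIV. A z (map onb J) * dbar_deriv (G J j) z (onb j)) / fact q" .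
    have 4: "dbar_deriv (F J j) z (onb j) =
        A z (map onb J) * dbar_deriv (G J j) z (onb j) + ?d J j * cnj (B z (onb j # map onb J)) * of_real (W z)" for J j
      unfolding F_def G_def dbar_deriv_mult[OF periodic_formsD(5)[OF A] sm]
      by (simp add: mult.assoc mult.commute)
    show ?thesis
      unfolding 1 3 4
      by (simp add: sum.distrib sum_distrib_right sum_divide_distrib add_divide_distrib add.commute)
  qed
  then have "inner_product (Suc q) (periodic_dbar A) B - inner_product q A (formal_adjoint B) =
      torus_integral (\<lambda>z. \<Sum>J | length J = q. \<Sum>j\<in>UNIV. (1 / fact q) * dbar_deriv (F J j) z (onb j))"
    unfolding inner_product_def
    by (subst torus_integral_diff[symmetric])
      (simp_all add: pairing_periodic pairing_continuous A B dA adj)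
  also have "\<dots> = (\<Sum>J | length J = q. \<Sum>j\<in>UNIV. torus_integral (\<lambda>z. (1 / fact q) * dbar_deriv (F J j) z (onb j)))"
  proof -
    have c: "continuous_on UNIV (\<lambda>z. (1 / fact q) * dbar_deriv (F J j) z (onb j))" for J j
      by (intro continuous_intros smooth_map_on_imp_continuous_on[OF smooth_dbar_deriv[OF F_smooth]])
    have p: "periodic (\<lambda>z. (1 / fact q) * dbar_deriv (F J j) z (onb j))" for J j
      by (intro periodicI arg_cong2[where f = "(*)"] refl periodicD[OF periodic_dbar_deriv[OF F_per]])
    have p2: "periodic (\<lambda>z. \<Sum>j\<in>UNIV. (1 / fact q) * dbar_deriv (F J j) z (onb j))" for J
      by (intro periodicI sum.cong refl periodicD[OF p])
    have c2: "continuous_on UNIV (\<lambda>z. \<Sum>j\<in>UNIV. (1 / fact q) * dbar_deriv (F J j) z (onb j))" for J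
      by (intro continuous_on_sum c)
    show ?thesis
      by (subst torus_integral_sum[OF p2 c2]) (intro sum.cong refl torus_integral_sum p c)
  qed
  also have "\<dots> = 0"
    by (simp only: torus_integral_cmult torus_integral_dbar_deriv[OF F_per F_smooth] mult_zero_right sum.neutral_const)
  finally show ?thesis by simp
qed

text \<open>The adjoint is defined by a description operator.  Its uniqueness part is that the difference of
  two candidates is orthogonal to all smooth forms, in particular to itself.\<close>

lemma dbar_adjoint_form_of:
  assumes B: "B \<in> periodic_forms (Suc q)"
  shows "dbar_adjoint torus_manifold flat_metric trivial_bundle (weight_metric W) q (form_of B) =
    form_of (formal_adjoint B)"
  unfolding dbar_adjoint_def
proof (rule the_equality)
  note adj = formal_adjoint_in_periodic_forms[OF B]
  let ?L2 = "L2_product torus_manifold flat_metric trivial_bundle (weight_metric W)"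
  have L2_dbar: "?L2 (Suc q) (dbar torus_manifold trivial_bundle (form_of A)) (form_of B) =
      inner_product q A (formal_adjoint B)" if "A \<in> periodic_forms q" for A
    using that B by (simp add: dbar_form_of L2_product_form_of periodic_dbar_in_periodic_forms inner_product_dbar)
  show "form_of (formal_adjoint B) \<in> smooth_forms torus_manifold trivial_bundle q \<and>
    (\<forall>\<alpha>\<in>smooth_forms torus_manifold trivial_bundle q.
      ?L2 (Suc q) (dbar torus_manifold trivial_bundle \<alpha>) (form_of B) = ?L2 q \<alpha> (form_of (formal_adjoint B)))"
  proof (intro conjI ballI)
    show "form_of (formal_adjoint B) \<in> smooth_forms torus_manifold trivial_bundle q"
      by (rule form_of_smooth_form[OF adj])
    fix \<alpha> :: "((complex^'n) \<times> (complex^'n), 'n, nat) form"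
    assume "\<alpha> \<in> smooth_forms torus_manifold trivial_bundle q"
    then obtain A where A: "A \<in> periodic_forms q" "\<alpha> = form_of A" by (rule smooth_form_obtain)
    show "?L2 (Suc q) (dbar torus_manifold trivial_bundle \<alpha>) (form_of B) = ?L2 q \<alpha> (form_of (formal_adjoint B))"
      unfolding A(2) L2_dbar[OF A(1)] L2_product_form_of[OF A(1) adj] ..
  qed
  fix \<gamma> :: "((complex^'n) \<times> (complex^'n), 'n, nat) form"
  assume \<gamma>: "\<gamma> \<in> smooth_forms torus_manifold trivial_bundle q \<and>
    (\<forall>\<alpha>\<in>smooth_forms torus_manifold trivial_bundle q.
      ?L2 (Suc q) (dbar torus_manifold trivial_bundle \<alpha>) (form_of B) = ?L2 q \<alpha> \<gamma>)"
  then obtain C where C: "C \<in> periodic_forms q" "\<gamma> = form_of C" using smooth_form_obtain by metis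
  define D where "D = (\<lambda>z vs. C z vs - formal_adjoint B z vs)"
  have D: "D \<in> periodic_forms q"
  proof (rule periodic_formsI)
    show "periodic (\<lambda>z. D z vs)" for vs
      unfolding D_def
      by (intro periodicI arg_cong2[where f = "(-)"] periodicD[OF periodic_formsD(2)[OF C(1)]]
          periodicD[OF periodic_formsD(2)[OF adj]])
    show "antilinear_alternating q (D z)" for z
      unfolding D_def by (intro alternating_diff periodic_formsD(3)[OF C(1)] periodic_formsD(3)[OF adj])
    show "D z vs = 0" if "length vs \<noteq> q" for z vs
      using periodic_formsD(4)[OF C(1) that] periodic_formsD(4)[OF adj that] by (simp add: D_def)
    show "smooth_map_on (\<lambda>z. D z vs) UNIV" for vs
      unfolding D_def smooth_map_on_def by (intro allI Ck_on_diff Ck_form[OF C(1)] Ck_form[OF adj]) simp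
  qed
  have "inner_product q D (formal_adjoint B) = inner_product q D C"
    using \<gamma> form_of_smooth_form[OF D] L2_dbar[OF D] L2_product_form_of[OF D C(1)] C(2) by metis
  then have "inner_product q D D = 0"
    unfolding D_def[of] using inner_product_diff_left[OF C(1) adj D] by (simp add: D_def)
  then have "D = (\<lambda>z vs. 0)"
    using inner_product_self[OF D] by (metis of_real_eq_0_iff)
  then have "C = formal_adjoint B"
    by (simp add: D_def fun_eq_iff)
  then show "\<gamma> = form_of (formal_adjoint B)" using C(2) by simp
qed

definition periodic_laplacian where
  "periodic_laplacian q A z vs =
    (case q of 0 \<Rightarrow> 0 | Suc r \<Rightarrow> periodic_dbar (formal_adjoint A) z vs) + formal_adjoint (periodic_dbar A) z vs"

lemma kodaira_laplacian_form_of: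
  assumes A: "A \<in> periodic_forms q"
  shows "kodaira_laplacian torus_manifold flat_metric trivial_bundle (weight_metric W) q (form_of A) =
    form_of (periodic_laplacian q A)"
proof -
  note adj = dbar_adjoint_form_of[OF periodic_dbar_in_periodic_forms[OF A]]
  show ?thesis
  proof (cases q)
    case 0
    then show ?thesis
      using adj by (simp add: kodaira_laplacian_def dbar_form_of form_of_def periodic_laplacian_def fun_eq_iff)
  next
    case (Suc r)
    have 1: "dbar_adjoint torus_manifold flat_metric trivial_bundle (weight_metric W) r (form_of A) = form_of (formal_adjoint A)"
      using dbar_adjoint_form_of A Suc by blast
    show ?thesis
      unfolding kodaira_laplacian_def dbar_form_of adj unfolding Suc nat.case 1 dbar_form_of
      by (intro ext) (simp add: form_of_def periodic_laplacian_def)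
  qed
qed

lemma laplacian_eigenvalue_iff:
  "laplacian_eigenvalue torus_manifold flat_metric trivial_bundle (weight_metric W) q \<mu> \<longleftrightarrow>
    (\<exists>A\<in>periodic_forms q. A \<noteq> (\<lambda>z vs. 0) \<and> periodic_laplacian q A = (\<lambda>z vs. of_real \<mu> * A z vs))"
proof -
  have zero: "form_of (\<lambda>(z :: complex^'n) vs. 0) = (\<lambda>c i p vs. 0)" by (simp add: form_of_def fun_eq_iff)
  have scale: "form_of (\<lambda>z vs. of_real \<mu> * A z vs) = (\<lambda>c i p vs. of_real \<mu> * form_of A c i p vs)"
    for A :: "complex^'n \<Rightarrow> (complex^'n) list \<Rightarrow> complex"
    by (simp add: form_of_def fun_eq_iff)
  show ?thesis
  proof
    assume "laplacian_eigenvalue torus_manifold flat_metric trivial_bundle (weight_metric W) q \<mu>"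
    then obtain \<alpha> where \<alpha>: "\<alpha> \<in> smooth_forms torus_manifold trivial_bundle q" "\<alpha> \<noteq> (\<lambda>c i p vs. 0)"
      "kodaira_laplacian torus_manifold flat_metric trivial_bundle (weight_metric W) q \<alpha> = (\<lambda>c i p vs. of_real \<mu> * \<alpha> c i p vs)"
      unfolding laplacian_eigenvalue_def by blast
    obtain A where A: "A \<in> periodic_forms q" "\<alpha> = form_of A" using \<alpha>(1) by (rule smooth_form_obtain)
    have "form_of (periodic_laplacian q A) = form_of (\<lambda>z vs. of_real \<mu> * A z vs)"
      using \<alpha>(3) unfolding A(2) kodaira_laplacian_form_of[OF A(1)] scale .
    moreover have "A \<noteq> (\<lambda>z vs. 0)" using \<alpha>(2) zero A(2) by metis
    ultimately show "\<exists>A\<in>periodic_forms q. A \<noteq> (\<lambda>z vs. 0) \<and> periodic_laplacian q A = (\<lambda>z vs. of_real \<mu> * A z vs)"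
      using A(1) unfolding form_of_eq_iff by blast
  next
    assume "\<exists>A\<in>periodic_forms q. A \<noteq> (\<lambda>z vs. 0) \<and> periodic_laplacian q A = (\<lambda>z vs. of_real \<mu> * A z vs)"
    then obtain A where A: "A \<in> periodic_forms q" "A \<noteq> (\<lambda>z vs. 0)"
      "periodic_laplacian q A = (\<lambda>z vs. of_real \<mu> * A z vs)" by blast
    have "form_of A \<noteq> (\<lambda>c i p vs. 0)" using A(2) unfolding zero[symmetric] form_of_eq_iff .
    moreover have "kodaira_laplacian torus_manifold flat_metric trivial_bundle (weight_metric W) q (form_of A) =
        (\<lambda>c i p vs. of_real \<mu> * form_of A c i p vs)"
      unfolding kodaira_laplacian_form_of[OF A(1)] A(3) scale ..
    ultimately show "laplacian_eigenvalue torus_manifold flat_metric trivial_bundle (weight_metric W) q \<mu>"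
      unfolding laplacian_eigenvalue_def using form_of_smooth_form[OF A(1)] by blast
  qed
qed

text \<open>For an eigenform \<open>A\<close>, the product of \<open>\<mu> A\<close> with \<open>A\<close> is the sum of the square norms of the images of
  \<open>A\<close> under the Cauchy-Riemann operator and under its adjoint.\<close>

lemma laplacian_eigenvalue_nonneg:
  assumes "laplacian_eigenvalue torus_manifold flat_metric trivial_bundle (weight_metric W) q \<mu>"
  shows "0 \<le> \<mu>"
proof -
  obtain A where A: "A \<in> periodic_forms q" "A \<noteq> (\<lambda>z vs. 0)"
    "periodic_laplacian q A = (\<lambda>z vs. of_real \<mu> * A z vs)"
    using assms unfolding laplacian_eigenvalue_iff by blast
  note dA = periodic_dbar_in_periodic_forms[OF A(1)]
  note adA = formal_adjoint_in_periodic_forms[OF dA]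
  obtain r where r: "inner_product q A A = of_real r" "0 \<le> r" "r = 0 \<Longrightarrow> A = (\<lambda>z vs. 0)"
    using inner_product_self[OF A(1)] by blast
  then have r_pos: "0 < r" using A(2) by force
  obtain s where s: "inner_product (Suc q) (periodic_dbar A) (periodic_dbar A) = of_real s" "0 \<le> s"
    using inner_product_self[OF dA] by blast
  have up: "inner_product q (formal_adjoint (periodic_dbar A)) A = of_real s"
    unfolding inner_product_cnj[of q "formal_adjoint (periodic_dbar A)" A] inner_product_dbar[OF A(1) dA, symmetric] s(1)
    by simp
  obtain t where t: "inner_product q (periodic_laplacian q A) A = of_real (t + s)" "0 \<le> t"
  proof (cases q)
    case 0
    then have "periodic_laplacian q A = formal_adjoint (periodic_dbar A)"
      by (simp add: periodic_laplacian_def fun_eq_iff)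
    then show thesis using that[of 0] up by simp
  next
    case (Suc r)
    have A': "A \<in> periodic_forms (Suc r)" using A(1) Suc by simp
    note aA = formal_adjoint_in_periodic_forms[OF A']
    obtain t where t: "inner_product r (formal_adjoint A) (formal_adjoint A) = of_real t" "0 \<le> t"
      using inner_product_self[OF aA] by blast
    have down: "inner_product q (periodic_dbar (formal_adjoint A)) A = of_real t"
      using inner_product_dbar[OF aA A'] t(1) Suc by simp
    have "periodic_laplacian q A =
        (\<lambda>z vs. periodic_dbar (formal_adjoint A) z vs + formal_adjoint (periodic_dbar A) z vs)"
      by (simp add: periodic_laplacian_def Suc fun_eq_iff)
    moreover have "periodic_dbar (formal_adjoint A) \<in> periodic_forms q"
      using periodic_dbar_in_periodic_forms[OF aA] Suc by simp
    ultimately have "inner_product q (periodic_laplacian q A) A = of_real (t + s)"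
      using inner_product_add_left adA A(1) up down by simp
    then show thesis using that t(2) by blast
  qed
  have "of_real (\<mu> * r) = (of_real (t + s) :: complex)"
    using t(1) unfolding A(3) inner_product_cmult_left r(1) by simp
  then have "\<mu> * r = t + s" by (simp only: of_real_eq_iff)
  then show ?thesis using r_pos s(2) t(2) by (metis add_nonneg_nonneg zero_le_mult_iff not_less)
qed

end

section \<open>Eigenforms that depend on one real coordinate\<close>

lemma Ck_on_sin_cos: "Ck_on k (sin :: real \<Rightarrow> real) UNIV \<and> Ck_on k (cos :: real \<Rightarrow> real) UNIV"
proof (induction k)
  case 0
  then show ?case by (simp add: continuous_on_sin continuous_on_cos)
next
  case (Suc k)
  then have "Ck_on (Suc k) (sin :: real \<Rightarrow> real) UNIV"
    by (intro Ck_on_real_derivative[OF DERIV_sin]) simp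
  moreover have "Ck_on (Suc k) (cos :: real \<Rightarrow> real) UNIV"
    using Suc by (intro Ck_on_real_derivative[OF DERIV_cos] Ck_on_uminus) simp_all
  ultimately show ?case by blast
qed

lemma Ck_on_exp_cos_squared: "Ck_on k (\<lambda>x::real. exp (c * (cos x)\<^sup>2)) UNIV"
proof (induction k)
  case 0
  show ?case unfolding Ck_on.simps by (intro continuous_intros)
next
  case (Suc k)
  show ?case
  proof (rule Ck_on_real_derivative)
    show "((\<lambda>x. exp (c * (cos x)\<^sup>2)) has_real_derivative exp (c * (cos x)\<^sup>2) * (- 2 * c * (cos x * sin x))) (at x)" for x
      by (auto intro!: derivative_eq_intros)
    show "Ck_on k (\<lambda>x. exp (c * (cos x)\<^sup>2) * (- 2 * c * (cos x * sin x))) UNIV"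
      using Ck_on_sin_cos by (intro Ck_on_mult Ck_on_const Suc) auto
  qed
qed

text \<open>Each derivative of one function is expressed through the other, so both gain derivatives
  alternately.\<close>

lemma sturm_liouville_smooth:
  fixes f p u v :: "real \<Rightarrow> real"
  assumes "\<And>k. Ck_on k u UNIV" "\<And>k. Ck_on k v UNIV"
    and f: "\<And>x. (f has_real_derivative u x * p x) (at x)"
    and p: "\<And>x. (p has_real_derivative v x * f x) (at x)"
  shows "Ck_on k f UNIV \<and> Ck_on k p UNIV"
proof (induction k)
  case 0
  have "isCont f x" "isCont p x" for x using f p DERIV_isCont by blast+
  then show ?case by (simp add: continuous_at_imp_continuous_on)
next
  case (Suc k)
  then show ?case
    by (intro conjI Ck_on_real_derivative[OF f] Ck_on_real_derivative[OF p] Ck_on_mult assms) auto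
qed

lemma periodic_coordinate:
  fixes \<phi> :: "real \<Rightarrow> 'b"
  assumes "\<And>x. \<phi> (x + 2 * pi) = \<phi> x"
  shows "periodic (\<lambda>z :: complex^'n. \<phi> (Re (z $ j)))"
proof (rule periodicI)
  have nat: "\<phi> (x + 2 * pi * real n) = \<phi> x" for x n
  proof (induction n)
    case (Suc n)
    have "\<phi> (x + 2 * pi * real (Suc n)) = \<phi> ((x + 2 * pi * real n) + 2 * pi)"
      by (simp add: algebra_simps)
    then show ?case using assms Suc by simp
  qed simp
  have int: "\<phi> (x + 2 * pi * real_of_int n) = \<phi> x" for x n
  proof (cases "0 \<le> n")
    case True
    then show ?thesis using nat[of x "nat n"] by simp
  next
    case False
    then show ?thesis using nat[of "x + 2 * pi * real_of_int n" "nat (- n)"] by simp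
  qed
  fix z w :: "complex^'n" assume "covering z = covering w"
  then have "cis (Re (z $ j)) = cis (Re (w $ j))" by (simp add: covering_def vec_eq_iff)
  then obtain n :: int where "Re (z $ j) = Re (w $ j) + 2 * pi * n" unfolding cis_eq_cis_iff by blast
  then show "\<phi> (Re (z $ j)) = \<phi> (Re (w $ j))" using int by simp
qed

lemma bounded_linear_Re_coordinate: "bounded_linear (\<lambda>z :: complex^'n::finite. Re (z $ j))"
  by (rule bounded_linear_compose[OF bounded_linear_Re bounded_linear_vec_nth])

text \<open>The conjugate linear part of \<open>v \<mapsto> Re (v $ j)\<close> is \<open>cnj (v $ j) / 2\<close>.\<close>

lemma dbar_deriv_coordinate:
  assumes "(\<phi> has_real_derivative \<phi>') (at (Re (z $ j)))"
  shows "dbar_deriv (\<lambda>z :: complex^'n::finite. of_real (\<phi> (Re (z $ j))) * c) z v = of_real \<phi>' * cnj (v $ j) / 2 * c"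
proof -
  have "((\<lambda>z :: complex^'n. Re (z $ j)) has_derivative (\<lambda>v. Re (v $ j))) (at z)"
    by (rule bounded_linear.has_derivative[OF bounded_linear_Re_coordinate has_derivative_ident])
  from diff_chain_at[OF this assms[unfolded has_field_derivative_def]]
  have "((\<lambda>z. \<phi> (Re (z $ j))) has_derivative (\<lambda>v. \<phi>' * Re (v $ j))) (at z)"
    by (simp add: o_def)
  then have "((\<lambda>z. of_real (\<phi> (Re (z $ j))) * c) has_derivative (\<lambda>v. of_real (\<phi>' * Re (v $ j)) * c)) (at z)"
    by (intro has_derivative_mult_left has_derivative_of_real)
  then have "dbar_deriv (\<lambda>z. of_real (\<phi> (Re (z $ j))) * c) z v =
      (of_real (\<phi>' * Re (v $ j)) * c + \<i> * (of_real (\<phi>' * Re ((\<i> *s v) $ j)) * c)) / 2"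
    by (rule dbar_deriv_eq)
  also have "\<dots> = of_real \<phi>' * (of_real (Re (v $ j)) - \<i> * of_real (Im (v $ j))) / 2 * c"
    by (simp add: field_simps)
  also have "of_real (Re (v $ j)) - \<i> * of_real (Im (v $ j)) = cnj (v $ j)"
    by (simp add: complex_eq_iff)
  finally show ?thesis .
qed

definition coordinate_form ::
    "(real \<Rightarrow> real) \<Rightarrow> 'n::finite \<Rightarrow> 'n list \<Rightarrow> complex^'n \<Rightarrow> (complex^'n) list \<Rightarrow> complex" where
  "coordinate_form \<phi> j J z vs = of_real (\<phi> (Re (z $ j))) * dzbar J vs"

lemma coordinate_form_in_periodic_forms:
  assumes "\<And>k. Ck_on k \<phi> UNIV" "\<And>x. \<phi> (x + 2 * pi) = \<phi> x"
  shows "coordinate_form \<phi> j J \<in> periodic_forms (length J)"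
proof (rule periodic_formsI)
  fix z and vs :: "(complex^'a) list"
  show "periodic (\<lambda>z. coordinate_form \<phi> j J z vs)"
    unfolding coordinate_form_def using assms(2) by (intro periodic_coordinate) simp
  show "antilinear_alternating (length J) (coordinate_form \<phi> j J z)"
    unfolding coordinate_form_def by (intro alternating_cmult alternating_dzbar)
  show "coordinate_form \<phi> j J z vs = 0" if "length vs \<noteq> length J"
    using dzbar_wrong_length[OF that] by (simp add: coordinate_form_def)
  show "smooth_map_on (\<lambda>z. coordinate_form \<phi> j J z vs) UNIV"
    unfolding smooth_map_on_def coordinate_form_def
    by (intro allI Ck_on_mult Ck_on_const Ck_on_bounded_linear[OF bounded_linear_of_real]
        Ck_on_compose_linear[OF bounded_linear_Re_coordinate] assms) auto
qed

lemma coordinate_form_neq_0: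
  assumes "\<phi> x \<noteq> 0" "distinct J"
  shows "coordinate_form \<phi> j J \<noteq> (\<lambda>z vs. 0)"
proof
  assume "coordinate_form \<phi> j J = (\<lambda>z vs. 0)"
  then have "coordinate_form \<phi> j J (\<chi> i. of_real x) (map (\<lambda>j. axis j 1) J) = 0" by simp
  then show False using assms by (simp add: coordinate_form_def dzbar_axis)
qed

lemma periodic_dbar_coordinate_form:
  assumes "\<And>x. (\<phi> has_real_derivative \<phi>' x) (at x)"
  shows "periodic_dbar (coordinate_form \<phi> j J) = coordinate_form (\<lambda>x. 1 / 2 * \<phi>' x) j (j # J)"
  by (simp add: fun_eq_iff periodic_dbar_def coordinate_form_def wedge_def dbar_deriv_coordinate[OF assms]
      sum_distrib_left mult_ac)

context torus_weight
begin

text \<open>Only \<open>d(cnj z\<^sub>j)\<close> is contracted, because coefficient and weight depend on \<open>z\<^sub>j\<close> alone.  In terms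
  of the orthonormal basis: the sum over its vectors assembles the standard basis vector \<open>e\<^sub>j\<close>, and
  inserting \<open>e\<^sub>j\<close> into \<open>d(cnj z\<^sub>j) \<and> d(cnj z\<^sub>J)\<close> leaves \<open>d(cnj z\<^sub>J)\<close>.\<close>

lemma formal_adjoint_coordinate_form:
  assumes W: "\<And>z. W z = w (Re (z $ j))" and "j \<notin> set J"
    and b: "\<And>x. ((\<lambda>x. w x * b x) has_real_derivative - 2 * w x * g x) (at x)"
  shows "formal_adjoint (coordinate_form b j (j # J)) = coordinate_form g j J"
proof (intro ext)
  fix z :: "complex^'n" and vs :: "(complex^'n) list"
  define T where "T = (\<lambda>v. dzbar (j # J) (v # vs))"
  have "dbar_deriv (\<lambda>z. of_real (W z) * cnj (coordinate_form b j (j # J) z (onb i # vs))) z (onb i) =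
      - of_real (W z * g (Re (z $ j))) * cnj (onb i $ j * T (onb i))" for i
  proof -
    have "(\<lambda>z. of_real (W z) * cnj (coordinate_form b j (j # J) z (onb i # vs))) =
        (\<lambda>z. of_real (w (Re (z $ j)) * b (Re (z $ j))) * cnj (T (onb i)))"
      unfolding coordinate_form_def T_def W by (simp add: fun_eq_iff del: dzbar.simps)
    then show ?thesis
      using dbar_deriv_coordinate[OF b, where j = j and z = z and c = "cnj (T (onb i))" and v = "onb i"]
      by (simp add: W)
  qed
  then have "formal_adjoint (coordinate_form b j (j # J)) z vs =
      - (\<Sum>i\<in>UNIV. - of_real (W z * g (Re (z $ j))) * (onb i $ j * T (onb i))) / of_real (W z)"
    unfolding formal_adjoint_def by simp
  also have "\<dots> = of_real (g (Re (z $ j))) * (\<Sum>i\<in>UNIV. onb i $ j * T (onb i))"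
    by (simp add: sum_negf mult.assoc flip: sum_distrib_left)
  also have "(\<Sum>i\<in>UNIV. onb i $ j * T (onb i)) = dzbar J vs"
  proof (cases "length vs = length J")
    case True
    have "(\<Sum>i\<in>UNIV. onb i $ j * T (onb i)) = (\<Sum>i\<in>UNIV. cnj (cnj (onb i $ j)) * dzbar (j # J) ([] @ onb i # vs))"
      by (simp add: T_def del: dzbar.simps)
    also have "\<dots> = dzbar (j # J) ([] @ (\<Sum>i\<in>UNIV. cnj (onb i $ j) *s onb i) # vs)"
      using True by (intro alternating_sum[OF alternating_dzbar, symmetric]) auto
    also have "\<dots> = dzbar J vs"
      unfolding axis_eq_sum_onb[symmetric] using dzbar_Cons_axis[OF assms(2)] by simp
    finally show ?thesis .
  next
    case False
    then have "T v = 0" for v unfolding T_def by (intro dzbar_wrong_length) simp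
    then show ?thesis using dzbar_wrong_length[OF False] by simp
  qed
  finally show "formal_adjoint (coordinate_form b j (j # J)) z vs = coordinate_form g j J z vs"
    by (simp only: coordinate_form_def[of g])
qed

text \<open>With \<open>g = f'\<close>, the Cauchy-Riemann operator sends \<open>f d(cnj z\<^sub>J)\<close> to \<open>1/2 g d(cnj z\<^sub>j) \<and> d(cnj z\<^sub>J)\<close>,
  and its adjoint sends \<open>g d(cnj z\<^sub>j) \<and> d(cnj z\<^sub>J)\<close> to \<open>l/2 f d(cnj z\<^sub>J)\<close>.  So both composites multiply
  by \<open>l/4\<close>.  In degree \<open>q > 0\<close> the other half of the Laplacian gives zero, as \<open>d(cnj z\<^sub>j)\<close> would occur
  twice.\<close>

lemma small_eigenvalue:
  fixes k :: nat and j :: 'n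
  assumes W: "\<And>z. W z = exp (- real k * (cos (Re (z $ j)))\<^sup>2)" and q: "q \<le> CARD('n)"
  shows "\<exists>\<mu>. 0 < \<mu> \<and> \<mu> \<le> exp (- real k / 2) \<and>
    laplacian_eigenvalue torus_manifold flat_metric trivial_bundle (weight_metric W) q \<mu>"
proof -
  define w where "w = (\<lambda>x. exp (- real k * (cos x)\<^sup>2))"
  have W: "W z = w (Re (z $ j))" for z by (simp add: W w_def)
  obtain l f p where l: "0 < l" "l \<le> 4 * exp (- real k / 2)" and p0: "p 0 = 1"
    and f': "\<And>x. (f has_real_derivative p x / exp (- real k * (cos x)\<^sup>2)) (at x)"
    and p': "\<And>x. (p has_real_derivative - l * exp (- real k * (cos x)\<^sup>2) * f x) (at x)"
    and fper: "\<And>x. f (x + 2 * pi) = f x" and pper: "\<And>x. p (x + 2 * pi) = p x"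
    by (rule exponentially_small_periodic_eigenvalue[of k], rule that)
  have f: "(f has_real_derivative p x / w x) (at x)" and p: "(p has_real_derivative - l * w x * f x) (at x)" for x
    unfolding w_def by (rule f', rule p')
  define g where "g = (\<lambda>x. p x / w x)"
  have w_pos: "w x > 0" for x by (simp add: w_def)
  have wg: "w x * g x = p x" for x using w_pos[of x] by (simp add: g_def)
  have w_smooth: "Ck_on i w UNIV" for i unfolding w_def by (rule Ck_on_exp_cos_squared)
  have winv_smooth: "Ck_on i (\<lambda>x. inverse (w x)) UNIV" for i
    by (rule Ck_on_inverse[OF w_smooth]) (use w_pos in \<open>auto simp: less_imp_neq[symmetric]\<close>)
  have fp_smooth: "Ck_on i f UNIV \<and> Ck_on i p UNIV" for i
  proof (rule sturm_liouville_smooth[OF winv_smooth])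
    show "Ck_on i (\<lambda>x. - l * w x) UNIV" for i by (intro Ck_on_mult Ck_on_const w_smooth) auto
    show "(f has_real_derivative inverse (w x) * p x) (at x)" for x
      using f[of x] by (simp add: divide_inverse mult.commute)
    show "(p has_real_derivative - l * w x * f x) (at x)" for x by (rule p)
  qed
  have g_smooth: "Ck_on i g UNIV" for i
    unfolding g_def divide_inverse by (intro Ck_on_mult winv_smooth) (use fp_smooth in auto)
  have w_per: "w (x + 2 * pi) = w x" for x by (simp add: w_def)
  have g_per: "g (x + 2 * pi) = g x" for x by (simp add: g_def pper w_per)
  have g0: "g 0 \<noteq> 0" using w_pos[of 0] by (simp add: g_def p0)
  have "\<exists>x. f x \<noteq> 0"
  proof (rule ccontr)
    assume "\<not> ?thesis"
    then have "f = (\<lambda>x. 0)" by auto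
    then have "((\<lambda>x. 0) has_real_derivative g 0) (at 0)" using f[of 0] by (simp add: g_def)
    then have "g 0 = 0" using DERIV_unique[OF _ DERIV_const] by blast
    then show False using g0 by simp
  qed
  then obtain x\<^sub>0 where x\<^sub>0: "f x\<^sub>0 \<noteq> 0" by blast
  have dg: "((\<lambda>x. w x * (c * g x)) has_real_derivative - 2 * w x * (c * (l / 2) * f x)) (at x)" for c x
  proof -
    have "(\<lambda>x. w x * (c * g x)) = (\<lambda>x. c * p x)"
      using wg by (simp add: fun_eq_iff mult.left_commute)
    then show ?thesis using DERIV_cmult[OF p, of c x] by (simp add: mult_ac)
  qed
  have df: "(f has_real_derivative g x) (at x)" for x using f by (simp add: g_def)
  have "0 < l / 4" "l / 4 \<le> exp (- real k / 2)" using l by auto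
  moreover have "laplacian_eigenvalue torus_manifold flat_metric trivial_bundle (weight_metric W) q (l / 4)"
    unfolding laplacian_eigenvalue_iff
  proof (cases q)
    case 0
    let ?A = "coordinate_form f j []"
    have "periodic_laplacian 0 ?A = formal_adjoint (coordinate_form (\<lambda>x. 1 / 2 * g x) j [j])"
      by (simp add: periodic_laplacian_def fun_eq_iff periodic_dbar_coordinate_form[OF df])
    also have "\<dots> = coordinate_form (\<lambda>x. 1 / 2 * (l / 2) * f x) j []"
      by (rule formal_adjoint_coordinate_form[OF W _ dg]) simp
    finally have "periodic_laplacian 0 ?A = (\<lambda>z vs. of_real (l / 4) * ?A z vs)"
      by (simp add: coordinate_form_def fun_eq_iff)
    moreover have "?A \<in> periodic_forms 0"
      using coordinate_form_in_periodic_forms[of f j "[]"] fp_smooth fper by simp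
    moreover have "?A \<noteq> (\<lambda>z vs. 0)" using coordinate_form_neq_0[of f x\<^sub>0 "[]"] x\<^sub>0 by simp
    ultimately show "\<exists>A\<in>periodic_forms q. A \<noteq> (\<lambda>z vs. 0) \<and>
        periodic_laplacian q A = (\<lambda>z vs. of_real (l / 4) * A z vs)"
      unfolding 0 by blast
  next
    case (Suc r)
    have "r \<le> card (UNIV - {j})" using q Suc by simp
    then obtain S where S: "S \<subseteq> UNIV - {j}" "card S = r"
      by (meson obtain_subset_with_card_n)
    obtain J where J: "set J = S" "distinct J"
      using finite_distinct_list[of S] by (meson finite_subset finite)
    have J': "length J = r" "j \<notin> set J" using S J distinct_card[OF J(2)] by auto
    let ?A = "coordinate_form g j (j # J)"
    obtain g' where g': "\<And>x. (g has_real_derivative g' x) (at x)"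
    proof -
      have "g differentiable (at x)" for x using g_smooth[of "Suc 0"] by simp
      then show thesis using that unfolding real_differentiable_def by metis
    qed
    have "formal_adjoint ?A = coordinate_form (\<lambda>x. 1 * (l / 2) * f x) j J"
      using formal_adjoint_coordinate_form[OF W J'(2) dg[of 1]] by simp
    then have adj: "periodic_dbar (formal_adjoint ?A) = coordinate_form (\<lambda>x. 1 / 2 * (l / 2 * g x)) j (j # J)"
      using periodic_dbar_coordinate_form[OF DERIV_cmult[OF df], of "l / 2" j J] by simp
    have "periodic_dbar ?A = (\<lambda>z vs. 0)"
      unfolding periodic_dbar_coordinate_form[OF g'] coordinate_form_def dzbar_repeated by simp
    then have "formal_adjoint (periodic_dbar ?A) = (\<lambda>z vs. 0)"
      by (simp add: formal_adjoint_def fun_eq_iff)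
    then have "periodic_laplacian (Suc r) ?A = (\<lambda>z vs. of_real (l / 4) * ?A z vs)"
      unfolding periodic_laplacian_def nat.case adj by (simp add: coordinate_form_def mult.assoc del: dzbar.simps)
    moreover have "?A \<in> periodic_forms (Suc r)"
      using coordinate_form_in_periodic_forms[of g j "j # J"] g_smooth g_per J' by simp
    moreover have "?A \<noteq> (\<lambda>z vs. 0)" using coordinate_form_neq_0[of g 0 "j # J"] g0 J J' by simp
    ultimately show "\<exists>A\<in>periodic_forms q. A \<noteq> (\<lambda>z vs. 0) \<and>
        periodic_laplacian q A = (\<lambda>z vs. of_real (l / 4) * A z vs)"
      unfolding Suc by blast
  qed
  ultimately show ?thesis by blast
qed

end

lemma powr_times_exp_tendsto_0: "(\<lambda>k::nat. real k powr N * exp (- real k / 2)) \<longlonglongrightarrow> 0"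
proof -
  define n where "n = nat \<lceil>N\<rceil>"
  have n: "N \<le> real n" unfolding n_def by linarith
  have "filterlim (\<lambda>k. real k / 2) at_top sequentially"
    by (rule filterlim_at_top_mult_tendsto_pos[of _ "1/2", OF tendsto_const _ filterlim_real_sequentially, simplified])
  from filterlim_compose[OF tendsto_power_div_exp_0[of n] this]
  have "(\<lambda>k. 2 ^ n * ((real k / 2) ^ n / exp (real k / 2))) \<longlonglongrightarrow> 2 ^ n * 0"
    by (intro tendsto_mult tendsto_const)
  then have lim: "(\<lambda>k. real k ^ n * exp (- real k / 2)) \<longlonglongrightarrow> 0"
    by (simp add: power_divide exp_minus field_simps)
  show ?thesis
  proof (rule tendsto_sandwich[OF _ _ tendsto_const lim])
    show "\<forall>\<^sub>F k in sequentially. 0 \<le> real k powr N * exp (- real k / 2)" by simp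
    show "\<forall>\<^sub>F k in sequentially. real k powr N * exp (- real k / 2) \<le> real k ^ n * exp (- real k / 2)"
      using eventually_ge_at_top[of 1]
    proof eventually_elim
      case (elim k)
      then have "real k powr N \<le> real k powr real n" using n by (intro powr_mono) auto
      also have "\<dots> = real k ^ n" using elim by (simp add: powr_realpow)
      finally show ?case by (intro mult_right_mono) auto
    qed
  qed
qed

theorem theorem10p1:
  fixes q :: nat
  assumes "q \<le> CARD('n::finite)"
  shows "\<exists>(M :: ((complex^'n) \<times> (complex^'n), 'n) cmanifold) h
            (L :: ((complex^'n) \<times> (complex^'n), nat) line_bundle) a.
           complex_manifold M \<and> compact_space (pts M) \<and> hermitian_metric M h \<and>
           holomorphic_line_bundle M L \<and> bundle_metric M L a \<and>
           (\<forall>N::real. N > 0 \<longrightarrow>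
              (\<lambda>k::nat. ereal (real k powr N) *
                 inf_nonzero_eigenvalue M h (bundle_power L k) (metric_power a k) q)
              \<longlonglongrightarrow> 0)"
proof -
  fix j :: 'n
  \<comment> \<open>A \<open>k\<close>-th power of this weight is the weight of \<open>small_eigenvalue\<close>.\<close>
  define V :: "complex^'n \<Rightarrow> real" where "V = (\<lambda>z. exp (- 1 * (cos (Re (z $ j)))\<^sup>2))"
  have V: "periodic V" "V z > 0" "smooth_map_on V UNIV" for z
  proof -
    show "periodic V" unfolding V_def by (rule periodic_coordinate[of "\<lambda>x. exp (- 1 * (cos x)\<^sup>2)"]) simp
    show "V z > 0" by (simp add: V_def)
    show "smooth_map_on V UNIV"
      unfolding smooth_map_on_def V_def
      by (intro allI Ck_on_compose_linear[OF bounded_linear_Re_coordinate Ck_on_exp_cos_squared]) simp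
  qed
  define gap where "gap = (\<lambda>k. inf_nonzero_eigenvalue torus_manifold flat_metric
    (bundle_power trivial_bundle k) (metric_power (weight_metric V) k) q)"
  have gap: "0 \<le> gap k" "gap k \<le> ereal (exp (- real k / 2))" for k
  proof -
    have Vk: "V z ^ k = exp (- real k * (cos (Re (z $ j)))\<^sup>2)" for z
      unfolding V_def by (simp flip: exp_of_nat_mult)
    interpret torus_weight "\<lambda>z. V z ^ k"
    proof
      show "periodic (\<lambda>z. V z ^ k)"
        by (intro periodicI arg_cong2[where f = power] refl periodicD[OF V(1)])
      show "V z ^ k > 0" for z using V(2) by simp
      show "smooth_map_on (\<lambda>z. V z ^ k) UNIV"
        using V(3) by (auto simp: smooth_map_on_def intro: Ck_on_power)
    qed
    have eq: "gap k = Inf {ereal \<mu> | \<mu>. \<mu> \<noteq> 0 \<and>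
        laplacian_eigenvalue torus_manifold flat_metric trivial_bundle (weight_metric (\<lambda>z. V z ^ k)) q \<mu>}"
      by (simp add: gap_def inf_nonzero_eigenvalue_def bundle_power_trivial metric_power_weight)
    show "0 \<le> gap k"
      unfolding eq by (intro Inf_greatest) (use laplacian_eigenvalue_nonneg in auto)
    obtain \<mu> where \<mu>: "0 < \<mu>" "\<mu> \<le> exp (- real k / 2)"
      "laplacian_eigenvalue torus_manifold flat_metric trivial_bundle (weight_metric (\<lambda>z. V z ^ k)) q \<mu>"
      using small_eigenvalue[OF Vk assms] by blast
    have "gap k \<le> ereal \<mu>"
      unfolding eq by (rule Inf_lower) (use \<mu> in auto)
    also have "\<dots> \<le> ereal (exp (- real k / 2))" using \<mu>(2) by simp
    finally show "gap k \<le> ereal (exp (- real k / 2))" .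
  qed
  have "(\<lambda>k. ereal (real k powr N) * gap k) \<longlonglongrightarrow> 0" for N
  proof (rule tendsto_sandwich[OF _ _ tendsto_const])
    show "\<forall>\<^sub>F k in sequentially. 0 \<le> ereal (real k powr N) * gap k"
      using gap(1) by (intro always_eventually allI) simp
    show "\<forall>\<^sub>F k in sequentially. ereal (real k powr N) * gap k \<le> ereal (real k powr N * exp (- real k / 2))"
    proof (intro always_eventually allI)
      fix k
      have "ereal (real k powr N) * gap k \<le> ereal (real k powr N) * ereal (exp (- real k / 2))"
        using gap(2) by (intro ereal_mult_left_mono) auto
      then show "ereal (real k powr N) * gap k \<le> ereal (real k powr N * exp (- real k / 2))" by simp
    qed
    show "(\<lambda>k. ereal (real k powr N * exp (- real k / 2))) \<longlonglongrightarrow> 0"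
      using powr_times_exp_tendsto_0[of N] unfolding zero_ereal_def by (rule tendsto_ereal)
  qed
  then show ?thesis
    using complex_manifold_torus compact_space_torus hermitian_metric_flat
      holomorphic_line_bundle_trivial bundle_metric_weight[OF V]
    unfolding gap_def by blast
qed

end
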